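(* Let $J(\lambda)\in\mathcal{U}_{F_1}^{\otimes2}$ be a dynamical twist with respect to $T$. The $T$-bialgebroid $\mathcal{A}^J$ is a $T$-Hopf algebroid with antipode $S^J:\mathcal{A}^J\to\mathcal{A}^J$ defined by $$S^J(a(\lambda,\mu))=S_{\mathcal{A}}\bigl(K^J(\lambda-\beta)\cdot a(\mu-\alpha,\lambda-\beta)\cdot Q^J(\mu)\bigr),\qquad a(\lambda,\mu)\in\mathcal{A}_K[\alpha,\beta].$$ In particular, $$S^J(a)=S_{\mathcal{A}}\bigl(K^J(\lambda-h)\cdot a\cdot Q^J(\mu)\bigr)\qquad\forall\,a\in\mathcal{A}.$$
   Context: **Hopf algebra $\mathcal{U}$ and $T$.** $\otimes=\otimes_{\mathbb{C}}$. $(\mathcal{U},m_{\mathcal{U}},1_{\mathcal{U}},\Delta_{\mathcal{U}},\epsilon_{\mathcal{U}},S_{\mathcal{U}})$ is a Hopf algebra over $\mathbb{C}$. For $u\in\mathcal{U}^{\otimes k}$, $u_{i_1\cdots i_k}\in\mathcal{U}^{\otimes n}$ denotes the element obtained by placing the $j$th tensor component of $u$ in position $i_j$ and $1_{\mathcal{U}}$ elsewhere. $\Delta_{\mathcal{U}j},\epsilon_{\mathcal{U}j},S_{\mathcal{U}j}$ denote $\Delta_{\mathcal{U}},\epsilon_{\mathcal{U}},S_{\mathcal{U}}$ acting on the $j$th tensor component. For a commutative $\mathbb{C}$-algebra $L$, $\mathcal{U}_L=L\otimes\mathcal{U}$ and $\mathcal{U}_L^{\otimes n}=L\otimes\mathcal{U}^{\otimes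 n}$, with all structure maps extended $L$-linearly. $G(\mathcal{U})=\{u:\Delta_{\mathcal{U}}(u)=u\otimes u,\ \epsilon_{\mathcal{U}}(u)=1\}$ and $T\subseteq G(\mathcal{U})$ is a finite abelian subgroup with character group $\widehat{T}$ (written additively; the value of $\alpha\in\widehat{T}$ at $t\in T$ is $t^\alpha$). It is assumed that $\mathcal{U}$ is $\mathrm{ad}(T)$-semisimple: $\mathcal{U}=\bigoplus_{\alpha\in\widehat{T}}\mathcal{U}[\alpha]$, $\mathcal{U}[\alpha]=\{u: tut^{-1}=t^\alpha u\ \forall t\in T\}$. Put $\pi_\alpha=\frac{1}{\#T}\sum_{t\in T}t^{-\alpha}t\in\mathcal{U}$. **Dynamical variables.** $F$ is the $\mathbb{C}$-algebra of complex valued functions on $\widehat{T}$ and $K=F\otimes F$, whose elements are written $f(\lambda,\mu)$; $f(\lambda)=f\otimes1_F$, $f(\mu)=1_F\otimes f$; $F_1=F\otimes 1_F$, $F_2=1_F\otimes F$. An element $u(\lambda)\in\mathcal{U}^{\otimes n}_{F_1}$ has a copy $u(\mu)\in\mathcal{U}^{\otimes n}_{F_2}$. Shifts of arguments by elements of $\widehat{T}$ act on the $K$-coefficients. For $u(\lambda)\in\mathcal{U}_{F_1}^{\otimes n}$, $u(\lambda\pm h^{(j)})=\sum_{\alpha\in\widehat{T}}u(\lambda\pm\alpha)\pi_{\alpha j}$ ($\pi_{\alpha j}$ is $\pi_\alpha$ in position $j$); for $n=1$ write $u(\lambda\pm h)=\sum_\alpha u(\lambda\pm\alpha)\pi_\alpha$.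 An element $u\in\mathcal{U}_K^{\otimes n}$ has zero $T$-weight if it commutes with $t^{\otimes n}$ for all $t\in T$. A *dynamical twist* with respect to $T$ is an invertible zero $T$-weight element $J(\lambda)\in\mathcal{U}_{F_1}^{\otimes2}$ with $\epsilon_{\mathcal{U}1}(J(\lambda))=1_{\mathcal{U}}=\epsilon_{\mathcal{U}2}(J(\lambda))$ and $\Delta_{\mathcal{U}1}(J(\lambda))J_{12}(\lambda+h^{(3)})=\Delta_{\mathcal{U}2}(J(\lambda))J_{23}(\lambda)$. Put $K^J(\lambda)=m_{\mathcal{U}}(S_{\mathcal{U}1}(J(\lambda)))$ and $Q^J(\lambda)=m_{\mathcal{U}}(S_{\mathcal{U}2}(J^{-1}(\lambda)))$. **Hopf algebra $\mathcal{A}$.** $(\mathcal{A},m_{\mathcal{A}},1_{\mathcal{A}},\Delta_{\mathcal{A}},\epsilon_{\mathcal{A}},S_{\mathcal{A}})$ is a Hopf algebra over $\mathbb{C}$ with a fixed Hopf algebra pairing $\langle\cdot,\cdot\rangle:\mathcal{U}\times\mathcal{A}\to\mathbb{C}$. The regular actions $u\cdot a=\sum\langle u,a_{(2)}\rangle a_{(1)}$, $a\cdot u=\sum\langle u,a_{(1)}\rangle a_{(2)}$ make $\mathcal{A}$ a $\mathcal{U}$-bimodule. All of this is extended $K$-linearly to $\mathcal{A}_K=K\otimes\mathcal{A}$, a $\mathcal{U}_K$-bimodule, and componentwise to $\mathcal{A}_K^{\otimes n}=K\otimes\mathcal{A}^{\otimes n}$, a $\mathcal{U}_K^{\otimes n}$-bimodule;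 $m_{\mathcal{A}}$ is the $K$-linear multiplication. It is assumed that $\mathcal{A}$ is $(T-T)$-semisimple: $\mathcal{A}=\bigoplus_{\alpha,\beta\in\widehat{T}}\mathcal{A}[\alpha,\beta]$, $\mathcal{A}[\alpha,\beta]=\{a: t\cdot a=t^\beta a,\ a\cdot t=t^\alpha a\ \forall t\in T\}$; $\mathcal{A}_K[\alpha,\beta]=K\otimes\mathcal{A}[\alpha,\beta]$. **$T$-Hopf algebroids.** $(T_\alpha f)(\lambda)=f(\lambda+\alpha)$ for $f\in F$. A *$T$-algebra* is a unital associative $\mathbb{C}$-algebra $A$ (product $\circ$) with a $\widehat{T}$-bigrading $A=\bigoplus A_{\alpha\beta}$ and unital algebra embeddings (moment maps) $\mu_l,\mu_r:F\to A_{00}$ with $\mu_l(f)\circ\mu_r(g)=\mu_r(g)\circ\mu_l(f)$, $\mu_l(f)\circ a=a\circ\mu_l(T_\alpha f)$, $\mu_r(f)\circ a=a\circ\mu_r(T_\beta f)$ for $a\in A_{\alpha\beta}$. Morphisms of $T$-algebras are algebra homomorphisms preserving bigrading and moment maps. $I=\bigoplus_{\alpha}FT_\alpha$ is the $T$-algebra of difference operators, $(fT_\alpha)\circ(gT_\beta)=f(T_\alpha g)T_{\alpha+\beta}$, $I_{\alpha\beta}=\delta_{\alpha,\beta}FT_{-\alpha}$, $\mu_l(f)=\mu_r(f)=fT_0$; for $a=\sum_\alpha a_\alpha T_{-\alpha}\in I$, $a1_F=\sum_\alpha a_\alpha\in F$. The tensor product is $A\widetilde{\otimes}B=\bigoplus_{\alpha,\beta}(A\widetilde{\otimes}B)_{\alpha\beta}$,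 $(A\widetilde{\otimes}B)_{\alpha\beta}=\bigoplus_\gamma A_{\alpha\gamma}\otimes_FB_{\gamma\beta}$ with balancing $(\mu_r(f)\circ a)\otimes_Fb=a\otimes_F(\mu_l(f)\circ b)$, componentwise product, unit $1_A\otimes_F 1_B$, and moment maps $\mu_l(f)=\mu_l^A(f)\otimes_F1$, $\mu_r(f)=1\otimes_F\mu_r^B(f)$. $I\widetilde{\otimes}A$ and $A\widetilde{\otimes}I$ are identified with $A$ via $fT_{-\alpha}\otimes_Fa\mapsto\mu_l(f)\circ a$, $a\otimes_FfT_{-\beta}\mapsto\mu_r(f)\circ a$ ($a\in A_{\alpha\beta}$). A *$T$-bialgebroid* is a $T$-algebra $A$ with $T$-algebra morphisms $\Delta:A\to A\widetilde{\otimes}A$, $\epsilon:A\to I$ satisfying coassociativity and counit axioms. A *$T$-Hopf algebroid* is a $T$-bialgebroid with a $\mathbb{C}$-linear antipode $S:A\to A$ satisfying $S(\mu_r(f)\circ a)=S(a)\circ\mu_l(f)$, $S(a\circ\mu_l(f))=\mu_r(f)\circ S(a)$, and, for $a\in A_{\alpha\beta}$, $m(\mathrm{Id}\otimes S)(\Delta(a))=\mu_l(\epsilon(a)1_F)$ and $m(S\otimes\mathrm{Id})(\Delta(a))=\mu_r(T_\alpha(\epsilon(a)1_F))$, where $m$ is the multiplication of $A$. **The $T$-bialgebroid $\mathcal{A}^J$** has underlying space $\mathcal{A}_K$, bigraded pieces $\mathcal{A}_K[\alpha,\beta]$, multiplication $m^J(a\otimes b)=m_{\mathcal{A}}\bigl(J(\mu)\cdot(a(\lambda+\alpha,\mu+\beta)\otimes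 b(\lambda,\mu))\cdot J^{-1}(\lambda)\bigr)$ for $a\in\mathcal{A}_K$, $b\in\mathcal{A}_K[\alpha,\beta]$, unit $1_{\mathcal{A}}$, moment maps $\mu_l(f)=f(\lambda)1_{\mathcal{A}}$, $\mu_r(f)=f(\mu)1_{\mathcal{A}}$, comultiplication $\Delta=\pi\circ\Delta_{\mathcal{A}}$ and counit $\epsilon(a)=T_{-\alpha}(m_F(\epsilon_{\mathcal{A}}(a)))T_{-\alpha}$ for $a\in\mathcal{A}_K[\alpha,\beta]$. Here $\mathcal{A}_K\widehat{\otimes}_F\mathcal{A}_K$ is the tensor product over $F$ with balancing $(f(\mu)a)\widehat{\otimes}_Fb=a\widehat{\otimes}_F(f(\lambda)b)$, $\mathcal{A}^J\widetilde{\otimes}\mathcal{A}^J$ is identified with its subspace $\bigoplus_{\alpha,\beta,\gamma}\mathcal{A}_K[\alpha,\gamma]\widehat{\otimes}_F\mathcal{A}_K[\gamma,\beta]$, $\pi:K\otimes\mathcal{A}\otimes\mathcal{A}\to\mathcal{A}_K\widehat{\otimes}_F\mathcal{A}_K$ is the linear map with $\pi(f(\lambda)\otimes g(\mu)\otimes a\otimes b)=(f(\lambda)a)\widehat{\otimes}_F(g(\mu)b)$, and $m_F:K=F\otimes F\to F$ is multiplication. *)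

theory Defs
  imports Complex_Main "HOL-Library.Function_Algebras" "HOL-Library.Poly_Mapping"
begin

section \<open>Complex vector spaces and algebras\<close>

class complex_space = ab_group_add +
  fixes scaleC :: "complex \<Rightarrow> 'a \<Rightarrow> 'a"  (infixr "*\<^sub>C" 75)
  assumes scaleC_add_right: "c *\<^sub>C (x + y) = c *\<^sub>C x + c *\<^sub>C y"
    and scaleC_add_left: "(c + d) *\<^sub>C x = c *\<^sub>C x + d *\<^sub>C x"
    and scaleC_scaleC: "c *\<^sub>C d *\<^sub>C x = (c * d) *\<^sub>C x"
    and scaleC_one: "1 *\<^sub>C x = x"

text \<open>Unital associative algebras; the zero algebra is allowed.\<close>

class complex_alg = complex_space + ring + monoid_mult +
  assumes mult_scaleC_left: "(c *\<^sub>C x) * y = c *\<^sub>C (x * y)"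
    and mult_scaleC_right: "x * (c *\<^sub>C y) = c *\<^sub>C (x * y)"

global_interpretation cs: vector_space "scaleC :: complex \<Rightarrow> 'a \<Rightarrow> 'a::complex_space"
  by unfold_locales (simp_all add: scaleC_add_right scaleC_add_left scaleC_scaleC scaleC_one)

abbreviation clinear :: "('a::complex_space \<Rightarrow> 'b::complex_space) \<Rightarrow> bool"
  where "clinear \<equiv> Vector_Spaces.linear scaleC scaleC"

definition cbilinear :: "('a::complex_space \<Rightarrow> 'b::complex_space \<Rightarrow> 'c::complex_space) \<Rightarrow> bool"
  where "cbilinear \<phi> \<longleftrightarrow> (\<forall>y. clinear (\<lambda>x. \<phi> x y)) \<and> (\<forall>x. clinear (\<phi> x))"

lemma clinear_iff:
  "clinear f \<longleftrightarrow> (\<forall>x y. f (x + y) = f x + f y) \<and> (\<forall>c x. f (c *\<^sub>C x) = c *\<^sub>C f x)"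
  by (simp add: Vector_Spaces.linear_iff cs.vector_space_axioms)

lemma clinearI:
  assumes "\<And>x y. f (x + y) = f x + f y" and "\<And>c x. f (c *\<^sub>C x) = c *\<^sub>C f x"
  shows "clinear f"
  using assms by (simp add: clinear_iff)

lemma clinear_add: "clinear f \<Longrightarrow> f (x + y) = f x + f y"
  and clinear_scale: "clinear f \<Longrightarrow> f (c *\<^sub>C x) = c *\<^sub>C f x"
  by (simp_all add: clinear_iff)

lemma clinear_zero: "clinear f \<Longrightarrow> f 0 = 0"
  by (metis clinear_scale cs.scale_zero_left)

lemma clinear_diff: "clinear f \<Longrightarrow> f (x - y) = f x - f y"
  by (metis add_diff_cancel_right' clinear_add diff_add_cancel)

lemma clinear_sum: "clinear f \<Longrightarrow> f (\<Sum>i\<in>I. g i) = (\<Sum>i\<in>I. f (g i))"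
  by (induction I rule: infinite_finite_induct) (simp_all add: clinear_zero clinear_add)

lemma cbilinearI:
  assumes "\<And>x x' y. \<phi> (x + x') y = \<phi> x y + \<phi> x' y"
    and "\<And>x y y'. \<phi> x (y + y') = \<phi> x y + \<phi> x y'"
    and "\<And>c x y. \<phi> (c *\<^sub>C x) y = c *\<^sub>C \<phi> x y"
    and "\<And>c x y. \<phi> x (c *\<^sub>C y) = c *\<^sub>C \<phi> x y"
  shows "cbilinear \<phi>"
  using assms by (simp add: cbilinear_def clinear_iff)

lemma cbilinear_add_left: "cbilinear \<phi> \<Longrightarrow> \<phi> (x + x') y = \<phi> x y + \<phi> x' y"
  and cbilinear_add_right: "cbilinear \<phi> \<Longrightarrow> \<phi> x (y + y') = \<phi> x y + \<phi> x y'"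
  and cbilinear_scale_left: "cbilinear \<phi> \<Longrightarrow> \<phi> (c *\<^sub>C x) y = c *\<^sub>C \<phi> x y"
  and cbilinear_scale_right: "cbilinear \<phi> \<Longrightarrow> \<phi> x (c *\<^sub>C y) = c *\<^sub>C \<phi> x y"
  by (simp_all add: cbilinear_def clinear_iff)

lemmas cbilinear_simps =
  cbilinear_add_left cbilinear_add_right cbilinear_scale_left cbilinear_scale_right

instantiation complex :: complex_alg
begin
definition scaleC_complex :: "complex \<Rightarrow> complex \<Rightarrow> complex" where "scaleC_complex c z = c * z"
instance by intro_classes (simp_all add: scaleC_complex_def algebra_simps)
end

instantiation "fun" :: (type, complex_space) complex_space
begin
definition scaleC_fun :: "complex \<Rightarrow> ('a \<Rightarrow> 'b) \<Rightarrow> 'a \<Rightarrow> 'b"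
  where "scaleC_fun c f = (\<lambda>x. c *\<^sub>C f x)"
instance
  by intro_classes
    (simp_all add: scaleC_fun_def fun_eq_iff scaleC_add_right scaleC_add_left scaleC_scaleC scaleC_one)
end

instantiation poly_mapping :: (type, complex_space) complex_space
begin
definition scaleC_poly_mapping :: "complex \<Rightarrow> ('a \<Rightarrow>\<^sub>0 'b) \<Rightarrow> 'a \<Rightarrow>\<^sub>0 'b"
  where "scaleC_poly_mapping c = Poly_Mapping.map (scaleC c)"
lemma lookup_scaleC: "Poly_Mapping.lookup (c *\<^sub>C p) k = c *\<^sub>C Poly_Mapping.lookup p k"
  by (simp add: scaleC_poly_mapping_def map.rep_eq when_def)
instance
  by intro_classes
    (simp_all add: poly_mapping_eq_iff fun_eq_iff lookup_scaleC lookup_add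
      scaleC_add_right scaleC_add_left scaleC_scaleC scaleC_one)
end

definition minv :: "'a::monoid_mult \<Rightarrow> 'a"
  where "minv x = (THE y. x * y = 1 \<and> y * x = 1)"

definition invertible_elt :: "'a::monoid_mult \<Rightarrow> bool"
  where "invertible_elt x \<longleftrightarrow> (\<exists>y. x * y = 1 \<and> y * x = 1)"

definition is_direct_sum :: "('i::finite \<Rightarrow> 'a::complex_space set) \<Rightarrow> bool"
  where "is_direct_sum V \<longleftrightarrow>
    (\<forall>i. cs.subspace (V i)) \<and> (\<forall>x. \<exists>!c. (\<forall>i. c i \<in> V i) \<and> (\<Sum>i\<in>UNIV. c i) = x)"

definition component :: "('i::finite \<Rightarrow> 'a::complex_space set) \<Rightarrow> 'i \<Rightarrow> 'a \<Rightarrow> 'a"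
  where "component V i x = (THE c. (\<forall>i. c i \<in> V i) \<and> (\<Sum>i\<in>UNIV. c i) = x) i"


section \<open>Tensor products over the complex numbers\<close>

inductive_set tensor_relations ::
    "(('a::complex_space \<times> 'b::complex_space) \<Rightarrow>\<^sub>0 complex) set"
  where
    rel_add_left: "Poly_Mapping.single (a + a', b) 1
      - (Poly_Mapping.single (a, b) 1 + Poly_Mapping.single (a', b) 1) \<in> tensor_relations"
  | rel_add_right: "Poly_Mapping.single (a, b + b') 1
      - (Poly_Mapping.single (a, b) 1 + Poly_Mapping.single (a, b') 1) \<in> tensor_relations"
  | rel_scale_left: "Poly_Mapping.single (c *\<^sub>C a, b) 1
      - c *\<^sub>C Poly_Mapping.single (a, b) 1 \<in> tensor_relations"
  | rel_scale_right: "Poly_Mapping.single (a, c *\<^sub>C b) 1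
      - c *\<^sub>C Poly_Mapping.single (a, b) 1 \<in> tensor_relations"

definition tensor_eq ::
    "(('a::complex_space \<times> 'b::complex_space) \<Rightarrow>\<^sub>0 complex) \<Rightarrow> ('a \<times> 'b \<Rightarrow>\<^sub>0 complex) \<Rightarrow> bool"
  where "tensor_eq p q \<longleftrightarrow> p - q \<in> cs.span tensor_relations"

quotient_type (overloaded) ('a, 'b) tensor = "('a::complex_space \<times> 'b::complex_space) \<Rightarrow>\<^sub>0 complex" / tensor_eq
proof (rule equivpI)
  show "reflp tensor_eq" by (simp add: reflp_def tensor_eq_def cs.span_zero)
  show "symp tensor_eq"
    by (metis cs.span_neg minus_diff_eq sympI tensor_eq_def)
  show "transp tensor_eq"
    by (metis (no_types, lifting) add_diff_eq cs.span_add diff_add_cancel tensor_eq_def transpI)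
qed

instantiation tensor :: (complex_space, complex_space) complex_space
begin

lift_definition zero_tensor :: "('a, 'b) tensor" is 0 .

lift_definition plus_tensor :: "('a, 'b) tensor \<Rightarrow> ('a, 'b) tensor \<Rightarrow> ('a, 'b) tensor" is "(+)"
  by (simp add: tensor_eq_def) (metis (no_types, lifting) add_diff_add cs.span_add)

lift_definition uminus_tensor :: "('a, 'b) tensor \<Rightarrow> ('a, 'b) tensor" is uminus
  by (simp add: tensor_eq_def) (metis cs.span_neg minus_diff_eq)

definition minus_tensor :: "('a, 'b) tensor \<Rightarrow> ('a, 'b) tensor \<Rightarrow> ('a, 'b) tensor"
  where "minus_tensor x y = x + - y"

lift_definition scaleC_tensor :: "complex \<Rightarrow> ('a, 'b) tensor \<Rightarrow> ('a, 'b) tensor" is scaleC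
  by (simp add: tensor_eq_def) (metis cs.scale_right_diff_distrib cs.span_scale)

instance
proof
  fix a b c :: "('a, 'b) tensor" and k l :: complex
  have eq: "tensor_eq p q" if "p = q" for p q :: "'a \<times> 'b \<Rightarrow>\<^sub>0 complex"
    using that by (simp add: tensor_eq_def cs.span_zero)
  show "a + b + c = a + (b + c)" by transfer (rule eq, simp add: add.assoc)
  show "a + b = b + a" by transfer (rule eq, simp add: add.commute)
  show "0 + a = a" by transfer (rule eq, simp)
  show "- a + a = 0" by transfer (rule eq, simp)
  show "a - b = a + - b" by (rule minus_tensor_def)
  show "k *\<^sub>C (a + b) = k *\<^sub>C a + k *\<^sub>C b" by transfer (rule eq, simp add: scaleC_add_right)
  show "(k + l) *\<^sub>C a = k *\<^sub>C a + l *\<^sub>C a" by transfer (rule eq, simp add: scaleC_add_left)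
  show "k *\<^sub>C l *\<^sub>C a = (k * l) *\<^sub>C a" by transfer (rule eq, simp)
  show "1 *\<^sub>C a = a" by transfer (rule eq, simp)
qed

end

lift_definition tensor_pair ::
    "'a::complex_space \<Rightarrow> 'b::complex_space \<Rightarrow> ('a, 'b) tensor"  (infixr "\<otimes>" 72)
  is "\<lambda>a b. Poly_Mapping.single (a, b) 1" .

lemma cbilinear_tensor_pair: "cbilinear (\<otimes>)"
proof (rule cbilinearI)
  fix a a' :: 'a and b b' :: 'b and c :: complex
  have base: "tensor_eq p q" if "p - q \<in> tensor_relations" for p q :: "'a \<times> 'b \<Rightarrow>\<^sub>0 complex"
    using that by (simp add: tensor_eq_def cs.span_base)
  show "(a + a') \<otimes> b = a \<otimes> b + a' \<otimes> b"
    by transfer (rule base, rule tensor_relations.intros)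
  show "a \<otimes> (b + b') = a \<otimes> b + a \<otimes> b'"
    by transfer (rule base, rule tensor_relations.intros)
  show "(c *\<^sub>C a) \<otimes> b = c *\<^sub>C (a \<otimes> b)"
    by transfer (rule base, rule tensor_relations.intros)
  show "a \<otimes> (c *\<^sub>C b) = c *\<^sub>C (a \<otimes> b)"
    by transfer (rule base, rule tensor_relations.intros)
qed

lemmas tensor_pair_simps = cbilinear_simps[OF cbilinear_tensor_pair]

lemma tensor_pair_sum_left: "(\<Sum>i\<in>I. f i) \<otimes> w = (\<Sum>i\<in>I. f i \<otimes> w)"
  by (rule clinear_sum[of "\<lambda>v. v \<otimes> w"]) (simp add: clinear_iff tensor_pair_simps)

lemma tensor_pair_sum_right: "w \<otimes> (\<Sum>i\<in>I. f i) = (\<Sum>i\<in>I. w \<otimes> f i)"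
  by (rule clinear_sum) (simp add: clinear_iff tensor_pair_simps)

lemma poly_mapping_induct_scale [case_names zero single add]:
  assumes "P 0" and "\<And>k. P (Poly_Mapping.single k 1)" 
    and "\<And>p q c. P p \<Longrightarrow> P q \<Longrightarrow> P (c *\<^sub>C p + q)"
  shows "P (p :: 'k \<Rightarrow>\<^sub>0 complex)"
proof -
  have *: "p = (\<Sum>k\<in>Poly_Mapping.keys p. Poly_Mapping.lookup p k *\<^sub>C Poly_Mapping.single k 1)" for p :: "'k \<Rightarrow>\<^sub>0 complex"
  proof (rule poly_mapping_eqI)
    fix j
    have "(\<Sum>k\<in>Poly_Mapping.keys p. Poly_Mapping.lookup p k * Poly_Mapping.lookup (Poly_Mapping.single k 1) j)
      = (\<Sum>k\<in>Poly_Mapping.keys p. if k = j then Poly_Mapping.lookup p k else 0)"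
      by (rule sum.cong) (auto simp: lookup_single)
    also have "\<dots> = Poly_Mapping.lookup p j" by (simp add: in_keys_iff)
    finally show "Poly_Mapping.lookup p j = Poly_Mapping.lookup (\<Sum>k\<in>Poly_Mapping.keys p. Poly_Mapping.lookup p k *\<^sub>C Poly_Mapping.single k 1) j"
      by (simp add: lookup_sum lookup_scaleC scaleC_complex_def)
  qed
  have "P (\<Sum>k\<in>K. f k *\<^sub>C Poly_Mapping.single k 1)" for K f
    by (induction K rule: infinite_finite_induct) (auto intro: assms)
  then show ?thesis using *[of p] by metis
qed


definition free_eval ::
    "('a \<Rightarrow> 'b \<Rightarrow> 'c) \<Rightarrow> ('a::complex_space \<times> 'b::complex_space \<Rightarrow>\<^sub>0 complex) \<Rightarrow> 'c::complex_space"
  where "free_eval \<phi> p = (\<Sum>(a, b)\<in>Poly_Mapping.keys p. Poly_Mapping.lookup p (a, b) *\<^sub>C \<phi> a b)"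

text \<open>The linear map with \<open>a \<otimes> b \<mapsto> \<phi> a b\<close>; only meaningful for bilinear \<open>\<phi>\<close>.\<close>

definition tensor_lift ::
    "('a::complex_space \<Rightarrow> 'b::complex_space \<Rightarrow> 'c::complex_space) \<Rightarrow> ('a, 'b) tensor \<Rightarrow> 'c"
  where "tensor_lift \<phi> x = free_eval \<phi> (rep_tensor x)"

lemma free_eval_single: "free_eval \<phi> (Poly_Mapping.single (a, b) 1) = \<phi> a b"
  by (simp add: free_eval_def scaleC_one)

lemma free_eval_superset:
  assumes "finite K" "Poly_Mapping.keys p \<subseteq> K"
  shows "free_eval \<phi> p = (\<Sum>(a, b)\<in>K. Poly_Mapping.lookup p (a, b) *\<^sub>C \<phi> a b)"
  unfolding free_eval_def using assms
  by (intro sum.mono_neutral_left) (auto simp: in_keys_iff)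

lemma clinear_free_eval: "clinear (free_eval \<phi>)"
proof (rule clinearI)
  fix p q :: "'a \<times> 'b \<Rightarrow>\<^sub>0 complex" and c
  let ?K = "Poly_Mapping.keys p \<union> Poly_Mapping.keys q"
  have "free_eval \<phi> r = (\<Sum>(a, b)\<in>?K. Poly_Mapping.lookup r (a, b) *\<^sub>C \<phi> a b)"
    if "r \<in> {p, q, p + q}" for r
    using that Poly_Mapping.keys_add[of p q] by (intro free_eval_superset) auto
  then show "free_eval \<phi> (p + q) = free_eval \<phi> p + free_eval \<phi> q"
    by (simp add: lookup_add scaleC_add_left sum.distrib case_prod_unfold)
  have "free_eval \<phi> (c *\<^sub>C p)
      = (\<Sum>(a, b)\<in>Poly_Mapping.keys p. Poly_Mapping.lookup (c *\<^sub>C p) (a, b) *\<^sub>C \<phi> a b)"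
    by (intro free_eval_superset) (auto simp: in_keys_iff lookup_scaleC scaleC_complex_def)
  also have "\<dots> = c *\<^sub>C free_eval \<phi> p"
    by (simp add: free_eval_def cs.scale_sum_right lookup_scaleC scaleC_complex_def case_prod_unfold)
  finally show "free_eval \<phi> (c *\<^sub>C p) = c *\<^sub>C free_eval \<phi> p" .
qed

lemma free_eval_relations:
  assumes "cbilinear \<phi>" and "p \<in> cs.span tensor_relations"
  shows "free_eval \<phi> p = 0"
  using assms(2)
proof (induction rule: cs.span_induct_alt)
  case base
  show ?case by (rule clinear_zero[OF clinear_free_eval])
next
  case (step c r p)
  have "free_eval \<phi> r = 0"
    using step(1)
    by cases (simp_all add: clinear_add[OF clinear_free_eval] clinear_diff[OF clinear_free_eval]
        clinear_scale[OF clinear_free_eval] free_eval_single cbilinear_simps[OF assms(1)])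
  then show ?case
    using step by (simp add: clinear_add[OF clinear_free_eval] clinear_scale[OF clinear_free_eval])
qed

lemma tensor_lift_abs:
  assumes "cbilinear \<phi>"
  shows "tensor_lift \<phi> (abs_tensor p) = free_eval \<phi> p"
proof -
  have "tensor_eq (rep_tensor (abs_tensor p)) p"
    by (rule Quotient3_rep_abs[OF Quotient3_tensor]) (simp add: tensor_eq_def cs.span_zero)
  then show ?thesis
    using free_eval_relations[OF assms] clinear_diff[OF clinear_free_eval, of \<phi>]
    by (fastforce simp: tensor_lift_def tensor_eq_def)
qed

lemma tensor_lift_pair:
  assumes "cbilinear \<phi>"
  shows "tensor_lift \<phi> (a \<otimes> b) = \<phi> a b"
  by (simp add: tensor_pair.abs_eq tensor_lift_abs[OF assms] free_eval_single)

lemma clinear_tensor_lift: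
  assumes "cbilinear \<phi>"
  shows "clinear (tensor_lift \<phi>)"
proof (rule clinearI)
  fix x y :: "('a, 'b) tensor" and c
  obtain p q where [simp]: "x = abs_tensor p" "y = abs_tensor q"
    by (metis Quotient3_abs_rep[OF Quotient3_tensor])
  show "tensor_lift \<phi> (x + y) = tensor_lift \<phi> x + tensor_lift \<phi> y"
    by (simp add: plus_tensor.abs_eq tensor_lift_abs[OF assms] clinear_add[OF clinear_free_eval])
  show "tensor_lift \<phi> (c *\<^sub>C x) = c *\<^sub>C tensor_lift \<phi> x"
    by (simp add: scaleC_tensor.abs_eq tensor_lift_abs[OF assms] clinear_scale[OF clinear_free_eval])
qed

lemma tensor_lift_add: "tensor_lift (\<lambda>a b. \<phi> a b + \<psi> a b) x = tensor_lift \<phi> x + tensor_lift \<psi> x"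
  by (simp add: tensor_lift_def free_eval_def scaleC_add_right sum.distrib case_prod_unfold)

lemma tensor_lift_scale: "tensor_lift (\<lambda>a b. c *\<^sub>C \<phi> a b) x = c *\<^sub>C tensor_lift \<phi> x"
  by (simp add: tensor_lift_def free_eval_def cs.scale_sum_right case_prod_unfold mult.commute)

lemma tensor_induct [case_names zero pair add]:
  assumes "P 0" and "\<And>a b. P (a \<otimes> b)" and "\<And>x y. P x \<Longrightarrow> P y \<Longrightarrow> P (x + y)"
  shows "P x"
proof -
  have scale: "c *\<^sub>C (a \<otimes> b) = (c *\<^sub>C a) \<otimes> b" for c and a :: 'a and b :: 'b
    by (simp add: tensor_pair_simps)
  have "\<forall>c. P (c *\<^sub>C abs_tensor p)" for p
  proof (induction p rule: poly_mapping_induct_scale)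
    case zero
    show ?case using assms(1) by (simp add: zero_tensor_def[symmetric])
  next
    case (single k)
    obtain a b where k: "k = (a, b)" by force
    show ?case using assms(2) by (simp add: k tensor_pair.abs_eq[symmetric] scale)
  next
    case (add p q c)
    then show ?case using assms(3)
      by (simp add: plus_tensor.abs_eq[symmetric] scaleC_tensor.abs_eq[symmetric] scaleC_add_right)
  qed
  then have "P (1 *\<^sub>C abs_tensor (rep_tensor x))" by blast
  then show ?thesis by (simp add: Quotient3_abs_rep[OF Quotient3_tensor])
qed

lemma clinear_tensor_eqI:
  assumes "clinear f" "clinear g" "\<And>a b. f (a \<otimes> b) = g (a \<otimes> b)"
  shows "f x = g x"
  by (induction x rule: tensor_induct) (simp_all add: assms clinear_zero clinear_add)

definition tensor_map ::
    "('a::complex_space \<Rightarrow> 'c::complex_space) \<Rightarrow> ('b::complex_space \<Rightarrow> 'd::complex_space)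
      \<Rightarrow> ('a, 'b) tensor \<Rightarrow> ('c, 'd) tensor"
  where "tensor_map f g = tensor_lift (\<lambda>a b. f a \<otimes> g b)"

definition tensor_assoc ::
    "(('a::complex_space, 'b::complex_space) tensor, 'c::complex_space) tensor
      \<Rightarrow> ('a, ('b, 'c) tensor) tensor"
  where "tensor_assoc = tensor_lift (\<lambda>x c. tensor_lift (\<lambda>a b. a \<otimes> (b \<otimes> c)) x)"

text \<open>For bilinear products \<open>f\<close> on \<open>'a\<close> and \<open>g\<close> on \<open>'b\<close>, the componentwise product on \<open>'a \<otimes> 'b\<close>.\<close>

definition tensor_prod ::
    "('a \<Rightarrow> 'a \<Rightarrow> 'a) \<Rightarrow> ('b \<Rightarrow> 'b \<Rightarrow> 'b)
      \<Rightarrow> ('a::complex_space, 'b::complex_space) tensor \<Rightarrow> ('a, 'b) tensor \<Rightarrow> ('a, 'b) tensor"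
  where "tensor_prod f g x y =
    tensor_lift (\<lambda>a b. tensor_lift (\<lambda>a' b'. f a a' \<otimes> g b b') y) x"

lemma tensor_map_pair:
  assumes "clinear f" "clinear g"
  shows "tensor_map f g (a \<otimes> b) = f a \<otimes> g b"
  unfolding tensor_map_def
  by (rule tensor_lift_pair, rule cbilinearI)
    (simp_all add: clinear_add[OF assms(1)] clinear_add[OF assms(2)]
      clinear_scale[OF assms(1)] clinear_scale[OF assms(2)] tensor_pair_simps)

lemma clinear_tensor_map:
  assumes "clinear f" "clinear g"
  shows "clinear (tensor_map f g)"
  unfolding tensor_map_def
  by (rule clinear_tensor_lift, rule cbilinearI)
    (simp_all add: clinear_add[OF assms(1)] clinear_add[OF assms(2)]
      clinear_scale[OF assms(1)] clinear_scale[OF assms(2)] tensor_pair_simps)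

lemma
  assumes f: "cbilinear f" and g: "cbilinear g"
  shows tensor_prod_pair: "tensor_prod f g (a \<otimes> b) (a' \<otimes> b') = f a a' \<otimes> g b b'"
    and cbilinear_tensor_prod: "cbilinear (tensor_prod f g)"
proof -
  note fg = cbilinear_simps[OF f] cbilinear_simps[OF g] tensor_pair_simps
  let ?\<psi> = "\<lambda>a b a' b'. f a a' \<otimes> g b b'"
  have inner: "cbilinear (?\<psi> a b)" for a b
    by (rule cbilinearI) (simp_all add: fg)
  have outer: "cbilinear (\<lambda>a b. tensor_lift (?\<psi> a b) y)" for y
    by (rule cbilinearI) (simp_all add: fg tensor_lift_add tensor_lift_scale)
  show "tensor_prod f g (a \<otimes> b) (a' \<otimes> b') = f a a' \<otimes> g b b'"
    unfolding tensor_prod_def tensor_lift_pair[OF outer] by (rule tensor_lift_pair[OF inner])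
  show "cbilinear (tensor_prod f g)"
    unfolding tensor_prod_def
    by (rule cbilinearI)
      (simp_all add: clinear_add[OF clinear_tensor_lift[OF outer]]
        clinear_scale[OF clinear_tensor_lift[OF outer]] clinear_add[OF clinear_tensor_lift[OF inner]]
        clinear_scale[OF clinear_tensor_lift[OF inner]] tensor_lift_add tensor_lift_scale)
qed

lemma cbilinear_times: "cbilinear ((*) :: 'a \<Rightarrow> 'a \<Rightarrow> 'a::complex_alg)"
  by (rule cbilinearI) (simp_all add: algebra_simps mult_scaleC_left mult_scaleC_right)

instantiation tensor :: (complex_alg, complex_alg) complex_alg
begin

definition one_tensor :: "('a, 'b) tensor" where "one_tensor = 1 \<otimes> 1"

definition times_tensor :: "('a, 'b) tensor \<Rightarrow> ('a, 'b) tensor \<Rightarrow> ('a, 'b) tensor"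
  where "times_tensor = tensor_prod (*) (*)"

instance
proof
  have bil: "cbilinear (tensor_prod (*) (*) :: ('a, 'b) tensor \<Rightarrow> _)"
    by (rule cbilinear_tensor_prod[OF cbilinear_times cbilinear_times])
  fix x y z :: "('a, 'b) tensor" and c :: complex
  have mult_pair: "(a \<otimes> b) * (a' \<otimes> b') = (a * a') \<otimes> (b * b')" for a a' :: 'a and b b' :: 'b
    by (simp add: times_tensor_def tensor_prod_pair cbilinear_times)
  show add1: "(x + y) * z = x * z + y * z" for x y z :: "('a, 'b) tensor"
    by (simp add: times_tensor_def cbilinear_simps[OF bil])
  show add2: "x * (y + z) = x * y + x * z" for x y z :: "('a, 'b) tensor"
    by (simp add: times_tensor_def cbilinear_simps[OF bil])
  show "(c *\<^sub>C x) * y = c *\<^sub>C (x * y)" "x * (c *\<^sub>C y) = c *\<^sub>C (x * y)"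
    by (simp_all add: times_tensor_def cbilinear_simps[OF bil])
  have zero: "0 * x = 0" "x * 0 = 0" for x :: "('a, 'b) tensor"
    using add1[of 0 0 x] add2[of x 0 0] by simp_all
  show "1 * x = x"
    by (induction x rule: tensor_induct) (simp_all add: add2 zero one_tensor_def mult_pair)
  show "x * 1 = x"
    by (induction x rule: tensor_induct) (simp_all add: add1 zero one_tensor_def mult_pair)
  show "x * y * z = x * (y * z)"
  proof (induction x rule: tensor_induct)
    case (pair a b)
    show ?case
    proof (induction y rule: tensor_induct)
      case (pair a' b')
      show ?case
        by (induction z rule: tensor_induct) (simp_all add: mult_pair add2 zero mult.assoc)
    qed (simp_all add: add1 add2 zero)
  qed (simp_all add: add1 zero)
qed

end

lemma tensor_pair_mult: "(a \<otimes> b) * (a' \<otimes> b') = (a * a') \<otimes> (b * b')"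
  by (simp add: times_tensor_def tensor_prod_pair cbilinear_times)

text \<open>
  For a finite set \<open>'g\<close>, functions \<open>'g \<Rightarrow> 'v\<close> are the tensor product of the algebra \<open>'g \<Rightarrow> complex\<close>
  of scalar functions with \<open>'v\<close>. Below, \<open>F \<otimes> V\<close> is therefore written \<open>'g \<Rightarrow> 'v\<close>, and \<open>K \<otimes> V\<close> with
  \<open>K = F \<otimes> F\<close> is written \<open>'g \<Rightarrow> 'g \<Rightarrow> 'v\<close> (arguments \<open>\<lambda>\<close>, \<open>\<mu>\<close>); structure maps extended linearly in the
  coefficients act pointwise.
\<close>

lemma bij_scalar_functions_tensor:
  "bij (tensor_lift (\<lambda>f v x. f x *\<^sub>C v) :: ('g::finite \<Rightarrow> complex, 'v::complex_space) tensor \<Rightarrow> 'g \<Rightarrow> 'v)"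
proof -
  let ?\<phi> = "\<lambda>(f :: 'g \<Rightarrow> complex) (v :: 'v) x. f x *\<^sub>C v"
  let ?\<delta> = "\<lambda>x y :: 'g. if y = x then 1 else 0 :: complex"
  let ?\<Psi> = "\<lambda>u :: 'g \<Rightarrow> 'v. \<Sum>x\<in>UNIV. ?\<delta> x \<otimes> u x"
  have bil: "cbilinear ?\<phi>"
    by (rule cbilinearI)
      (simp_all add: fun_eq_iff scaleC_add_left scaleC_add_right scaleC_fun_def scaleC_complex_def
        mult.commute)
  have sum_apply: "(\<Sum>x\<in>X. h x) y = (\<Sum>x\<in>X. h x y)" for X and h :: "'g \<Rightarrow> 'g \<Rightarrow> 'w::complex_space" and y
    by (induction X rule: infinite_finite_induct) simp_all
  have lin: "clinear ?\<Psi>"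
    by (rule clinearI)
      (simp_all add: tensor_pair_simps sum.distrib scaleC_fun_def cs.scale_sum_right)
  have "?\<Psi> (tensor_lift ?\<phi> t) = t" for t
  proof (induction t rule: tensor_induct)
    case (pair f v)
    have "?\<Psi> (tensor_lift ?\<phi> (f \<otimes> v)) = (\<Sum>x\<in>UNIV. (f x *\<^sub>C ?\<delta> x) \<otimes> v)"
      by (simp only: tensor_lift_pair[OF bil] tensor_pair_simps)
    also have "\<dots> = (\<Sum>x\<in>UNIV. f x *\<^sub>C ?\<delta> x) \<otimes> v"
      by (rule tensor_pair_sum_left[symmetric])
    also have "(\<Sum>x\<in>UNIV. f x *\<^sub>C ?\<delta> x) = f"
      by (simp add: fun_eq_iff sum_apply scaleC_fun_def scaleC_complex_def if_distrib[of "(*) _"]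
          cong: if_cong)
    finally show ?case .
  qed (simp_all only: clinear_zero[OF lin] clinear_add[OF lin]
      clinear_zero[OF clinear_tensor_lift[OF bil]] clinear_add[OF clinear_tensor_lift[OF bil]])
  moreover have "tensor_lift ?\<phi> (?\<Psi> u) = u" for u
    by (simp add: clinear_sum[OF clinear_tensor_lift[OF bil]] tensor_lift_pair[OF bil] fun_eq_iff
        sum_apply if_distrib[of "\<lambda>c. c *\<^sub>C _"] scaleC_one cong: if_cong)
  ultimately show ?thesis by (intro o_bij[of ?\<Psi>]) (simp_all add: fun_eq_iff)
qed


section \<open>Hopf algebras\<close>

record (overloaded) ('h::complex_space) hopf =
  comult :: "'h \<Rightarrow> ('h, 'h) tensor"
  counit :: "'h \<Rightarrow> complex"
  antipode :: "'h \<Rightarrow> 'h"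

locale hopf_algebra =
  fixes H :: "'h::complex_alg hopf"
  assumes linear: "clinear (comult H)" "clinear (counit H)" "clinear (antipode H)"
    and comult_mult: "comult H (x * y) = comult H x * comult H y"
    and comult_one: "comult H 1 = 1"
    and counit_mult: "counit H (x * y) = counit H x * counit H y"
    and counit_one: "counit H 1 = 1"
    and coassoc: "tensor_assoc (tensor_map (comult H) id (comult H x))
      = tensor_map id (comult H) (comult H x)"
    and counit_left: "tensor_lift (\<lambda>y z. counit H y *\<^sub>C z) (comult H x) = x"
    and counit_right: "tensor_lift (\<lambda>y z. counit H z *\<^sub>C y) (comult H x) = x"
    and antipode_left: "tensor_lift (\<lambda>y z. antipode H y * z) (comult H x) = counit H x *\<^sub>C 1"
    and antipode_right: "tensor_lift (\<lambda>y z. y * antipode H z) (comult H x) = counit H x *\<^sub>C 1"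

definition hopf_pairing ::
    "'u::complex_alg hopf \<Rightarrow> 'a::complex_alg hopf \<Rightarrow> ('u \<Rightarrow> 'a \<Rightarrow> complex) \<Rightarrow> bool"
  where "hopf_pairing U A p \<longleftrightarrow> cbilinear p
    \<and> (\<forall>u v a. p (u * v) a = tensor_lift (\<lambda>a' a''. p u a' * p v a'') (comult A a))
    \<and> (\<forall>u a b. p u (a * b) = tensor_lift (\<lambda>u' u''. p u' a * p u'' b) (comult U u))
    \<and> (\<forall>a. p 1 a = counit A a) \<and> (\<forall>u. p u 1 = counit U u)
    \<and> (\<forall>u a. p (antipode U u) a = p u (antipode A a))"

definition grouplike :: "'h::complex_alg hopf \<Rightarrow> 'h set"
  where "grouplike H = {u. comult H u = u \<otimes> u \<and> counit H u = 1}"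

definition finite_abelian_subgroup :: "'h::complex_alg hopf \<Rightarrow> 'h set \<Rightarrow> bool"
  where "finite_abelian_subgroup H T \<longleftrightarrow> finite T \<and> T \<subseteq> grouplike H \<and> 1 \<in> T
    \<and> (\<forall>s\<in>T. \<forall>t\<in>T. s * t \<in> T \<and> s * t = t * s) \<and> (\<forall>s\<in>T. \<exists>t\<in>T. s * t = 1 \<and> t * s = 1)"

definition character :: "'h::monoid_mult set \<Rightarrow> ('h \<Rightarrow> complex) \<Rightarrow> bool"
  where "character T \<chi> \<longleftrightarrow> (\<forall>t\<in>T. \<chi> t \<noteq> 0) \<and> (\<forall>s\<in>T. \<forall>t\<in>T. \<chi> (s * t) = \<chi> s * \<chi> t)"

text \<open>
  The character group of \<open>T\<close>, written additively, is presented as a type \<open>'g\<close> together with an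
  isomorphism \<open>chr\<close> onto the group of characters of \<open>T\<close>; \<open>chr \<alpha> t\<close> is the value $t^\alpha$.
\<close>

definition character_group :: "'h::monoid_mult set \<Rightarrow> ('g::{finite, ab_group_add} \<Rightarrow> 'h \<Rightarrow> complex) \<Rightarrow> bool"
  where "character_group T chr \<longleftrightarrow> (\<forall>\<alpha>. character T (chr \<alpha>))
    \<and> (\<forall>\<alpha> \<beta>. \<forall>t\<in>T. chr (\<alpha> + \<beta>) t = chr \<alpha> t * chr \<beta> t)
    \<and> (\<forall>\<chi>. character T \<chi> \<longrightarrow> (\<exists>!\<alpha>. \<forall>t\<in>T. chr \<alpha> t = \<chi> t))"


section \<open>T-Hopf algebroids\<close>

text \<open>
  The balanced tensor product of two T-algebras is a quotient that depends on their moment maps. To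
  keep all structure maps linear maps between types, a T-algebra is presented as a subquotient:
  its underlying space is \<open>T_carrier A\<close> (the span of the graded pieces) modulo \<open>null A\<close>, its
  operations are given on representatives, and \<open>T_eq A\<close> is equality in the quotient.
  When \<open>null A = {0}\<close>, \<open>T_eq A\<close> is equality. The grading group is \<open>'g\<close> and \<open>'g \<Rightarrow> complex\<close> is \<open>F\<close>.
\<close>

record ('g, 'a) T_alg =
  grade :: "'g \<Rightarrow> 'g \<Rightarrow> 'a set"
  null :: "'a set"
  prd :: "'a \<Rightarrow> 'a \<Rightarrow> 'a"
  unt :: "'a"
  mom_l :: "('g \<Rightarrow> complex) \<Rightarrow> 'a"
  mom_r :: "('g \<Rightarrow> complex) \<Rightarrow> 'a"

definition T_carrier :: "('g, 'a::complex_space) T_alg \<Rightarrow> 'a set"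
  where "T_carrier A = cs.span (\<Union>\<alpha> \<beta>. grade A \<alpha> \<beta>)"

definition T_eq :: "('g, 'a::complex_space) T_alg \<Rightarrow> 'a \<Rightarrow> 'a \<Rightarrow> bool"
  where "T_eq A x y \<longleftrightarrow> x - y \<in> null A"

definition shift :: "'g::ab_group_add \<Rightarrow> ('g \<Rightarrow> 'v) \<Rightarrow> 'g \<Rightarrow> 'v"
  where "shift \<alpha> f = (\<lambda>x. f (x + \<alpha>))"

locale T_algebra =
  fixes A :: "('g::{finite, ab_group_add}, 'a::complex_space) T_alg"
  assumes subspace_grade: "cs.subspace (grade A \<alpha> \<beta>)"
    and subspace_null: "cs.subspace (null A)"
    and direct_sum: "(\<And>\<alpha> \<beta>. c \<alpha> \<beta> \<in> grade A \<alpha> \<beta>) \<Longrightarrow> (\<Sum>\<alpha>\<in>UNIV. \<Sum>\<beta>\<in>UNIV. c \<alpha> \<beta>) \<in> null A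
      \<Longrightarrow> c \<alpha> \<beta> \<in> null A"
    and bilinear_prd: "cbilinear (prd A)"
    and prd_null: "x \<in> T_carrier A \<Longrightarrow> y \<in> T_carrier A \<Longrightarrow> y \<in> null A
      \<Longrightarrow> prd A x y \<in> null A \<and> prd A y x \<in> null A"
    and prd_grade: "x \<in> grade A \<alpha> \<beta> \<Longrightarrow> y \<in> grade A \<gamma> \<delta> \<Longrightarrow> prd A x y \<in> grade A (\<alpha> + \<gamma>) (\<beta> + \<delta>)"
    and prd_assoc: "x \<in> T_carrier A \<Longrightarrow> y \<in> T_carrier A \<Longrightarrow> z \<in> T_carrier A
      \<Longrightarrow> T_eq A (prd A (prd A x y) z) (prd A x (prd A y z))"
    and unt_grade: "unt A \<in> grade A 0 0"
    and prd_unt: "x \<in> T_carrier A \<Longrightarrow> T_eq A (prd A (unt A) x) x \<and> T_eq A (prd A x (unt A)) x"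
    and mom_linear: "clinear (mom_l A)" "clinear (mom_r A)"
    and mom_grade: "mom_l A f \<in> grade A 0 0" "mom_r A f \<in> grade A 0 0"
    and mom_mult: "T_eq A (mom_l A (f * g)) (prd A (mom_l A f) (mom_l A g))"
      "T_eq A (mom_r A (f * g)) (prd A (mom_r A f) (mom_r A g))"
    and mom_one: "T_eq A (mom_l A 1) (unt A)" "T_eq A (mom_r A 1) (unt A)"
    and mom_inj: "mom_l A f \<in> null A \<Longrightarrow> f = 0" "mom_r A f \<in> null A \<Longrightarrow> f = 0"
    and mom_commute: "T_eq A (prd A (mom_l A f) (mom_r A g)) (prd A (mom_r A g) (mom_l A f))"
    and mom_l_prd: "a \<in> grade A \<alpha> \<beta> \<Longrightarrow> T_eq A (prd A (mom_l A f) a) (prd A a (mom_l A (shift \<alpha> f)))"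
    and mom_r_prd: "a \<in> grade A \<alpha> \<beta> \<Longrightarrow> T_eq A (prd A (mom_r A f) a) (prd A a (mom_r A (shift \<beta> f)))"

definition T_morphism ::
    "('g, 'a::complex_space) T_alg \<Rightarrow> ('g, 'b::complex_space) T_alg \<Rightarrow> ('a \<Rightarrow> 'b) \<Rightarrow> bool"
  where "T_morphism A B \<phi> \<longleftrightarrow> clinear \<phi>
    \<and> (\<forall>\<alpha> \<beta>. \<phi> ` grade A \<alpha> \<beta> \<subseteq> grade B \<alpha> \<beta>)
    \<and> \<phi> ` (T_carrier A \<inter> null A) \<subseteq> null B
    \<and> (\<forall>x\<in>T_carrier A. \<forall>y\<in>T_carrier A. T_eq B (\<phi> (prd A x y)) (prd B (\<phi> x) (\<phi> y)))
    \<and> T_eq B (\<phi> (unt A)) (unt B)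
    \<and> (\<forall>f. T_eq B (\<phi> (mom_l A f)) (mom_l B f) \<and> T_eq B (\<phi> (mom_r A f)) (mom_r B f))"

text \<open>
  The piece of degree \<open>(\<alpha>, \<beta>)\<close> is the direct sum over \<open>\<gamma>\<close> of the spaces \<open>grade A \<alpha> \<gamma> \<otimes> grade B \<gamma> \<beta>\<close>,
  balanced over \<open>F\<close> by means of \<open>mom_r A\<close> and \<open>mom_l B\<close>.
\<close>

definition T_tensor ::
    "('g, 'a::complex_space) T_alg \<Rightarrow> ('g, 'b::complex_space) T_alg \<Rightarrow> ('g, ('a, 'b) tensor) T_alg"
  where "T_tensor A B = \<lparr>
    grade = (\<lambda>\<alpha> \<beta>. cs.span (\<Union>\<gamma>. {a \<otimes> b |a b. a \<in> grade A \<alpha> \<gamma> \<and> b \<in> grade B \<gamma> \<beta>})),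
    null = cs.span (\<Union>\<alpha> \<beta> \<gamma>.
      {prd A (mom_r A f) a \<otimes> b - a \<otimes> prd B (mom_l B f) b |f a b. a \<in> grade A \<alpha> \<gamma> \<and> b \<in> grade B \<gamma> \<beta>}
      \<union> {a \<otimes> b |a b. a \<in> grade A \<alpha> \<gamma> \<and> b \<in> grade B \<gamma> \<beta> \<and> (a \<in> null A \<or> b \<in> null B)}),
    prd = tensor_prod (prd A) (prd B),
    unt = unt A \<otimes> unt B,
    mom_l = (\<lambda>f. mom_l A f \<otimes> unt B),
    mom_r = (\<lambda>f. unt A \<otimes> mom_r B f)\<rparr>"

text \<open>
  A difference operator $\sum_\alpha f_\alpha T_\alpha$ is the family \<open>d\<close> with \<open>d \<alpha>\<close> = $f_\alpha$;
  \<open>diff_op \<alpha> f\<close> is $f T_\alpha$ and \<open>at_one d\<close> is the value of \<open>d\<close> on the constant function 1.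
\<close>

definition diff_op :: "'g \<Rightarrow> ('g \<Rightarrow> complex) \<Rightarrow> 'g \<Rightarrow> 'g \<Rightarrow> complex"
  where "diff_op \<alpha> f = (\<lambda>\<gamma>. if \<gamma> = \<alpha> then f else 0)"

definition at_one :: "('g::finite \<Rightarrow> 'g \<Rightarrow> complex) \<Rightarrow> 'g \<Rightarrow> complex"
  where "at_one d = (\<Sum>\<alpha>\<in>UNIV. d \<alpha>)"

definition diff_op_alg :: "('g::{finite, ab_group_add}, 'g \<Rightarrow> 'g \<Rightarrow> complex) T_alg"
  where "diff_op_alg = \<lparr>
    grade = (\<lambda>\<alpha> \<beta>. if \<alpha> = \<beta> then range (diff_op (- \<alpha>)) else {0}),
    null = {0},
    prd = (\<lambda>d e. \<Sum>\<alpha>\<in>UNIV. \<Sum>\<beta>\<in>UNIV. diff_op (\<alpha> + \<beta>) (d \<alpha> * shift \<alpha> (e \<beta>))),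
    unt = diff_op 0 1,
    mom_l = diff_op 0,
    mom_r = diff_op 0\<rparr>"

text \<open>
  In the counit axioms, \<open>I \<otimes> A\<close> and \<open>A \<otimes> I\<close> are mapped to \<open>A\<close> by \<open>d \<otimes> a \<mapsto> \<mu>\<^sub>l(d 1) \<circ> a\<close> and
  \<open>a \<otimes> d \<mapsto> \<mu>\<^sub>r(d 1) \<circ> a\<close>.
\<close>

locale T_bialgebroid = T_algebra A
  for A :: "('g::{finite, ab_group_add}, 'a::complex_space) T_alg" +
  fixes \<Delta> :: "'a \<Rightarrow> ('a, 'a) tensor" and \<epsilon> :: "'a \<Rightarrow> 'g \<Rightarrow> 'g \<Rightarrow> complex"
  assumes comult_morphism: "T_morphism A (T_tensor A A) \<Delta>"
    and counit_morphism: "T_morphism A diff_op_alg \<epsilon>"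
    and coassociative: "a \<in> T_carrier A \<Longrightarrow> T_eq (T_tensor A (T_tensor A A))
      (tensor_assoc (tensor_map \<Delta> id (\<Delta> a))) (tensor_map id \<Delta> (\<Delta> a))"
    and counital_left: "a \<in> T_carrier A \<Longrightarrow> T_eq A
      (tensor_lift (\<lambda>d b. prd A (mom_l A (at_one d)) b) (tensor_map \<epsilon> id (\<Delta> a))) a"
    and counital_right: "a \<in> T_carrier A \<Longrightarrow> T_eq A
      (tensor_lift (\<lambda>b d. prd A (mom_r A (at_one d)) b) (tensor_map id \<epsilon> (\<Delta> a))) a"

locale T_Hopf_algebroid = T_bialgebroid A \<Delta> \<epsilon>
  for A :: "('g::{finite, ab_group_add}, 'a::complex_space) T_alg" and \<Delta> \<epsilon> +
  fixes S :: "'a \<Rightarrow> 'a"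
  assumes antipode_linear: "clinear S"
    and antipode_carrier: "a \<in> T_carrier A \<Longrightarrow> S a \<in> T_carrier A"
    and antipode_null: "a \<in> T_carrier A \<Longrightarrow> a \<in> null A \<Longrightarrow> S a \<in> null A"
    and antipode_mom_r: "a \<in> T_carrier A
      \<Longrightarrow> T_eq A (S (prd A (mom_r A f) a)) (prd A (S a) (mom_l A f))"
    and antipode_mom_l: "a \<in> T_carrier A
      \<Longrightarrow> T_eq A (S (prd A a (mom_l A f))) (prd A (mom_r A f) (S a))"
    and antipode_right: "a \<in> grade A \<alpha> \<beta>
      \<Longrightarrow> T_eq A (tensor_lift (prd A) (tensor_map id S (\<Delta> a))) (mom_l A (at_one (\<epsilon> a)))"
    and antipode_left: "a \<in> grade A \<alpha> \<beta>
      \<Longrightarrow> T_eq A (tensor_lift (prd A) (tensor_map S id (\<Delta> a))) (mom_r A (shift \<alpha> (at_one (\<epsilon> a))))"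


section \<open>Dynamical twists and the algebroid of a twist\<close>

locale dynamical_data =
  fixes U :: "'u::complex_alg hopf" and A :: "'a::complex_alg hopf"
    and p :: "'u \<Rightarrow> 'a \<Rightarrow> complex"
    and T :: "'u set" and chr :: "'g::{finite, ab_group_add} \<Rightarrow> 'u \<Rightarrow> complex"
begin

definition ad_weight :: "'g \<Rightarrow> 'u set"
  where "ad_weight \<alpha> = {u. \<forall>t\<in>T. t * u * minv t = chr \<alpha> t *\<^sub>C u}"

definition weight_proj :: "'g \<Rightarrow> 'u"  (\<open>\<pi>\<close>)
  where "\<pi> \<alpha> = (1 / of_nat (card T)) *\<^sub>C (\<Sum>t\<in>T. chr (- \<alpha>) t *\<^sub>C t)"

definition dynamical_twist :: "('g \<Rightarrow> ('u, 'u) tensor) \<Rightarrow> bool"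
  where "dynamical_twist J \<longleftrightarrow>
    (\<forall>x. invertible_elt (J x))
    \<and> (\<forall>x. \<forall>t\<in>T. J x * (t \<otimes> t) = (t \<otimes> t) * J x)
    \<and> (\<forall>x. tensor_lift (\<lambda>u v. counit U u *\<^sub>C v) (J x) = 1
      \<and> tensor_lift (\<lambda>u v. counit U v *\<^sub>C u) (J x) = 1)
    \<and> (\<forall>x. tensor_assoc (tensor_map (comult U) id (J x) * (\<Sum>\<alpha>\<in>UNIV. (J (x + \<alpha>) \<otimes> 1) * (1 \<otimes> \<pi> \<alpha>)))
      = tensor_map id (comult U) (J x) * (1 \<otimes> J x))"

definition KJ :: "('g \<Rightarrow> ('u, 'u) tensor) \<Rightarrow> 'g \<Rightarrow> 'u"
  where "KJ J x = tensor_lift (\<lambda>u v. antipode U u * v) (J x)"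

definition QJ :: "('g \<Rightarrow> ('u, 'u) tensor) \<Rightarrow> 'g \<Rightarrow> 'u"
  where "QJ J x = tensor_lift (\<lambda>u v. u * antipode U v) (minv (J x))"

text \<open>\<open>minus_h u\<close> is $u(\lambda - h)$.\<close>

definition minus_h :: "('g \<Rightarrow> 'u) \<Rightarrow> 'g \<Rightarrow> 'u"
  where "minus_h u x = (\<Sum>\<alpha>\<in>UNIV. u (x - \<alpha>) * \<pi> \<alpha>)"

definition lact :: "'u \<Rightarrow> 'a \<Rightarrow> 'a"
  where "lact u a = tensor_lift (\<lambda>a' a''. p u a'' *\<^sub>C a') (comult A a)"

definition ract :: "'a \<Rightarrow> 'u \<Rightarrow> 'a"
  where "ract a u = tensor_lift (\<lambda>a' a''. p u a' *\<^sub>C a'') (comult A a)"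

definition lact2 :: "('u, 'u) tensor \<Rightarrow> ('a, 'a) tensor \<Rightarrow> ('a, 'a) tensor"
  where "lact2 w z = tensor_lift (\<lambda>u v. tensor_map (lact u) (lact v) z) w"

definition ract2 :: "('a, 'a) tensor \<Rightarrow> ('u, 'u) tensor \<Rightarrow> ('a, 'a) tensor"
  where "ract2 z w = tensor_lift (\<lambda>u v. tensor_map (\<lambda>a. ract a u) (\<lambda>a. ract a v) z) w"

definition biweight :: "'g \<Rightarrow> 'g \<Rightarrow> 'a set"
  where "biweight \<alpha> \<beta> = {a. \<forall>t\<in>T. lact t a = chr \<beta> t *\<^sub>C a \<and> ract a t = chr \<alpha> t *\<^sub>C a}"

definition biweightK :: "'g \<Rightarrow> 'g \<Rightarrow> ('g \<Rightarrow> 'g \<Rightarrow> 'a) set"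
  where "biweightK \<alpha> \<beta> = {a. \<forall>x y. a x y \<in> biweight \<alpha> \<beta>}"

text \<open>
  Maps prescribed on elements of bidegree \<open>(\<alpha>, \<beta>)\<close> are extended linearly by summing over the
  components \<open>compK \<alpha> \<beta> a\<close> of the argument.
\<close>

definition compK :: "'g \<Rightarrow> 'g \<Rightarrow> ('g \<Rightarrow> 'g \<Rightarrow> 'a) \<Rightarrow> 'g \<Rightarrow> 'g \<Rightarrow> 'a"
  where "compK \<alpha> \<beta> a = component (\<lambda>(\<gamma>, \<delta>). biweightK \<gamma> \<delta>) (\<alpha>, \<beta>) a"

definition multJ ::
    "('g \<Rightarrow> ('u, 'u) tensor) \<Rightarrow> ('g \<Rightarrow> 'g \<Rightarrow> 'a) \<Rightarrow> ('g \<Rightarrow> 'g \<Rightarrow> 'a) \<Rightarrow> 'g \<Rightarrow> 'g \<Rightarrow> 'a"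
  where "multJ J a b x y = (\<Sum>\<alpha>\<in>UNIV. \<Sum>\<beta>\<in>UNIV. tensor_lift (*)
    (ract2 (lact2 (J y) (a (x + \<alpha>) (y + \<beta>) \<otimes> compK \<alpha> \<beta> b x y)) (minv (J x))))"

definition algebroidJ :: "('g \<Rightarrow> ('u, 'u) tensor) \<Rightarrow> ('g, 'g \<Rightarrow> 'g \<Rightarrow> 'a) T_alg"
  where "algebroidJ J = \<lparr>
    grade = biweightK,
    null = {0},
    prd = multJ J,
    unt = (\<lambda>x y. 1),
    mom_l = (\<lambda>f x y. f x *\<^sub>C 1),
    mom_r = (\<lambda>f x y. f y *\<^sub>C 1)\<rparr>"

text \<open>
  The unbalanced lift of the map \<open>\<pi>\<close> from \<open>K \<otimes> A \<otimes> A\<close>: it is linear and sends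
  \<open>f(\<lambda>) g(\<mu>) (a \<otimes> b)\<close> to \<open>(f(\<lambda>) a) \<otimes> (g(\<mu>) b)\<close>.
\<close>

definition split_coefficients ::
    "('g \<Rightarrow> 'g \<Rightarrow> ('a, 'a) tensor) \<Rightarrow> ('g \<Rightarrow> 'g \<Rightarrow> 'a, 'g \<Rightarrow> 'g \<Rightarrow> 'a) tensor"
  where "split_coefficients z = (\<Sum>\<sigma>\<in>UNIV. \<Sum>\<tau>\<in>UNIV.
    tensor_map (\<lambda>a x y. if x = \<sigma> then a else 0) (\<lambda>b x y. if y = \<tau> then b else 0) (z \<sigma> \<tau>))"

definition comultJ :: "('g \<Rightarrow> 'g \<Rightarrow> 'a) \<Rightarrow> ('g \<Rightarrow> 'g \<Rightarrow> 'a, 'g \<Rightarrow> 'g \<Rightarrow> 'a) tensor"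
  where "comultJ a = split_coefficients (\<lambda>x y. comult A (a x y))"

definition counitJ :: "('g \<Rightarrow> 'g \<Rightarrow> 'a) \<Rightarrow> 'g \<Rightarrow> 'g \<Rightarrow> complex"
  where "counitJ a = (\<Sum>\<alpha>\<in>UNIV. \<Sum>\<beta>\<in>UNIV.
    diff_op (- \<alpha>) (shift (- \<alpha>) (\<lambda>x. counit A (compK \<alpha> \<beta> a x x))))"

definition antipodeJ :: "('g \<Rightarrow> ('u, 'u) tensor) \<Rightarrow> ('g \<Rightarrow> 'g \<Rightarrow> 'a) \<Rightarrow> 'g \<Rightarrow> 'g \<Rightarrow> 'a"
  where "antipodeJ J a x y = (\<Sum>\<alpha>\<in>UNIV. \<Sum>\<beta>\<in>UNIV. antipode A
    (ract (lact (KJ J (x - \<beta>)) (compK \<alpha> \<beta> a (y - \<alpha>) (x - \<beta>))) (QJ J y)))"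

end

lemma split_coefficients_pair:
  fixes a b :: "'a::complex_alg" and f g :: "'g::{finite, ab_group_add} \<Rightarrow> complex"
  shows "dynamical_data.split_coefficients (\<lambda>x y. (f x * g y) *\<^sub>C (a \<otimes> b))
    = (\<lambda>x y. f x *\<^sub>C a) \<otimes> (\<lambda>x y. g y *\<^sub>C b)"
proof -
  have sum_apply2: "(\<Sum>x\<in>X. h x) y z = (\<Sum>x\<in>X. h x y z)"
    for X and h :: "'g \<Rightarrow> 'g \<Rightarrow> 'g \<Rightarrow> 'a" and y z
    by (induction X rule: infinite_finite_induct) simp_all
  have lin: "clinear (\<lambda>a x y. if x = \<sigma> then a else 0 :: 'a)"
    "clinear (\<lambda>a x y. if y = \<sigma> then a else 0 :: 'a)" for \<sigma> :: 'g
    by (rule clinearI; simp add: fun_eq_iff scaleC_fun_def)+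
  let ?l = "\<lambda>\<sigma> :: 'g. \<lambda>(x :: 'g) (y :: 'g). if x = \<sigma> then a else 0"
    and ?r = "\<lambda>\<tau> :: 'g. \<lambda>(x :: 'g) (y :: 'g). if y = \<tau> then b else 0"
  have l: "(\<lambda>x y. f x *\<^sub>C a) = (\<Sum>\<sigma>\<in>UNIV. f \<sigma> *\<^sub>C ?l \<sigma>)"
    and r: "(\<lambda>x y. g y *\<^sub>C b) = (\<Sum>\<tau>\<in>UNIV. g \<tau> *\<^sub>C ?r \<tau>)"
    by (simp_all add: fun_eq_iff sum_apply2 scaleC_fun_def if_distrib[of "(*\<^sub>C) _"] cong: if_cong)
  show ?thesis
    unfolding l r dynamical_data.split_coefficients_def
    unfolding tensor_pair_sum_left
    unfolding tensor_pair_sum_right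
    by (simp add: clinear_scale[OF clinear_tensor_map[OF lin]] tensor_map_pair[OF lin] tensor_pair_simps mult.commute)
qed

locale dynamical_setting = dynamical_data U A p T chr + U: hopf_algebra U + A: hopf_algebra A
  for U :: "'u::complex_alg hopf" and A :: "'a::complex_alg hopf"
    and p :: "'u \<Rightarrow> 'a \<Rightarrow> complex"
    and T :: "'u set" and chr :: "'g::{finite, ab_group_add} \<Rightarrow> 'u \<Rightarrow> complex" +
  assumes pairing: "hopf_pairing U A p"
    and subgroup: "finite_abelian_subgroup U T"
    and characters: "character_group T chr"
    and ad_semisimple: "is_direct_sum ad_weight"
    and bi_semisimple: "is_direct_sum (\<lambda>(\<alpha>, \<beta>). biweight \<alpha> \<beta>)"

end

theory Submission
  imports Defs
begin

text \<open>
  The product of \<open>A\<^sup>J\<close> is pointwise in $(\lambda, \mu)$, up to shifts, given by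
  $a \ast b = m(J(\mu) \cdot (a \otimes b) \cdot J^{-1}(\lambda))$. Since $u \cdot m(z) = m(\Delta(u) \cdot z)$,
  associativity is the twist equation together with its inverse, and multiplicativity of $\Delta$
  holds because $u \cdot a_1 \otimes a_2 = a_1 \otimes a_2 \cdot u$ lets a factor $J(\mu)$ meet $J^{-1}(\mu)$.
  Using $u \cdot S(a) \cdot v = S(S(v) \cdot a \cdot S(u))$, the same exchange contracts $J$ against
  $Q = \sum J'_1 S(J'_2)$, where $J' = J^{-1}$, and reduces both antipode axioms to
  $Q(\lambda) K(\lambda - h) = 1$. This identity in turn follows from the twist equation. All axioms are linear,
  so they are checked on elements $\delta_\sigma(\lambda) \delta_\tau(\mu) a$ with $a$ homogeneous,
  for which $\Delta(a)$ only involves tensors of matching inner degree.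
\<close>

text \<open>Sweedler sums are written \<open>tensor_lift \<phi> (comult A a)\<close>, and each
  manipulation of them is a reduction to pure tensors, justified by linearity in every argument.
  Since \<open>J x\<close> is not a pure tensor, the identities for products and antipodes are
  stated for arbitrary tensors \<open>w\<close>, \<open>w'\<close>, and \<open>J\<close> is
  substituted afterwards.

  In each antipode axiom one dynamical variable has to disappear from the result. It sits in a pair
  that contracts to 1: \<open>J(\<mu>)\<close> with \<open>Q(\<mu>)\<close>, or the inverse of
  \<open>J(\<lambda>)\<close> with \<open>K(\<lambda>)\<close>. What survives is the pairing of a
  product \<open>Q K\<close> with an element of known left degree \<open>\<beta>\<close>, so it
  suffices to know \<open>Q (x + \<beta>) * K x * \<pi> \<beta>\<close>.

  The target of \<open>\<Delta>\<close> is a quotient, where equality asks for explicit balancing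
  relations. Instead, elements are compared by evaluation at triples (\<lambda>, z, \<mu>), with z
  the variable shared by the two factors. The product shifts z by the right index of the degree in
  the first factor and by the left index in the second; these must agree, hence the need to expand
  \<open>\<Delta>(a)\<close> with matching inner degrees.\<close>

section \<open>Multilinear maps on tensor products\<close>

text \<open>Introduction rules that prove linearity in one chosen variable by descending through the
  term. \<open>intro clin\<close> discharges the side conditions of every reduction to pure tensors;
  bilinearity goals are split into two linearity goals.\<close>

named_theorems clin

lemma clinear_id_fun [clin]: "clinear (\<lambda>x. x)" and clinear_id [clin]: "clinear id"
  by (simp_all add: clinear_iff)

lemma clinear_zero_fun [clin]: "clinear (\<lambda>x. 0)"
  by (simp add: clinear_iff)

lemma clinear_comp: "clinear h \<Longrightarrow> clinear f \<Longrightarrow> clinear (\<lambda>x. h (f x))"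
  by (simp add: clinear_iff)

lemma clinear_plus [clin]: "clinear f \<Longrightarrow> clinear g \<Longrightarrow> clinear (\<lambda>x. f x + g x)"
  and clinear_minus [clin]: "clinear f \<Longrightarrow> clinear g \<Longrightarrow> clinear (\<lambda>x. f x - g x)"
  and clinear_scaleC [clin]: "clinear f \<Longrightarrow> clinear (\<lambda>x. c *\<^sub>C f x)"
  by (simp_all add: clinear_iff scaleC_add_right cs.scale_right_diff_distrib mult.commute)

lemma clinear_sum_fun [clin]: "(\<And>i. clinear (f i)) \<Longrightarrow> clinear (\<lambda>x. \<Sum>i\<in>I. f i x)"
  by (simp add: clinear_iff sum.distrib cs.scale_sum_right)

lemma clinear_if [clin]: "clinear f \<Longrightarrow> clinear g \<Longrightarrow> clinear (\<lambda>x. if b then f x else g x)"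
  by (cases b) simp_all

lemma clinear_fun [clin]: "(\<And>y. clinear (\<lambda>x. f x y)) \<Longrightarrow> clinear f"
  by (simp add: clinear_iff fun_eq_iff scaleC_fun_def)

lemma clinear_fun_apply: "clinear f \<Longrightarrow> clinear (\<lambda>x. f x y)"
  by (simp add: clinear_iff scaleC_fun_def)

lemma cbilinearI_clinear [clin]:
  "(\<And>y. clinear (\<lambda>x. \<phi> x y)) \<Longrightarrow> (\<And>x. clinear (\<lambda>y. \<phi> x y)) \<Longrightarrow> cbilinear \<phi>"
  by (simp add: cbilinear_def)

lemma cbilinear_comp:
  assumes "cbilinear \<phi>"
  shows "clinear f \<Longrightarrow> clinear (\<lambda>x. \<phi> (f x) y)" "clinear g \<Longrightarrow> clinear (\<lambda>x. \<phi> z (g x))"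
  using assms by (simp_all add: clinear_iff cbilinear_simps)

lemma cbilinear_scaleC: "cbilinear (scaleC :: complex \<Rightarrow> 'a \<Rightarrow> 'a::complex_space)"
  by (rule cbilinearI) (simp_all add: scaleC_add_left scaleC_add_right scaleC_complex_def
      mult.commute)

lemmas cbilinear_comps [clin] =
  cbilinear_comp[OF cbilinear_scaleC] cbilinear_comp[OF cbilinear_times]
  cbilinear_comp[OF cbilinear_tensor_pair]

lemma clinear_tensor_lift_arg [clin]:
  "cbilinear \<phi> \<Longrightarrow> clinear f \<Longrightarrow> clinear (\<lambda>x. tensor_lift \<phi> (f x))"
  by (rule clinear_comp[OF clinear_tensor_lift])

text \<open>With the representative of \<open>z\<close> fixed, the lift is a finite sum of scaled
  values of \<open>\<phi> x\<close>. This covers nested Sweedler sums in which the outer variable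
  occurs in the integrand.\<close>

lemma clinear_tensor_lift_fun [clin]:
  assumes "\<And>a b. clinear (\<lambda>x. \<phi> x a b)"
  shows "clinear (\<lambda>x. tensor_lift (\<phi> x) z)"
proof (rule clinearI)
  fix x y c
  have "\<phi> (x + y) = (\<lambda>a b. \<phi> x a b + \<phi> y a b)" "\<phi> (c *\<^sub>C x) = (\<lambda>a b. c *\<^sub>C \<phi> x a b)"
    by (simp_all add: fun_eq_iff clinear_add[OF assms] clinear_scale[OF assms])
  then show "tensor_lift (\<phi> (x + y)) z = tensor_lift (\<phi> x) z + tensor_lift (\<phi> y) z"
    "tensor_lift (\<phi> (c *\<^sub>C x)) z = c *\<^sub>C tensor_lift (\<phi> x) z"
    by (simp_all add: tensor_lift_add tensor_lift_scale)
qed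

lemma clinear_tensor_map_arg [clin]:
  "clinear f \<Longrightarrow> clinear g \<Longrightarrow> clinear h \<Longrightarrow> clinear (\<lambda>x. tensor_map f g (h x))"
  by (rule clinear_comp[OF clinear_tensor_map])

lemma clinear_tensor_map_fun [clin]:
  shows "(\<And>a. clinear (\<lambda>x. f x a)) \<Longrightarrow> clinear (\<lambda>x. tensor_map (f x) g z)"
    and "(\<And>a. clinear (\<lambda>x. f' x a)) \<Longrightarrow> clinear (\<lambda>x. tensor_map g' (f' x) z)"
  unfolding tensor_map_def by (intro clin; simp)+

lemma clinear_tensor_assoc [clin]: "clinear f \<Longrightarrow> clinear (\<lambda>x. tensor_assoc (f x))"
  unfolding tensor_assoc_def by (intro clin)

lemma tensor_assoc_pair: "tensor_assoc ((a \<otimes> b) \<otimes> c) = a \<otimes> (b \<otimes> c)"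
  unfolding tensor_assoc_def by (subst tensor_lift_pair; (intro clin)?)+ simp

text \<open>\<open>tensor_lift \<phi> x\<close> is a finite sum of values of \<open>\<phi>\<close> even if \<open>\<phi>\<close> is not bilinear.\<close>

lemma clinear_lift_commute:
  assumes "clinear h"
  shows "h (tensor_lift \<phi> z) = tensor_lift (\<lambda>a b. h (\<phi> a b)) z"
  by (simp add: tensor_lift_def free_eval_def clinear_sum[OF assms] clinear_scale[OF assms]
      case_prod_unfold)

lemma tensor_lift_swap:
  "tensor_lift (\<lambda>a b. tensor_lift (\<lambda>c d. \<phi> a b c d) y) x =
      tensor_lift (\<lambda>c d. tensor_lift (\<lambda>a b. \<phi> a b c d) x) y"
  unfolding tensor_lift_def free_eval_def case_prod_unfold cs.scale_sum_right
  by (subst sum.swap) (simp add: mult.commute)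

lemma tensor_lift_tensor_map:
  assumes "clinear f" "clinear g" "cbilinear \<phi>"
  shows "tensor_lift \<phi> (tensor_map f g z) = tensor_lift (\<lambda>a b. \<phi> (f a) (g b)) z"
  unfolding tensor_map_def
  by (subst clinear_lift_commute[OF clinear_tensor_lift[OF assms(3)]])
      (simp add: tensor_lift_pair[OF assms(3)])

lemma tensor_lift_pair_self: "tensor_lift (\<otimes>) z = z"
  by (rule clinear_tensor_eqI[of _ "\<lambda>x. x"])
      (intro clin | simp add: tensor_lift_pair cbilinear_tensor_pair)+

lemma tensor_lift_sum: "tensor_lift (\<lambda>a b. \<Sum>i\<in>I. \<phi> i a b) z = (\<Sum>i\<in>I. tensor_lift (\<phi> i) z)"
  by (simp add: tensor_lift_def free_eval_def cs.scale_sum_right case_prod_unfold) (rule sum.swap)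

context hopf_algebra
begin

lemmas clinear_structure [clin] =
  clinear_comp[OF linear(1)] clinear_comp[OF linear(2)] clinear_comp[OF linear(3)]

text \<open>Rebracketing of a threefold Sweedler sum, the form in which coassociativity is used
  throughout: the linear map induced by \<open>\<phi>\<close> is applied to both sides of the
  axiom.\<close>

lemma coassoc_lift:
  assumes "\<And>b c. clinear (\<lambda>a. \<phi> a b c)" "\<And>a c. clinear (\<lambda>b. \<phi> a b c)" "\<And>a b. clinear (\<lambda>c. \<phi> a b c)"
  shows "tensor_lift (\<lambda>y c. tensor_lift (\<lambda>a b. \<phi> a b c) (comult H y)) (comult H x)
    = tensor_lift (\<lambda>a y. tensor_lift (\<lambda>b c. \<phi> a b c) (comult H y)) (comult H x)"
proof -
  let ?h = "tensor_lift (\<lambda>a w. tensor_lift (\<lambda>b c. \<phi> a b c) w)"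
  have bil: "cbilinear (\<lambda>a w. tensor_lift (\<phi> a) w)" "cbilinear (\<phi> a)" for a
    by (intro clin assms)+
  have h: "clinear ?h"
    by (intro clin assms)
  have L: "?h (tensor_assoc z) = tensor_lift (\<lambda>w c. tensor_lift (\<lambda>a b. \<phi> a b c) w) z" for z
  proof -
    have bil2: "cbilinear (\<lambda>a b. \<phi> a b c)" for c by (intro clin assms)
    have lz: "clinear (\<lambda>z. ?h (tensor_assoc z))"
      "clinear (\<lambda>z. tensor_lift (\<lambda>w c. tensor_lift (\<lambda>a b. \<phi> a b c) w) z)"
      by (intro clin assms)+
    have b3: "cbilinear (\<lambda>w c. tensor_lift (\<lambda>a b. \<phi> a b c) w)"  by (intro clin assms)+
    show ?thesis
    proof (rule clinear_tensor_eqI[OF lz])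
      fix w c
      show "?h (tensor_assoc (w \<otimes> c)) = tensor_lift (\<lambda>w c. tensor_lift (\<lambda>a b. \<phi> a b c) w) (w \<otimes> c)"
        unfolding tensor_lift_pair[OF b3]
      proof (rule clinear_tensor_eqI[of "\<lambda>w. ?h (tensor_assoc (w \<otimes> c))"])
        show "clinear (\<lambda>w. ?h (tensor_assoc (w \<otimes> c)))" "clinear (tensor_lift (\<lambda>a b. \<phi> a b c))"
          by (intro clin assms)+
      qed (simp add: tensor_assoc_pair tensor_lift_pair bil bil2)
    qed
  qed
  have "?h (tensor_assoc (tensor_map (comult H) id (comult H x)))
     = ?h (tensor_map id (comult H) (comult H x))"
    by (simp add: coassoc)
  then show ?thesis unfolding L
    by (subst (asm) (1 2) tensor_lift_tensor_map) (intro clin assms | simp)+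
qed

lemma comult_mult_lift:
  assumes "cbilinear \<phi>"
  shows "tensor_lift \<phi> (comult H (x * y))
    = tensor_lift (\<lambda>x' x''. tensor_lift (\<lambda>y' y''. \<phi> (x' * y') (x'' * y'')) (comult H y))
        (comult H x)"
proof -
  have "tensor_lift \<phi> (w * z) =
      tensor_lift (\<lambda>x' x''. tensor_lift (\<lambda>y' y''. \<phi> (x' * y') (x'' * y'')) z) w" for w z
    unfolding times_tensor_def tensor_prod_def
    by (simp add: clinear_lift_commute[OF clinear_tensor_lift[OF assms]] tensor_lift_pair[OF assms])
  then show ?thesis by (simp add: comult_mult)
qed

end

section \<open>The antipode of a Hopf algebra\<close>

context hopf_algebra
begin

text \<open>Here and in the antipode versions below, \<open>h\<close> is the linear context in which
  the contracted legs occur inside a larger sum.\<close>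

lemma counit_left_lift: "clinear h \<Longrightarrow> tensor_lift (\<lambda>a b. counit H a *\<^sub>C h b) (comult H x) = h x"
  and counit_right_lift: "clinear h \<Longrightarrow> tensor_lift (\<lambda>a b. counit H b *\<^sub>C h a) (comult H x) = h x"
  using clinear_lift_commute[of h "\<lambda>a b. counit H a *\<^sub>C b" "comult H x"]
    clinear_lift_commute[of h "\<lambda>a b. counit H b *\<^sub>C a" "comult H x"]
  by (simp_all add: counit_left counit_right clinear_scale)

lemma antipode_left_lift:
    "clinear h \<Longrightarrow> tensor_lift (\<lambda>a b. h (antipode H a * b)) (comult H x) = counit H x *\<^sub>C h 1"
  and antipode_right_lift:
    "clinear h \<Longrightarrow> tensor_lift (\<lambda>a b. h (a * antipode H b)) (comult H x) = counit H x *\<^sub>C h 1"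
  using clinear_lift_commute[of h "\<lambda>a b. antipode H a * b" "comult H x"]
    clinear_lift_commute[of h "\<lambda>a b. a * antipode H b" "comult H x"]
  by (simp_all add: antipode_left antipode_right clinear_scale)

lemma antipode_one: "antipode H 1 = 1"
proof -
  have "tensor_lift (\<lambda>y z. antipode H y * z) (1 \<otimes> 1) = counit H 1 *\<^sub>C 1"
    using antipode_left[of 1] by (simp add: comult_one one_tensor_def)
  then show ?thesis
    by (subst (asm) tensor_lift_pair) (intro clin | simp add: counit_one scaleC_one)+
qed

text \<open>
  Both sides are read off from the double sum of \<open>S(x\<^sub>1 y\<^sub>1) x\<^sub>2 y\<^sub>2 S(y\<^sub>3) S(x\<^sub>3)\<close>.
\<close>

lemma antipode_mult: "antipode H (x * y) = antipode H y * antipode H x"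
proof -
  let ?S = "antipode H" and ?\<Delta> = "comult H" and ?\<epsilon> = "counit H"
  let ?\<phi> = "\<lambda>a p q c r s. ?S (a * c) * (p * (r * ?S s) * ?S q)"
  \<comment> \<open>The sum collapses from the inside out: \<open>y\<^sub>2 S(y\<^sub>3)\<close>
    first, then \<open>x\<^sub>2 S(x\<^sub>3)\<close>.\<close>
  have right: "tensor_lift (\<lambda>a b. tensor_lift (\<lambda>p q. tensor_lift (\<lambda>c d. tensor_lift (\<lambda>r s.
      ?\<phi> a p q c r s) (?\<Delta> d)) (?\<Delta> y)) (?\<Delta> b)) (?\<Delta> x) = ?S (x * y)"
  proof -
    have "tensor_lift (\<lambda>r s. ?\<phi> a p q c r s) (?\<Delta> d) = ?\<epsilon> d *\<^sub>C (?S (a * c) * (p * ?S q))" for a p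
        q c d
      by (subst antipode_right_lift[of "\<lambda>t. ?S (a * c) * (p * t * ?S q)"]) (intro clin | simp)+
    moreover have "tensor_lift (\<lambda>c d. ?\<epsilon> d *\<^sub>C (?S (a * c) * (p * ?S q))) (?\<Delta> y) =
        ?S (a * y) * (p * ?S q)" for a p q
      by (rule counit_right_lift) (intro clin)
    moreover have "tensor_lift (\<lambda>p q. ?S (a * y) * (p * ?S q)) (?\<Delta> b) = ?\<epsilon> b *\<^sub>C ?S (a * y)" for a b
      by (subst antipode_right_lift) (intro clin | simp)+
    moreover have "tensor_lift (\<lambda>a b. ?\<epsilon> b *\<^sub>C ?S (a * y)) (?\<Delta> x) = ?S (x * y)"
      by (rule counit_right_lift) (intro clin)
    ultimately show ?thesis by simp
  qed
  \<comment> \<open>Rebracketed so that the first two legs of \<open>x\<close> and of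
    \<open>y\<close> are the coproducts of \<open>b\<close> and \<open>d\<close>; these combine into
    the coproduct of \<open>b * d\<close>, to which the left antipode axiom applies.\<close>
  have "tensor_lift (\<lambda>a b. tensor_lift (\<lambda>p q. tensor_lift (\<lambda>c d. tensor_lift (\<lambda>r s.
      ?\<phi> a p q c r s) (?\<Delta> d)) (?\<Delta> y)) (?\<Delta> b)) (?\<Delta> x)
    = tensor_lift (\<lambda>b q. tensor_lift (\<lambda>a p. tensor_lift (\<lambda>c d. tensor_lift (\<lambda>r s.
      ?\<phi> a p q c r s) (?\<Delta> d)) (?\<Delta> y)) (?\<Delta> b)) (?\<Delta> x)"
    by (rule coassoc_lift[symmetric]) (intro clin)+
  also have "\<dots> = tensor_lift (\<lambda>b q. tensor_lift (\<lambda>a p. tensor_lift (\<lambda>d s. tensor_lift (\<lambda>c r.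
      ?\<phi> a p q c r s) (?\<Delta> d)) (?\<Delta> y)) (?\<Delta> b)) (?\<Delta> x)"
    by (subst coassoc_lift[of "\<lambda>c r s. ?\<phi> _ _ _ c r s"]) (intro clin refl)+
  also have "\<dots> = tensor_lift (\<lambda>b q. tensor_lift (\<lambda>d s. tensor_lift (\<lambda>a p. tensor_lift (\<lambda>c r.
      ?\<phi> a p q c r s) (?\<Delta> d)) (?\<Delta> b)) (?\<Delta> y)) (?\<Delta> x)"
    by (subst (2) tensor_lift_swap) (rule refl)
  also have "\<dots> = tensor_lift (\<lambda>b q. tensor_lift (\<lambda>d s.
      ?\<epsilon> b *\<^sub>C ?\<epsilon> d *\<^sub>C (?S s * ?S q)) (?\<Delta> y)) (?\<Delta> x)"
  proof -
    have "tensor_lift (\<lambda>a p. tensor_lift (\<lambda>c r. ?\<phi> a p q c r s) (?\<Delta> d)) (?\<Delta> b)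
      = tensor_lift (\<lambda>v w. ?S v * w * (?S s * ?S q)) (?\<Delta> (b * d))" for b d q s
      by (subst comult_mult_lift) (intro clin | simp add: mult.assoc)+
    moreover have "tensor_lift (\<lambda>v w. ?S v * w * (?S s * ?S q)) (?\<Delta> (b * d))
      = ?\<epsilon> b *\<^sub>C ?\<epsilon> d *\<^sub>C (?S s * ?S q)" for b d q s
      by (subst antipode_left_lift[of "\<lambda>t. t * (?S s * ?S q)"])
          (intro clin | simp add: counit_mult)+
    ultimately show ?thesis by simp
  qed
  also have "\<dots> = ?S y * ?S x"
  proof -
    have "tensor_lift (\<lambda>d s. ?\<epsilon> b *\<^sub>C ?\<epsilon> d *\<^sub>C (?S s * ?S q)) (?\<Delta> y) = ?\<epsilon> b *\<^sub>C (?S y * ?S q)"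
        for b q
      by (subst tensor_lift_scale) (subst counit_left_lift; intro clin refl)
    then show ?thesis by simp (rule counit_left_lift, intro clin)
  qed
  finally show ?thesis unfolding right .
qed

text \<open>
  Both \<open>\<Delta> \<circ> S\<close> and \<open>x \<mapsto> S(x\<^sub>2) \<otimes> S(x\<^sub>1)\<close> are convolution inverse to \<open>\<Delta>\<close>.
\<close>

lemma comult_antipode:
  "comult H (antipode H x) = tensor_lift (\<lambda>a b. antipode H b \<otimes> antipode H a) (comult H x)"
proof -
  let ?S = "antipode H" and ?\<Delta> = "comult H" and ?\<epsilon> = "counit H"
  let ?\<nu> = "\<lambda>x. tensor_lift (\<lambda>a b. ?S b \<otimes> ?S a) (?\<Delta> x)"
  \<comment> \<open>\<open>?\<nu>\<close> is a right convolution inverse of the coproduct: the two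
    middle legs cancel in the second tensor factor, then the two outer ones in the first.\<close>
  have inv: "tensor_lift (\<lambda>a b. ?\<Delta> a * ?\<nu> b) (?\<Delta> z) = ?\<epsilon> z *\<^sub>C 1" for z
  proof -
    have "tensor_lift (\<lambda>a b. ?\<Delta> a * ?\<nu> b) (?\<Delta> z)
      = tensor_lift (\<lambda>a b. tensor_lift (\<lambda>p q. tensor_lift (\<lambda>r s. (p * ?S s) \<otimes> (q * ?S r)) (?\<Delta> b))
          (?\<Delta> a)) (?\<Delta> z)"
    proof -
      have "?\<Delta> a * ?\<nu> b = tensor_lift (\<lambda>p q. tensor_lift (\<lambda>r s. (p * ?S s) \<otimes> (q * ?S r)) (?\<Delta> b))
          (?\<Delta> a)" for a b
      proof -
        have "?\<Delta> a * ?\<nu> b = tensor_lift (\<lambda>p q. p \<otimes> q) (?\<Delta> a) * ?\<nu> b"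
            by (simp add: tensor_lift_pair_self)
        also have "\<dots> = tensor_lift (\<lambda>p q. (p \<otimes> q) * ?\<nu> b) (?\<Delta> a)"
          by (rule clinear_lift_commute) (intro clin)
        also have "\<dots> = tensor_lift (\<lambda>p q. tensor_lift (\<lambda>r s. (p \<otimes> q) * (?S s \<otimes> ?S r)) (?\<Delta> b))
            (?\<Delta> a)"
          by (subst clinear_lift_commute[of "\<lambda>t. (_ \<otimes> _) * t"]) (intro clin refl)+
        finally show ?thesis by (simp add: tensor_pair_mult)
      qed
      then show ?thesis by simp
    qed
    also have "\<dots> = tensor_lift
        (\<lambda>p b. tensor_lift (\<lambda>q c. tensor_lift (\<lambda>r s. (p * ?S s) \<otimes> (q * ?S r)) (?\<Delta> c)) (?\<Delta> b))
        (?\<Delta> z)"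
      by (rule coassoc_lift) (intro clin)+
    also have "\<dots> = tensor_lift
        (\<lambda>p b. tensor_lift (\<lambda>c s. tensor_lift (\<lambda>q r. (p * ?S s) \<otimes> (q * ?S r)) (?\<Delta> c)) (?\<Delta> b))
        (?\<Delta> z)"
      by (subst coassoc_lift[of "\<lambda>q r s. (_ * ?S s) \<otimes> (q * ?S r)"]) (intro clin refl)+
    also have "\<dots> = tensor_lift (\<lambda>p b. tensor_lift (\<lambda>c s. ?\<epsilon> c *\<^sub>C ((p * ?S s) \<otimes> 1)) (?\<Delta> b)) (?\<Delta> z)"
      by (subst antipode_right_lift[of "\<lambda>t. _ \<otimes> t"]) (intro clin refl)+
    also have "\<dots> = tensor_lift (\<lambda>p b. (p * ?S b) \<otimes> 1) (?\<Delta> z)"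
      by (subst counit_left_lift) (intro clin refl)+
    also have "\<dots> = ?\<epsilon> z *\<^sub>C 1"
      by (subst antipode_right_lift[of "\<lambda>t. t \<otimes> 1"]) (intro clin | simp add: one_tensor_def)+
    finally show ?thesis .
  qed
  have "?\<Delta> (?S x) = tensor_lift (\<lambda>a b. ?\<epsilon> b *\<^sub>C ?\<Delta> (?S a)) (?\<Delta> x)"
    by (rule counit_right_lift[symmetric]) (intro clin)
  also have "\<dots> = tensor_lift (\<lambda>a b. tensor_lift (\<lambda>p q. ?\<Delta> (?S a) * (?\<Delta> p * ?\<nu> q)) (?\<Delta> b)) (?\<Delta> x)"
  proof -
    have "tensor_lift (\<lambda>p q. ?\<Delta> (?S a) * (?\<Delta> p * ?\<nu> q)) (?\<Delta> b) = ?\<epsilon> b *\<^sub>C ?\<Delta> (?S a)" for a b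
      by (subst clinear_lift_commute[of "\<lambda>t. ?\<Delta> (?S a) * t", symmetric])
        (intro clin | simp add: inv mult_scaleC_right)+
    then show ?thesis by simp
  qed
  also have "\<dots> = tensor_lift (\<lambda>b q. tensor_lift (\<lambda>a p. ?\<Delta> (?S a) * (?\<Delta> p * ?\<nu> q)) (?\<Delta> b)) (?\<Delta> x)"
    by (rule coassoc_lift[symmetric]) (intro clin)+
  also have "\<dots> = tensor_lift (\<lambda>b q. ?\<epsilon> b *\<^sub>C ?\<nu> q) (?\<Delta> x)"
  proof -
    have "tensor_lift (\<lambda>a p. ?\<Delta> (?S a) * (?\<Delta> p * ?\<nu> q)) (?\<Delta> b) = ?\<epsilon> b *\<^sub>C ?\<nu> q" for b q
    proof -
      have "tensor_lift (\<lambda>a p. ?\<Delta> (?S a) * (?\<Delta> p * ?\<nu> q)) (?\<Delta> b)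
        = tensor_lift (\<lambda>a p. ?\<Delta> (?S a * p) * ?\<nu> q) (?\<Delta> b)"
        by (simp add: comult_mult mult.assoc)
      also have "\<dots> = ?\<epsilon> b *\<^sub>C (?\<Delta> 1 * ?\<nu> q)"
        by (rule antipode_left_lift) (intro clin)
      finally show ?thesis by (simp add: comult_one)
    qed
    then show ?thesis by simp
  qed
  also have "\<dots> = ?\<nu> x"
    by (rule counit_left_lift) (intro clin)
  finally show ?thesis .
qed

end

section \<open>The bimodule of the regular actions\<close>

lemma tensor_eqI2:
  assumes "cbilinear f" "cbilinear g" "\<And>a b c d. f (a \<otimes> b) (c \<otimes> d) = g (a \<otimes> b) (c \<otimes> d)"
  shows "f x y = g x y"
proof -
  have lin: "clinear (\<lambda>x. f x y)" "clinear (\<lambda>x. g x y)" "clinear (f x)" "clinear (g x)" for x y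
    using assms(1,2) by (simp_all add: cbilinear_def)
  have "f (a \<otimes> b) y = g (a \<otimes> b) y" for a b
    by (rule clinear_tensor_eqI[OF lin(3,4)]) (rule assms(3))
  then show ?thesis
    by (rule clinear_tensor_eqI[OF lin(1,2)])
qed

text \<open>Generic in the two actions so that one set of lemmas serves left and right actions, the
  latter with arguments exchanged, and so that nesting yields the actions on triple tensors.\<close>

definition act2 ::
    "('r \<Rightarrow> 'v \<Rightarrow> 'v) \<Rightarrow> ('s \<Rightarrow> 'w \<Rightarrow> 'w) \<Rightarrow> ('r::complex_space, 's::complex_space) tensor
      \<Rightarrow> ('v::complex_space, 'w::complex_space) tensor \<Rightarrow> ('v, 'w) tensor"
  where "act2 L M w z = tensor_lift (\<lambda>u v. tensor_map (L u) (M v) z) w"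

locale two_actions =
  fixes L :: "'r::complex_alg \<Rightarrow> 'v::complex_space \<Rightarrow> 'v" and M ::
      "'s::complex_alg \<Rightarrow> 'w::complex_space \<Rightarrow> 'w"
  assumes bilinear: "cbilinear L" "cbilinear M"
begin

lemmas bilinear_comps [clin] = cbilinear_comp[OF bilinear(1)] cbilinear_comp[OF bilinear(2)]

lemma cbilinear_tensor_map_actions: "cbilinear (\<lambda>u v. tensor_map (L u) (M v) z)"
  by (intro clin)

lemma act2_pair: "act2 L M (u \<otimes> v) (a \<otimes> b) = L u a \<otimes> M v b"
proof -
  have "clinear (L u)" "clinear (M v)" by (intro clin)+
  then show ?thesis
    by (simp add: act2_def tensor_lift_pair[OF cbilinear_tensor_map_actions] tensor_map_pair)
qed

lemma cbilinear_act2: "cbilinear (act2 L M)"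
  unfolding act2_def by (intro clin cbilinear_tensor_map_actions)

lemmas act2_comps [clin] = cbilinear_comp[OF cbilinear_act2]

lemma act2_mult:
  assumes "\<And>u v a. L (u * v) a = L u (L v a)" "\<And>u v a. M (u * v) a = M u (M v a)"
  shows "act2 L M (w * w') z = act2 L M w (act2 L M w' z)"
proof -
  have pair: "act2 L M ((u \<otimes> v) * w') z = act2 L M (u \<otimes> v) (act2 L M w' z)" for u v
    by (rule tensor_eqI2[of "\<lambda>w' z. act2 L M ((u \<otimes> v) * w') z"
        "\<lambda>w' z. act2 L M (u \<otimes> v) (act2 L M w' z)"])
      (intro clin | simp add: act2_pair tensor_pair_mult assms)+
  show ?thesis
    by (rule clinear_tensor_eqI[of "\<lambda>w. act2 L M (w * w') z" "\<lambda>w. act2 L M w (act2 L M w' z)",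
        OF _ _ pair]) (intro clin)+
qed

lemma act2_mult_op:
  assumes "\<And>u v a. L (u * v) a = L v (L u a)" "\<And>u v a. M (u * v) a = M v (M u a)"
  shows "act2 L M (w * w') z = act2 L M w' (act2 L M w z)"
proof -
  have pair: "act2 L M ((u \<otimes> v) * w') z = act2 L M w' (act2 L M (u \<otimes> v) z)" for u v
    by (rule tensor_eqI2[of "\<lambda>w' z. act2 L M ((u \<otimes> v) * w') z"
        "\<lambda>w' z. act2 L M w' (act2 L M (u \<otimes> v) z)"])
      (intro clin | simp add: act2_pair tensor_pair_mult assms)+
  show ?thesis
    by (rule clinear_tensor_eqI[of "\<lambda>w. act2 L M (w * w') z" "\<lambda>w. act2 L M w' (act2 L M w z)",
        OF _ _ pair]) (intro clin)+
qed

end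

lemma act2_commute:
  assumes "two_actions L M" "two_actions L' M'"
    and "\<And>u v a. L u (L' v a) = L' v (L u a)" "\<And>u v a. M u (M' v a) = M' v (M u a)"
  shows "act2 L M w (act2 L' M' w' z) = act2 L' M' w' (act2 L M w z)"
proof -
  interpret l: two_actions L M by fact
  interpret r: two_actions L' M' by fact
  have pair: "act2 L M (u \<otimes> v) (act2 L' M' w' z) = act2 L' M' w' (act2 L M (u \<otimes> v) z)" for u v
    by (rule tensor_eqI2[of "\<lambda>w' z. act2 L M (u \<otimes> v) (act2 L' M' w' z)"
        "\<lambda>w' z. act2 L' M' w' (act2 L M (u \<otimes> v) z)"])
      (intro clin | simp add: l.act2_pair r.act2_pair assms)+
  show ?thesis
    by (rule clinear_tensor_eqI[of "\<lambda>w. act2 L M w (act2 L' M' w' z)"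
        "\<lambda>w. act2 L' M' w' (act2 L M w z)", OF _ _ pair]) (intro clin)+
qed

context dynamical_setting
begin

lemma cbilinear_p: "cbilinear p"
  and p_mult_left: "p (u * v) a = tensor_lift (\<lambda>a' a''. p u a' * p v a'') (comult A a)"
  and p_mult_right: "p u (a * b) = tensor_lift (\<lambda>u' u''. p u' a * p u'' b) (comult U u)"
  and p_one_left: "p 1 a = counit A a"
  and p_one_right: "p u 1 = counit U u"
  and p_antipode: "p (antipode U u) a = p u (antipode A a)"
  using pairing by (simp_all add: hopf_pairing_def)

lemmas p_comps [clin] = cbilinear_comp[OF cbilinear_p]

lemma cbilinear_lact: "cbilinear lact" and cbilinear_ract: "cbilinear ract"
  unfolding lact_def ract_def by (intro clin)+

lemmas lact_comps [clin] = cbilinear_comp[OF cbilinear_lact] cbilinear_comp[OF cbilinear_ract]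

lemma lift_scaleC_left:
  "tensor_lift (\<lambda>a b. \<phi> a b *\<^sub>C c) z = tensor_lift \<phi> z *\<^sub>C c"
  by (rule clinear_lift_commute[symmetric]) (intro clin)

text \<open>The left action pairs \<open>u\<close> with the last leg of the coproduct, so by
  coassociativity only the second factor sees \<open>u\<close>; dually the right action only reaches
  the first factor.\<close>

lemma comult_lact: "comult A (lact u a) = tensor_map id (lact u) (comult A a)"
proof -
  have "comult A (lact u a) = tensor_lift (\<lambda>w c. p u c *\<^sub>C comult A w) (comult A a)"
    unfolding lact_def by (subst clinear_lift_commute[of "comult A"])
        (intro clin | simp add: clinear_scale[OF A.linear(1)])+
  also have "\<dots> = tensor_lift (\<lambda>w c. tensor_lift (\<lambda>a b. p u c *\<^sub>C (a \<otimes> b)) (comult A w))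
      (comult A a)"
    by (simp add: tensor_lift_scale tensor_lift_pair_self)
  also have "\<dots> = tensor_lift (\<lambda>a w. tensor_lift (\<lambda>b c. p u c *\<^sub>C (a \<otimes> b)) (comult A w))
      (comult A a)"
    by (rule A.coassoc_lift) (intro clin)+
  also have "\<dots> = tensor_map id (lact u) (comult A a)"
    unfolding lact_def tensor_map_def
    by (subst clinear_lift_commute[of "\<lambda>b. id _ \<otimes> b"]) (intro clin | simp add: tensor_pair_simps)+
  finally show ?thesis .
qed

lemma comult_ract: "comult A (ract a u) = tensor_map (\<lambda>b. ract b u) id (comult A a)"
proof -
  have "comult A (ract a u) = tensor_lift (\<lambda>c w. p u c *\<^sub>C comult A w) (comult A a)"
    unfolding ract_def by (subst clinear_lift_commute[of "comult A"])
        (intro clin | simp add: clinear_scale[OF A.linear(1)])+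
  also have "\<dots> = tensor_lift (\<lambda>c w. tensor_lift (\<lambda>a b. p u c *\<^sub>C (a \<otimes> b)) (comult A w))
      (comult A a)"
    by (simp add: tensor_lift_scale tensor_lift_pair_self)
  also have "\<dots> = tensor_lift (\<lambda>w b. tensor_lift (\<lambda>c a. p u c *\<^sub>C (a \<otimes> b)) (comult A w))
      (comult A a)"
    by (rule A.coassoc_lift[symmetric]) (intro clin)+
  also have "\<dots> = tensor_map (\<lambda>b. ract b u) id (comult A a)"
    unfolding ract_def tensor_map_def
    by (subst clinear_lift_commute[of "\<lambda>b. b \<otimes> id _"]) (intro clin | simp add: tensor_pair_simps)+
  finally show ?thesis .
qed

text \<open>Both sides are the sum of \<open>a\<^sub>1 \<otimes> a\<^sub>3\<close> weighted by
  \<open>p u a\<^sub>2\<close>; coassociativity only decides to which neighbour the middle leg is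
  attached.\<close>

lemma lact_ract_middle:
  "tensor_map (lact u) id (comult A a) = tensor_map id (\<lambda>b. ract b u) (comult A a)"
proof -
  have "tensor_map (lact u) id (comult A a)
    = tensor_lift (\<lambda>w c. tensor_lift (\<lambda>a b. p u b *\<^sub>C (a \<otimes> c)) (comult A w)) (comult A a)"
    unfolding lact_def tensor_map_def
    by (subst clinear_lift_commute[of "\<lambda>b. b \<otimes> id _"]) (intro clin | simp add: tensor_pair_simps)+
  also have "\<dots> = tensor_lift (\<lambda>a w. tensor_lift (\<lambda>b c. p u b *\<^sub>C (a \<otimes> c)) (comult A w))
      (comult A a)"
    by (rule A.coassoc_lift) (intro clin)+
  also have "\<dots> = tensor_map id (\<lambda>b. ract b u) (comult A a)"
    unfolding ract_def tensor_map_def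
    by (subst clinear_lift_commute[of "\<lambda>b. id _ \<otimes> b"]) (intro clin | simp add: tensor_pair_simps)+
  finally show ?thesis .
qed

lemma lact_lift:
  assumes "cbilinear \<phi>"
  shows "tensor_lift \<phi> (comult A (lact u a)) = tensor_lift (\<lambda>b c. \<phi> b (lact u c)) (comult A a)"
  unfolding comult_lact by (subst tensor_lift_tensor_map) (intro clin assms | simp)+

lemma ract_lift:
  assumes "cbilinear \<phi>"
  shows "tensor_lift \<phi> (comult A (ract a u)) = tensor_lift (\<lambda>b c. \<phi> (ract b u) c) (comult A a)"
  unfolding comult_ract by (subst tensor_lift_tensor_map) (intro clin assms | simp)+

lemma middle_lift:
  assumes "cbilinear \<phi>"
  shows "tensor_lift (\<lambda>b c. \<phi> (lact u b) c) (comult A a) =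
      tensor_lift (\<lambda>b c. \<phi> b (ract c u)) (comult A a)"
proof -
  have "tensor_lift \<phi> (tensor_map (lact u) id (comult A a)) =
      tensor_lift \<phi> (tensor_map id (\<lambda>b. ract b u) (comult A a))"
    by (simp add: lact_ract_middle)
  then show ?thesis
    by (subst (asm) (1 2) tensor_lift_tensor_map) (intro clin assms | simp)+
qed

lemma counit_lact: "counit A (lact u a) = p u a"
proof -
  have "counit A (lact u a) = tensor_lift (\<lambda>b c. counit A b *\<^sub>C p u c) (comult A a)"
    unfolding lact_def by (subst clinear_lift_commute[of "counit A"])
      (intro clin | simp add: clinear_scale[OF A.linear(2)] scaleC_complex_def mult.commute)+
  also have "\<dots> = p u a" by (rule A.counit_left_lift) (intro clin)
  finally show ?thesis .
qed

lemma counit_ract: "counit A (ract a u) = p u a"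
proof -
  have "counit A (ract a u) = tensor_lift (\<lambda>b c. counit A c *\<^sub>C p u b) (comult A a)"
    unfolding ract_def by (subst clinear_lift_commute[of "counit A"])
      (intro clin | simp add: clinear_scale[OF A.linear(2)] scaleC_complex_def mult.commute)+
  also have "\<dots> = p u a" by (rule A.counit_right_lift) (intro clin)
  finally show ?thesis .
qed

lemma lact_mult: "lact (u * v) a = lact u (lact v a)"
proof -
  have "lact u (lact v a) = tensor_lift (\<lambda>b c. p u (lact v c) *\<^sub>C b) (comult A a)"
    unfolding lact_def[of u "lact v a"] by (rule lact_lift) (intro clin)
  moreover have "p u (lact v c) = p (u * v) c" for c
    by (simp add: lact_def p_mult_left clinear_lift_commute[of "p u"] clinear_scale[of "p u"]
        cbilinear_p[unfolded cbilinear_def]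
        scaleC_complex_def mult.commute)
  ultimately show ?thesis by (simp add: lact_def[of "u * v"])
qed

lemma ract_mult: "ract a (u * v) = ract (ract a u) v"
proof -
  have "ract (ract a u) v = tensor_lift (\<lambda>b c. p v (ract b u) *\<^sub>C c) (comult A a)"
    unfolding ract_def[of "ract a u" v] by (rule ract_lift) (intro clin)
  moreover have "p v (ract c u) = p (u * v) c" for c
    by (simp add: ract_def p_mult_left clinear_lift_commute[of "p v"] clinear_scale[of "p v"]
        cbilinear_p[unfolded cbilinear_def]
        scaleC_complex_def mult.commute)
  ultimately show ?thesis by (simp add: ract_def[of _ "u * v"])
qed

lemma lact_ract: "lact u (ract a v) = ract (lact u a) v"
proof -
  have "lact u (ract a v) = tensor_lift (\<lambda>b c. p u c *\<^sub>C ract b v) (comult A a)"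
    unfolding lact_def[of u "ract a v"] by (rule ract_lift) (intro clin)
  also have "\<dots> = ract (lact u a) v"
    unfolding lact_def[of u a]
    by (subst clinear_lift_commute[of "\<lambda>b. ract b v"])
        (intro clin | simp add: cbilinear_simps[OF cbilinear_ract])+
  finally show ?thesis .
qed

lemma lact_one: "lact 1 a = a" and ract_one: "ract a 1 = a"
  by (simp_all add: lact_def ract_def p_one_left A.counit_left A.counit_right)

lemma lact_unit: "lact u 1 = counit U u *\<^sub>C 1" and ract_unit: "ract 1 u = counit U u *\<^sub>C 1"
  unfolding lact_def ract_def A.comult_one one_tensor_def
  by (subst tensor_lift_pair; (intro clin)?; simp add: p_one_right)+

text \<open>The antipode reverses the coproduct, which exchanges the two actions, and it is
  self-adjoint for the pairing, which moves it onto \<open>u\<close>.\<close>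

lemma lact_antipode: "lact u (antipode A a) = antipode A (ract a (antipode U u))"
proof -
  have "lact u (antipode A a) =
      tensor_lift (\<lambda>b c. p u (antipode A b) *\<^sub>C antipode A c) (comult A a)"
    unfolding lact_def A.comult_antipode
    by (subst clinear_lift_commute; (subst tensor_lift_pair)?; (intro clin refl)?)
  also have "\<dots> = antipode A (ract a (antipode U u))"
    unfolding ract_def
    by (subst clinear_lift_commute[of "antipode A"])
        (intro clin | simp add: p_antipode clinear_scale[OF A.linear(3)])+
  finally show ?thesis .
qed

lemma ract_antipode: "ract (antipode A a) u = antipode A (lact (antipode U u) a)"
proof -
  have "ract (antipode A a) u =
      tensor_lift (\<lambda>b c. p u (antipode A c) *\<^sub>C antipode A b) (comult A a)"
    unfolding ract_def A.comult_antipode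
    by (subst clinear_lift_commute; (subst tensor_lift_pair)?; (intro clin refl)?)
  also have "\<dots> = antipode A (lact (antipode U u) a)"
    unfolding lact_def
    by (subst clinear_lift_commute[of "antipode A"])
        (intro clin | simp add: p_antipode clinear_scale[OF A.linear(3)])+
  finally show ?thesis .
qed

end

section \<open>Weights\<close>

lemma subspace_zero: "cs.subspace {0}"
  by (simp add: cs.subspace_def)

lemma tensor_map_mult:
  fixes f :: "'a::complex_alg \<Rightarrow> 'c::complex_alg" and g :: "'b::complex_alg \<Rightarrow> 'd::complex_alg"
  assumes lin: "clinear f" "clinear g"
    and mult: "\<And>x y. f (x * y) = f x * f y" "\<And>x y. g (x * y) = g x * g y"
  shows "tensor_map f g (z * w) = tensor_map f g z * tensor_map f g w"
  by (rule tensor_eqI2[of "\<lambda>z w. tensor_map f g (z * w)"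
      "\<lambda>z w. tensor_map f g z * tensor_map f g w"])
    (intro clin lin | simp add: tensor_map_pair[OF lin] tensor_pair_mult mult)+

lemma tensor_assoc_mult:
  fixes z w :: "(('a::complex_alg, 'b::complex_alg) tensor, 'c::complex_alg) tensor"
  shows "tensor_assoc (z * w) = tensor_assoc z * tensor_assoc w"
proof (rule tensor_eqI2[of "\<lambda>z w. tensor_assoc (z * w)" "\<lambda>z w. tensor_assoc z * tensor_assoc w"])
  fix a c :: "('a, 'b) tensor" and b d :: 'c
  show "tensor_assoc ((a \<otimes> b) * (c \<otimes> d)) = tensor_assoc (a \<otimes> b) * tensor_assoc (c \<otimes> d)"
    unfolding tensor_pair_mult
    by (rule tensor_eqI2[of "\<lambda>a c. tensor_assoc ((a * c) \<otimes> (b * d))"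
        "\<lambda>a c. tensor_assoc (a \<otimes> b) * tensor_assoc (c \<otimes> d)"])
      (intro clin | simp add: tensor_pair_mult tensor_assoc_pair)+
qed (intro clin)+

context dynamical_setting
begin

section \<open>Group-like elements of \<open>T\<close>, characters and weight projectors\<close>

lemma U_grouplike: "t \<in> T \<Longrightarrow> comult U t = t \<otimes> t" "t \<in> T \<Longrightarrow> counit U t = 1"
  using subgroup by (auto simp: finite_abelian_subgroup_def grouplike_def)

lemma finite_T: "finite T" and one_in_T: "1 \<in> T" and mult_in_T: "s \<in> T \<Longrightarrow> t \<in> T \<Longrightarrow> s * t \<in> T"
  and mult_comm_T: "s \<in> T \<Longrightarrow> t \<in> T \<Longrightarrow> s * t = t * s"
  using subgroup unfolding finite_abelian_subgroup_def by blast+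

text \<open>For group-like \<open>t\<close> the antipode axioms say that \<open>antipode U t\<close>
  is the inverse of \<open>t\<close>; uniqueness of inverses then places it in
  \<open>T\<close>.\<close>

lemma antipode_T:
  assumes "t \<in> T"
  shows "antipode U t * t = 1" "t * antipode U t = 1" "antipode U t \<in> T"
proof -
  show l: "antipode U t * t = 1" and r: "t * antipode U t = 1"
    using U.antipode_left[of t] U.antipode_right[of t]
    by (simp_all add: U_grouplike[OF assms] scaleC_one tensor_lift_pair clin)
  obtain s where "s \<in> T" "t * s = 1"
    using subgroup assms unfolding finite_abelian_subgroup_def by blast
  moreover from this have "antipode U t * (t * s) = antipode U t" by simp
  then have "s = antipode U t" unfolding mult.assoc[symmetric] l by simp
  ultimately show "antipode U t \<in> T" by simp
qed

lemma chr_mult: "s \<in> T \<Longrightarrow> t \<in> T \<Longrightarrow> chr \<alpha> (s * t) = chr \<alpha> s * chr \<alpha> t"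
  and chr_nonzero: "t \<in> T \<Longrightarrow> chr \<alpha> t \<noteq> 0"
  and chr_add: "t \<in> T \<Longrightarrow> chr (\<alpha> + \<beta>) t = chr \<alpha> t * chr \<beta> t"
  using characters by (auto simp: character_group_def character_def)

lemma chr_one: "chr \<alpha> 1 = 1"
  using chr_mult[OF one_in_T one_in_T, of \<alpha>] chr_nonzero[OF one_in_T, of \<alpha>] by simp

lemma chr_zero: "t \<in> T \<Longrightarrow> chr 0 t = 1"
  using chr_add[of t 0 0] chr_nonzero[of t 0] by simp

lemma chr_uminus: "t \<in> T \<Longrightarrow> chr (- \<alpha>) t = 1 / chr \<alpha> t"
  using chr_add[of t "- \<alpha>" \<alpha>] chr_zero[of t] chr_nonzero[of t \<alpha>] by (simp add: field_simps)

lemma chr_antipode: "t \<in> T \<Longrightarrow> chr \<alpha> (antipode U t) = chr (- \<alpha>) t"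
  using chr_mult[of "antipode U t" t \<alpha>] antipode_T[of t] chr_nonzero[of t \<alpha>]
  by (simp add: chr_uminus chr_one field_simps)

lemma chr_inj: "(\<And>t. t \<in> T \<Longrightarrow> chr \<alpha> t = chr \<beta> t) \<Longrightarrow> \<alpha> = \<beta>"
  using characters unfolding character_group_def by metis

lemma sum_chr: "(\<Sum>t\<in>T. chr \<alpha> t) = (if \<alpha> = 0 then of_nat (card T) else 0)"
proof (cases "\<alpha> = 0")
  case False
  then obtain s where s: "s \<in> T" "chr \<alpha> s \<noteq> 1"
    using chr_inj[of \<alpha> 0] chr_zero by metis
  have "bij_betw ((*) s) T T"
    by (rule bij_betw_byWitness[of _ "(*) (antipode U s)"])
      (use s antipode_T[of s] mult_in_T in \<open>auto simp flip: mult.assoc\<close>)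
  then have "(\<Sum>t\<in>T. chr \<alpha> t) = (\<Sum>t\<in>T. chr \<alpha> (s * t))"
    by (rule sum.reindex_bij_betw[symmetric])
  also have "\<dots> = chr \<alpha> s * (\<Sum>t\<in>T. chr \<alpha> t)"
    by (simp add: chr_mult s sum_distrib_left)
  finally show ?thesis using s False by simp
qed (simp add: chr_zero)

lemma card_T: "card T \<noteq> 0"
  using finite_T one_in_T by auto

text \<open>Orthogonality of characters in the form needed for everything below: \<open>h\<close>
  will be multiplication by a projector or an action on a fixed homogeneous element.\<close>

lemma weight_proj_eval:
  assumes "clinear h" "\<And>t. t \<in> T \<Longrightarrow> h t = chr \<beta> t *\<^sub>C v"
  shows "h (\<pi> \<alpha>) = (if \<alpha> = \<beta> then v else 0)"
proof -
  have "chr (- \<alpha>) t *\<^sub>C chr \<beta> t *\<^sub>C v = chr (\<beta> - \<alpha>) t *\<^sub>C v" if "t \<in> T" for t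
    using chr_add[OF that, of \<beta> "- \<alpha>"] by (simp add: mult.commute)
  then have "h (\<pi> \<alpha>) = (1 / of_nat (card T)) *\<^sub>C (\<Sum>t\<in>T. chr (\<beta> - \<alpha>) t *\<^sub>C v)"
    by (simp only: weight_proj_def clinear_scale[OF assms(1)] clinear_sum[OF assms(1)] assms(2)
        cong: sum.cong)
  also have "\<dots> = ((1 / of_nat (card T)) * (\<Sum>t\<in>T. chr (\<beta> - \<alpha>) t)) *\<^sub>C v"
    by (simp only: cs.scale_sum_left[symmetric] cs.scale_scale)
  also have "\<dots> = (if \<alpha> = \<beta> then v else 0)"
    using card_T by (simp add: sum_chr scaleC_one)
  finally show ?thesis .
qed

lemma T_weight_proj:
  assumes "s \<in> T"
  shows "s * \<pi> \<alpha> = chr \<alpha> s *\<^sub>C \<pi> \<alpha>"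
proof -
  have bij: "bij_betw ((*) s) T T"
    by (rule bij_betw_byWitness[of _ "(*) (antipode U s)"])
      (use assms antipode_T[of s] mult_in_T in \<open>auto simp flip: mult.assoc\<close>)
  have "chr \<alpha> s *\<^sub>C (\<Sum>t\<in>T. chr (- \<alpha>) t *\<^sub>C t) = chr \<alpha> s *\<^sub>C (\<Sum>t\<in>T. chr (- \<alpha>) (s * t) *\<^sub>C (s * t))"
    by (simp add: sum.reindex_bij_betw[OF bij, of "\<lambda>t. chr (- \<alpha>) t *\<^sub>C t"])
  also have "\<dots> = (\<Sum>t\<in>T. chr (- \<alpha>) t *\<^sub>C (s * t))"
    unfolding cs.scale_sum_right
    by (rule sum.cong) (use assms chr_nonzero in \<open>auto simp: chr_mult chr_uminus\<close>)
  finally show ?thesis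
    by (simp only: weight_proj_def mult_scaleC_right sum_distrib_left
        cs.scale_left_commute[of "chr \<alpha> s"])
qed

lemma weight_proj_T:
  assumes "s \<in> T"
  shows "\<pi> \<alpha> * s = chr \<alpha> s *\<^sub>C \<pi> \<alpha>"
proof -
  have "(\<Sum>t\<in>T. chr (- \<alpha>) t *\<^sub>C (t * s)) = (\<Sum>t\<in>T. chr (- \<alpha>) t *\<^sub>C (s * t))"
    by (intro sum.cong refl arg_cong[of _ _ "scaleC _"] mult_comm_T assms)
  then show ?thesis
    unfolding T_weight_proj[OF assms, symmetric]
    by (simp only: weight_proj_def mult_scaleC_right mult_scaleC_left sum_distrib_left
        sum_distrib_right)
qed

lemma weight_proj_orth: "\<pi> \<alpha> * \<pi> \<beta> = (if \<alpha> = \<beta> then \<pi> \<beta> else 0)"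
  by (rule weight_proj_eval[of "\<lambda>u. u * \<pi> \<beta>"]) (intro clin | simp add: T_weight_proj)+

section \<open>Homogeneous components in \<open>A\<close> and in coproducts\<close>

lemma biweightD: "a \<in> biweight \<alpha> \<beta> \<Longrightarrow> t \<in> T \<Longrightarrow> lact t a = chr \<beta> t *\<^sub>C a"
  "a \<in> biweight \<alpha> \<beta> \<Longrightarrow> t \<in> T \<Longrightarrow> ract a t = chr \<alpha> t *\<^sub>C a"
  by (simp_all add: biweight_def)

lemma weight_proj_biweight:
  assumes "a \<in> biweight \<alpha> \<beta>"
  shows "lact (\<pi> \<gamma>) a = (if \<gamma> = \<beta> then a else 0)" "ract a (\<pi> \<gamma>) = (if \<gamma> = \<alpha> then a else 0)"
  by (rule weight_proj_eval; (intro clin)?; simp add: biweightD[OF assms])+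

text \<open>An explicit linear projection onto \<open>biweight \<alpha> \<beta>\<close>. It replaces
  the definite description in \<open>component\<close>, from which linearity could not be read
  off.\<close>

definition bicomp :: "'g \<Rightarrow> 'g \<Rightarrow> 'a \<Rightarrow> 'a"
  where "bicomp \<alpha> \<beta> a = ract (lact (\<pi> \<beta>) a) (\<pi> \<alpha>)"

lemma clinear_bicomp [clin]: "clinear f \<Longrightarrow> clinear (\<lambda>x. bicomp \<alpha> \<beta> (f x))"
  unfolding bicomp_def by (intro clin)

lemma subspace_biweight: "cs.subspace (biweight \<alpha> \<beta>)"
  by (auto simp: cs.subspace_def biweight_def cbilinear_simps[OF cbilinear_lact]
      cbilinear_simps[OF cbilinear_ract]
      scaleC_add_right mult.commute clinear_zero[OF lact_comps(2)[OF clinear_id_fun]]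
          clinear_zero[OF lact_comps(3)[OF clinear_id_fun]])

lemma bicomp_biweight: "bicomp \<alpha> \<beta> a \<in> biweight \<alpha> \<beta>"
  by (simp add: biweight_def bicomp_def lact_ract T_weight_proj weight_proj_T
      cbilinear_simps[OF cbilinear_ract] cbilinear_simps[OF cbilinear_lact]
      flip: lact_mult ract_mult)

lemma bicomp_of_biweight: "a \<in> biweight \<alpha> \<beta> \<Longrightarrow> bicomp \<gamma> \<delta> a = (if \<gamma> = \<alpha> \<and> \<delta> = \<beta> then a else 0)"
  by (auto simp: bicomp_def weight_proj_biweight clinear_zero[OF lact_comps(3)[OF clinear_id_fun]])

lemma sum_pair_UNIV: "(\<Sum>i\<in>UNIV. f i) = (\<Sum>\<alpha>\<in>UNIV. \<Sum>\<beta>\<in>UNIV. f (\<alpha>, \<beta>))"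
  for f :: "'i::finite \<times> 'j::finite \<Rightarrow> 'v::comm_monoid_add"
  by (simp add: sum.cartesian_product UNIV_Times_UNIV[symmetric] del: UNIV_Times_UNIV)

text \<open>Semisimplicity of \<open>A\<close> enters here: it supplies some homogeneous components
  of \<open>a\<close>, and the projections recover them.\<close>

lemma sum_bicomp: "(\<Sum>\<alpha>\<in>UNIV. \<Sum>\<beta>\<in>UNIV. bicomp \<alpha> \<beta> a) = a"
proof -
  obtain c where c': "\<forall>i. c i \<in> (case i of (\<alpha>, \<beta>) \<Rightarrow> biweight \<alpha> \<beta>)" and a': "(\<Sum>i\<in>UNIV. c i) = a"
    using bi_semisimple unfolding is_direct_sum_def by blast
  have c: "c (\<alpha>, \<beta>) \<in> biweight \<alpha> \<beta>" for \<alpha> \<beta>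
    using c'[rule_format, of "(\<alpha>, \<beta>)"] by simp
  have a: "(\<Sum>\<gamma>\<in>UNIV. \<Sum>\<delta>\<in>UNIV. c (\<gamma>, \<delta>)) = a"
    using a' by (simp add: sum_pair_UNIV)
  have "bicomp \<alpha> \<beta> a = c (\<alpha>, \<beta>)" for \<alpha> \<beta>
  proof -
    have "bicomp \<alpha> \<beta> a = (\<Sum>\<gamma>\<in>UNIV. \<Sum>\<delta>\<in>UNIV. bicomp \<alpha> \<beta> (c (\<gamma>, \<delta>)))"
      unfolding a[symmetric] by (simp add: clinear_sum[OF clinear_bicomp[OF clinear_id_fun]])
    also have "\<dots> = (\<Sum>\<gamma>\<in>UNIV. \<Sum>\<delta>\<in>UNIV. if \<delta> = \<beta> then if \<gamma> = \<alpha> then c (\<gamma>, \<delta>) else 0 else 0)"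
      by (intro sum.cong refl) (auto simp: bicomp_of_biweight[OF c])
    also have "\<dots> = c (\<alpha>, \<beta>)"
      by simp
    finally show ?thesis .
  qed
  then show ?thesis using a by simp
qed

text \<open>The outer degrees are inherited from \<open>a\<close>, because the right action reaches
  only the first leg and the left action only the second. The inner degrees agree because a
  projector acting on the inner side of one leg may be moved to the other leg, and distinct
  projectors multiply to 0.\<close>

lemma comult_biweight:
  assumes "a \<in> biweight \<alpha> \<beta>"
  shows "comult A a = (\<Sum>\<gamma>\<in>UNIV. tensor_map (bicomp \<alpha> \<gamma>) (bicomp \<gamma> \<beta>) (comult A a))"
proof -
  \<comment> \<open>The two outer projectors are absorbed into \<open>a\<close>; \<open>u\<close>
    and \<open>v\<close> stand for the inner ones.\<close>
  have Z: "tensor_map (\<lambda>b. ract (lact u b) (\<pi> \<gamma>)) (\<lambda>c. ract (lact (\<pi> \<delta>) c) v) (comult A a)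
     = (if \<gamma> = \<alpha> \<and> \<delta> = \<beta> then tensor_map (lact u) (\<lambda>c. ract c v) (comult A a) else 0)" for u v \<gamma> \<delta>
  proof -
    have "tensor_map (\<lambda>b. ract (lact u b) (\<pi> \<gamma>)) (\<lambda>c. ract (lact (\<pi> \<delta>) c) v) (comult A a)
      = tensor_map (lact u) (\<lambda>c. ract c v) (comult A (lact (\<pi> \<delta>) (ract a (\<pi> \<gamma>))))"
      unfolding tensor_map_def by (subst lact_lift, intro clin, subst ract_lift, intro clin)
          (simp add: lact_ract)
    then show ?thesis
      by (auto simp: weight_proj_biweight[OF assms] clinear_zero[OF A.linear(1)]
          clinear_zero[OF lact_comps(2)[OF clinear_id_fun]]
          clinear_zero[OF clinear_tensor_map_arg[OF _ _ clinear_id_fun]] clin)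
  qed
  have lin: "clinear (lact u)" "clinear (\<lambda>c. ract c v)" for u v
    by (intro clin)+
  have "comult A a = tensor_lift
      (\<lambda>b c. (\<Sum>\<gamma>'\<in>UNIV. \<Sum>\<gamma>\<in>UNIV. bicomp \<gamma>' \<gamma> b) \<otimes> (\<Sum>\<delta>\<in>UNIV. \<Sum>\<beta>'\<in>UNIV. bicomp \<delta> \<beta>' c)) (comult A a)"
    by (simp add: sum_bicomp tensor_lift_pair_self)
  also have "\<dots> = (\<Sum>\<gamma>'\<in>UNIV. \<Sum>\<gamma>\<in>UNIV. \<Sum>\<delta>\<in>UNIV. \<Sum>\<beta>'\<in>UNIV. tensor_map (bicomp \<gamma>' \<gamma>) (bicomp \<delta> \<beta>')
      (comult A a))"
    unfolding tensor_map_def by (simp only: tensor_pair_sum_left)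
        (simp only: tensor_pair_sum_right tensor_lift_sum)
  also have "\<dots> = (\<Sum>\<gamma>'\<in>UNIV. \<Sum>\<gamma>\<in>UNIV. \<Sum>\<delta>\<in>UNIV. \<Sum>\<beta>'\<in>UNIV.
      if \<beta>' = \<beta> then if \<delta> = \<gamma> then if \<gamma>' = \<alpha> then tensor_map (bicomp \<gamma>' \<gamma>) (bicomp \<delta> \<beta>')
          (comult A a) else 0 else 0 else 0)"
  proof (intro sum.cong refl)
    fix \<gamma>' \<gamma> \<delta> \<beta>'
    have "tensor_map (lact (\<pi> \<gamma>)) (\<lambda>c. ract c (\<pi> \<delta>)) (comult A a)
      = tensor_map id (\<lambda>c. ract c (\<pi> \<gamma> * \<pi> \<delta>)) (comult A a)"
      unfolding tensor_map_def by (subst middle_lift) (intro clin | simp add: ract_mult)+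
    then have "\<gamma> \<noteq> \<delta> \<Longrightarrow> tensor_map (lact (\<pi> \<gamma>)) (\<lambda>c. ract c (\<pi> \<delta>)) (comult A a) = 0"
      by (simp add: weight_proj_orth clinear_zero[OF lact_comps(4)[OF clinear_id_fun]]
          tensor_map_def
          clinear_zero[OF cbilinear_comps(6)[OF clinear_id_fun]])
              (simp add: tensor_lift_def free_eval_def)
    then show "tensor_map (bicomp \<gamma>' \<gamma>) (bicomp \<delta> \<beta>') (comult A a)
      = (if \<beta>' = \<beta> then if \<delta> = \<gamma> then if \<gamma>' = \<alpha> then tensor_map (bicomp \<gamma>' \<gamma>) (bicomp \<delta> \<beta>')
          (comult A a) else 0 else 0 else 0)"
      by (auto simp: bicomp_def[abs_def] Z)
  qed
  also have "\<dots> = (\<Sum>\<gamma>\<in>UNIV. tensor_map (bicomp \<alpha> \<gamma>) (bicomp \<gamma> \<beta>) (comult A a))"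
    by (subst sum.swap) simp
  finally show ?thesis .
qed

text \<open>The homogeneous expansion of the coproduct as an elimination rule: only pure tensors
  with matching inner degree \<open>\<gamma>\<close> have to be considered. With
  \<open>V = {0}\<close> it proves equalities.\<close>

lemma comult_biweight_mem:
  assumes "a \<in> biweight \<alpha> \<beta>" "clinear f" "cs.subspace V"
    and "\<And>\<gamma> b c. b \<in> biweight \<alpha> \<gamma> \<Longrightarrow> c \<in> biweight \<gamma> \<beta> \<Longrightarrow> f (b \<otimes> c) \<in> V"
  shows "f (comult A a) \<in> V"
proof -
  have lin: "clinear (bicomp \<gamma> \<delta>)" for \<gamma> \<delta> by (intro clin)
  have "f (tensor_map (bicomp \<alpha> \<gamma>) (bicomp \<gamma> \<beta>) z) \<in> V" for \<gamma> z
    by (induction z rule: tensor_induct)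
      (simp_all add: clinear_zero[OF clinear_tensor_map[OF lin lin]]
          clinear_add[OF clinear_tensor_map[OF lin lin]]
        clinear_zero[OF assms(2)] clinear_add[OF assms(2)] cs.subspace_0[OF assms(3)]
            cs.subspace_add[OF assms(3)]
        tensor_map_pair[OF lin lin] assms(4)[OF bicomp_biweight bicomp_biweight])
  then show ?thesis
    by (subst comult_biweight[OF assms(1)])
        (simp add: clinear_sum[OF assms(2)] cs.subspace_sum[OF assms(3)])
qed

lemma comult_biweight_eqI:
  assumes "a \<in> biweight \<alpha> \<beta>" "clinear f" "clinear g"
    and "\<And>\<gamma> b c. b \<in> biweight \<alpha> \<gamma> \<Longrightarrow> c \<in> biweight \<gamma> \<beta> \<Longrightarrow> f (b \<otimes> c) = g (b \<otimes> c)"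
  shows "f (comult A a) = g (comult A a)"
proof -
  have "f (comult A a) - g (comult A a) \<in> {0}"
    by (rule comult_biweight_mem[OF assms(1) _ subspace_zero, of "\<lambda>z. f z - g z"])
      (intro clin assms | simp add: assms(4))+
  then show ?thesis by simp
qed

text \<open>The counit of \<open>t \<cdot> a\<close> and of \<open>a \<cdot> t\<close> are both the
  pairing of \<open>t\<close> with \<open>a\<close>, so a nonzero value forces equal left and right
  weights.\<close>

lemma counit_biweight: "a \<in> biweight \<alpha> \<beta> \<Longrightarrow> \<alpha> \<noteq> \<beta> \<Longrightarrow> counit A a = 0"
proof -
  assume a: "a \<in> biweight \<alpha> \<beta>" and ne: "\<alpha> \<noteq> \<beta>"
  then obtain t where t: "t \<in> T" "chr \<alpha> t \<noteq> chr \<beta> t" using chr_inj by blast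
  have "counit A (lact t a) = counit A (ract a t)" by (simp add: counit_lact counit_ract)
  then show ?thesis
    using t by (simp add: biweightD[OF a] clinear_scale[OF A.linear(2)] scaleC_complex_def)
qed

end

section \<open>Actions on tensor powers\<close>

lemma minv_inverse:
  assumes "invertible_elt x"
  shows "x * minv x = 1" "minv x * x = 1"
proof -
  obtain y where y: "x * y = 1" "y * x = 1"
    using assms by (auto simp: invertible_elt_def)
  have "z = y" if "x * z = 1 \<and> z * x = 1" for z
  proof -
    have "z = (y * x) * z" by (simp add: y)
    also have "\<dots> = y" using that by (simp add: mult.assoc)
    finally show ?thesis .
  qed
  then have "minv x = y"
    unfolding minv_def using y by (intro the_equality conjI)
  then show "x * minv x = 1" "minv x * x = 1" using y by simp_all
qed

lemma inverse_commute:
  fixes x :: "'a::monoid_mult"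
  assumes "x * y = 1" "y * x = 1" "x * t = t * x"
  shows "y * t = t * y"
proof -
  have "y * t = y * (t * x) * y" by (simp only: mult.assoc assms(1) mult_1_right)
  also have "\<dots> = (y * x) * t * y" by (simp only: assms(3)[symmetric] mult.assoc)
  finally show ?thesis by (simp only: assms(2) mult_1_left)
qed

context dynamical_setting
begin

sublocale l2: two_actions lact lact
  by unfold_locales (rule cbilinear_lact)+

sublocale r2: two_actions "\<lambda>u a. ract a u" "\<lambda>u a. ract a u"
  by unfold_locales (intro clin)+

lemma lact2_act2: "lact2 = act2 lact lact"
  and ract2_act2: "ract2 z w = act2 (\<lambda>u a. ract a u) (\<lambda>u a. ract a u) w z"
  by (simp_all add: fun_eq_iff lact2_def ract2_def act2_def)

lemma lact2_pair: "lact2 (u \<otimes> v) (a \<otimes> b) = lact u a \<otimes> lact v b"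
  and ract2_pair: "ract2 (a \<otimes> b) (u \<otimes> v) = ract a u \<otimes> ract b v"
  by (simp_all add: lact2_act2 ract2_act2 l2.act2_pair r2.act2_pair)

lemma cbilinear_lact2: "cbilinear lact2" and cbilinear_ract2: "cbilinear ract2"
  unfolding lact2_act2 ract2_act2[abs_def] by (intro clin)+

lemmas lact2_comps [clin] = cbilinear_comp[OF cbilinear_lact2] cbilinear_comp[OF cbilinear_ract2]

lemma lact2_mult: "lact2 (w * w') z = lact2 w (lact2 w' z)"
  unfolding lact2_act2 by (rule l2.act2_mult) (rule lact_mult)+

lemma ract2_mult: "ract2 z (w * w') = ract2 (ract2 z w) w'"
  unfolding ract2_act2 by (rule r2.act2_mult_op) (rule ract_mult)+

lemma lact2_ract2: "lact2 w (ract2 z w') = ract2 (lact2 w z) w'"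
  unfolding lact2_act2 ract2_act2
  by (rule act2_commute[OF l2.two_actions_axioms r2.two_actions_axioms]) (rule lact_ract)+

section \<open>Actions on triple tensors and their passage through multiplication\<close>

sublocale l3: two_actions lact lact2
  by unfold_locales (intro clin)+

sublocale r3: two_actions "\<lambda>u a. ract a u" "\<lambda>w z. ract2 z w"
  by unfold_locales (intro clin)+

text \<open>Triple tensors are bracketed to the right, the normal form produced by
  \<open>tensor_assoc\<close>, because the two sides of the twist equation are compared
  there.\<close>

definition lact3 where "lact3 = act2 lact lact2"
definition ract3 where "ract3 z w = act2 (\<lambda>u a. ract a u) (\<lambda>w z. ract2 z w) w z"

lemma lact3_pair: "lact3 (u \<otimes> w) (a \<otimes> z) = lact u a \<otimes> lact2 w z"
  and ract3_pair: "ract3 (a \<otimes> z) (u \<otimes> w) = ract a u \<otimes> ract2 z w"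
  by (simp_all add: lact3_def ract3_def l3.act2_pair r3.act2_pair)

lemma cbilinear_lact3: "cbilinear lact3" and cbilinear_ract3: "cbilinear ract3"
  unfolding lact3_def ract3_def[abs_def] by (intro clin)+

lemmas lact3_comps [clin] = cbilinear_comp[OF cbilinear_lact3] cbilinear_comp[OF cbilinear_ract3]

lemma lact3_mult: "lact3 (w * w') z = lact3 w (lact3 w' z)"
  unfolding lact3_def by (rule l3.act2_mult) (rule lact_mult lact2_mult)+

lemma ract3_mult: "ract3 z (w * w') = ract3 (ract3 z w) w'"
  unfolding ract3_def by (rule r3.act2_mult_op) (rule ract_mult ract2_mult)+

lemma lact3_ract3: "lact3 w (ract3 z w') = ract3 (lact3 w z) w'"
  unfolding lact3_def ract3_def
  by (rule act2_commute[OF l3.two_actions_axioms r3.two_actions_axioms])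
      (rule lact_ract lact2_ract2)+

abbreviation mult_A :: "('a, 'a) tensor \<Rightarrow> 'a"
  where "mult_A \<equiv> tensor_lift (*)"

lemma mult_A_pair: "mult_A (a \<otimes> b) = a * b"
  by (simp add: tensor_lift_pair cbilinear_times)

text \<open>The pairing turns the product of \<open>A\<close> into the coproduct of
  \<open>U\<close>; exchanging the three Sweedler sums then separates the two factors.\<close>

lemma lact_times: "lact u (a * b) = mult_A (lact2 (comult U u) (a \<otimes> b))"
proof -
  have "lact u (a * b) = tensor_lift
      (\<lambda>a' a''. tensor_lift (\<lambda>b' b''. p u (a'' * b'') *\<^sub>C (a' * b')) (comult A b)) (comult A a)"
    unfolding lact_def by (rule A.comult_mult_lift) (intro clin)
  also have "\<dots> = tensor_lift
      (\<lambda>a' a''. tensor_lift (\<lambda>b' b''. tensor_lift (\<lambda>v w. (p v a'' * p w b'') *\<^sub>C (a' * b'))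
      (comult U u)) (comult A b)) (comult A a)"
    by (simp add: p_mult_right lift_scaleC_left)
  also have "\<dots> = tensor_lift
      (\<lambda>v w. tensor_lift (\<lambda>a' a''. tensor_lift (\<lambda>b' b''. (p v a'' * p w b'') *\<^sub>C (a' * b'))
      (comult A b)) (comult A a)) (comult U u)"
    by (subst (2) tensor_lift_swap) (subst tensor_lift_swap, rule refl)
  also have "\<dots> = tensor_lift (\<lambda>v w. lact v a * lact w b) (comult U u)"
  proof -
    have "tensor_lift (\<lambda>a' a''. tensor_lift (\<lambda>b' b''. (p v a'' * p w b'') *\<^sub>C (a' * b'))
        (comult A b)) (comult A a) = lact v a * lact w b" for v w
    proof -
      have "tensor_lift (\<lambda>b' b''. (p v a'' * p w b'') *\<^sub>C (a' * b')) (comult A b) =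
          (p v a'' *\<^sub>C a') * lact w b" for a' a''
        unfolding lact_def by (subst clinear_lift_commute[of "\<lambda>t. (p v a'' *\<^sub>C a') * t"])
            (intro clin | simp add: mult_scaleC_left mult_scaleC_right mult.commute)+
      then show ?thesis
        unfolding lact_def[of v] by (subst clinear_lift_commute[of "\<lambda>t. t * lact w b"])
            (intro clin | simp)+
    qed
    then show ?thesis by simp
  qed
  also have "\<dots> = mult_A (lact2 (comult U u) (a \<otimes> b))"
  proof -
    have "tensor_lift (\<lambda>v w. lact v a * lact w b) z = mult_A (lact2 z (a \<otimes> b))" for z
      by (rule clinear_tensor_eqI[of "\<lambda>z. tensor_lift (\<lambda>v w. lact v a * lact w b) z"
          "\<lambda>z. mult_A (lact2 z (a \<otimes> b))"])
        (intro clin | simp add: lact2_pair mult_A_pair tensor_lift_pair clin)+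
    then show ?thesis .
  qed
  finally show ?thesis .
qed

lemma ract_times: "ract (a * b) u = mult_A (ract2 (a \<otimes> b) (comult U u))"
proof -
  have "ract (a * b) u = tensor_lift
      (\<lambda>a' a''. tensor_lift (\<lambda>b' b''. p u (a' * b') *\<^sub>C (a'' * b'')) (comult A b)) (comult A a)"
    unfolding ract_def by (rule A.comult_mult_lift) (intro clin)
  also have "\<dots> = tensor_lift
      (\<lambda>a' a''. tensor_lift (\<lambda>b' b''. tensor_lift (\<lambda>v w. (p v a' * p w b') *\<^sub>C (a'' * b''))
      (comult U u)) (comult A b)) (comult A a)"
    by (simp add: p_mult_right lift_scaleC_left)
  also have "\<dots> = tensor_lift
      (\<lambda>v w. tensor_lift (\<lambda>a' a''. tensor_lift (\<lambda>b' b''. (p v a' * p w b') *\<^sub>C (a'' * b''))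
      (comult A b)) (comult A a)) (comult U u)"
    by (subst (2) tensor_lift_swap) (subst tensor_lift_swap, rule refl)
  also have "\<dots> = tensor_lift (\<lambda>v w. ract a v * ract b w) (comult U u)"
  proof -
    have "tensor_lift (\<lambda>a' a''. tensor_lift (\<lambda>b' b''. (p v a' * p w b') *\<^sub>C (a'' * b''))
        (comult A b)) (comult A a) = ract a v * ract b w" for v w
    proof -
      have "tensor_lift (\<lambda>b' b''. (p v a' * p w b') *\<^sub>C (a'' * b'')) (comult A b) =
          (p v a' *\<^sub>C a'') * ract b w" for a' a''
        unfolding ract_def by (subst clinear_lift_commute[of "\<lambda>t. (p v a' *\<^sub>C a'') * t"])
            (intro clin | simp add: mult_scaleC_left mult_scaleC_right mult.commute)+
      then show ?thesis
        unfolding ract_def[of _ v] by (subst clinear_lift_commute[of "\<lambda>t. t * ract b w"])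
            (intro clin | simp)+
    qed
    then show ?thesis by simp
  qed
  also have "\<dots> = mult_A (ract2 (a \<otimes> b) (comult U u))"
  proof -
    have "tensor_lift (\<lambda>v w. ract a v * ract b w) z = mult_A (ract2 (a \<otimes> b) z)" for z
      by (rule clinear_tensor_eqI[of "\<lambda>z. tensor_lift (\<lambda>v w. ract a v * ract b w) z"
          "\<lambda>z. mult_A (ract2 (a \<otimes> b) z)"])
        (intro clin | simp add: ract2_pair mult_A_pair tensor_lift_pair clin)+
    then show ?thesis .
  qed
  finally show ?thesis .
qed

lemma tensor_eqI3:
  assumes "clinear f" "clinear g" "\<And>a b c. f (a \<otimes> (b \<otimes> c)) = g (a \<otimes> (b \<otimes> c))"
  shows "f x = g x"
proof (rule clinear_tensor_eqI[OF assms(1,2)])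
  fix a y
  show "f (a \<otimes> y) = g (a \<otimes> y)"
    by (rule clinear_tensor_eqI[of "\<lambda>y. f (a \<otimes> y)" "\<lambda>y. g (a \<otimes> y)"])
      (intro clinear_comp[OF assms(1)] clinear_comp[OF assms(2)] clin assms(3))+
qed

definition mult_12 :: "('a, ('a, 'a) tensor) tensor \<Rightarrow> ('a, 'a) tensor"
  where "mult_12 = tensor_lift (\<lambda>a z. tensor_lift (\<lambda>b c. (a * b) \<otimes> c) z)"

definition mult_23 :: "('a, ('a, 'a) tensor) tensor \<Rightarrow> ('a, 'a) tensor"
  where "mult_23 = tensor_map id mult_A"

lemma clinear_mult_12: "clinear mult_12" and clinear_mult_23: "clinear mult_23"
  unfolding mult_12_def mult_23_def by (intro clin)+

lemmas mult_12_lin [clin] = clinear_comp[OF clinear_mult_12] clinear_comp[OF clinear_mult_23]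

lemma mult_12_pair: "mult_12 (a \<otimes> (b \<otimes> c)) = (a * b) \<otimes> c"
proof -
  have "cbilinear (\<lambda>(a :: 'a) z. tensor_lift (\<lambda>b (c :: 'a). (a * b) \<otimes> c) z)"
      "cbilinear (\<lambda>b (c :: 'a). (a * b) \<otimes> c)"
    by (intro clin)+
  then show ?thesis by (simp add: mult_12_def tensor_lift_pair)
qed

lemma mult_23_pair: "mult_23 (a \<otimes> z) = a \<otimes> mult_A z"
  by (simp add: mult_23_def tensor_map_pair[OF clinear_id clinear_tensor_lift[OF cbilinear_times]])

lemma mult_A_assoc: "mult_A (mult_12 t) = mult_A (mult_23 t)"
  by (rule tensor_eqI3[of "\<lambda>t. mult_A (mult_12 t)" "\<lambda>t. mult_A (mult_23 t)"])
    (intro clin | simp add: mult_12_pair mult_23_pair mult_A_pair mult.assoc)+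

lemma mult_12_assoc: "mult_12 (tensor_assoc (z \<otimes> c)) = mult_A z \<otimes> c"
  by (rule clinear_tensor_eqI[of "\<lambda>z. mult_12 (tensor_assoc (z \<otimes> c))" "\<lambda>z. mult_A z \<otimes> c"])
    (intro clin | simp add: mult_12_pair mult_A_pair tensor_assoc_pair)+

lemma lact3_assoc: "lact3 (tensor_assoc (w \<otimes> v)) (tensor_assoc (z \<otimes> c)) =
    tensor_assoc (lact2 w z \<otimes> lact v c)"
  by (rule tensor_eqI2[of "\<lambda>w z. lact3 (tensor_assoc (w \<otimes> v)) (tensor_assoc (z \<otimes> c))"
      "\<lambda>w z. tensor_assoc (lact2 w z \<otimes> lact v c)"])
    (intro clin | simp add: lact2_pair lact3_pair tensor_assoc_pair)+

lemma ract3_assoc: "ract3 (tensor_assoc (z \<otimes> c)) (tensor_assoc (w \<otimes> v)) =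
    tensor_assoc (ract2 z w \<otimes> ract c v)"
  by (rule tensor_eqI2[of "\<lambda>w z. ract3 (tensor_assoc (z \<otimes> c)) (tensor_assoc (w \<otimes> v))"
      "\<lambda>w z. tensor_assoc (ract2 z w \<otimes> ract c v)"])
    (intro clin | simp add: ract2_pair ract3_pair tensor_assoc_pair)+

text \<open>Moving an action past the multiplication of the first two factors applies the coproduct
  to the first component of \<open>w\<close>. This is how the coproducts in the twist equation arise
  from a product of products.\<close>

lemma lact2_mult_12: "lact2 w (mult_12 t) =
    mult_12 (lact3 (tensor_assoc (tensor_map (comult U) id w)) t)"
proof -
  have "lact2 (u \<otimes> v) (mult_12 t) = mult_12 (lact3 (tensor_assoc (comult U u \<otimes> v)) t)" for u v
  proof (rule tensor_eqI3[of "\<lambda>t. lact2 (u \<otimes> v) (mult_12 t)"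
      "\<lambda>t. mult_12 (lact3 (tensor_assoc (comult U u \<otimes> v)) t)"])
    fix a b c
    have "mult_12 (lact3 (tensor_assoc (comult U u \<otimes> v)) (tensor_assoc ((a \<otimes> b) \<otimes> c))) =
        lact u (a * b) \<otimes> lact v c"
      unfolding lact3_assoc mult_12_assoc lact_times ..
    then show "lact2 (u \<otimes> v) (mult_12 (a \<otimes> (b \<otimes> c))) =
        mult_12 (lact3 (tensor_assoc (comult U u \<otimes> v)) (a \<otimes> (b \<otimes> c)))"
      by (simp add: mult_12_pair lact2_pair tensor_assoc_pair)
  qed (intro clin)+
  then show ?thesis
    by - (rule clinear_tensor_eqI[of "\<lambda>w. lact2 w (mult_12 t)"
        "\<lambda>w. mult_12 (lact3 (tensor_assoc (tensor_map (comult U) id w)) t)"],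
        (intro clin | simp add: tensor_map_pair[OF U.linear(1) clinear_id])+)
qed

lemma ract2_mult_12: "ract2 (mult_12 t) w =
    mult_12 (ract3 t (tensor_assoc (tensor_map (comult U) id w)))"
proof -
  have "ract2 (mult_12 t) (u \<otimes> v) = mult_12 (ract3 t (tensor_assoc (comult U u \<otimes> v)))" for u v
  proof (rule tensor_eqI3[of "\<lambda>t. ract2 (mult_12 t) (u \<otimes> v)"
      "\<lambda>t. mult_12 (ract3 t (tensor_assoc (comult U u \<otimes> v)))"])
    fix a b c
    have "mult_12 (ract3 (tensor_assoc ((a \<otimes> b) \<otimes> c)) (tensor_assoc (comult U u \<otimes> v))) =
        ract (a * b) u \<otimes> ract c v"
      unfolding ract3_assoc mult_12_assoc ract_times ..
    then show "ract2 (mult_12 (a \<otimes> (b \<otimes> c))) (u \<otimes> v) =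
        mult_12 (ract3 (a \<otimes> (b \<otimes> c)) (tensor_assoc (comult U u \<otimes> v)))"
      by (simp add: mult_12_pair ract2_pair tensor_assoc_pair)
  qed (intro clin)+
  then show ?thesis
    by - (rule clinear_tensor_eqI[of "\<lambda>w. ract2 (mult_12 t) w"
        "\<lambda>w. mult_12 (ract3 t (tensor_assoc (tensor_map (comult U) id w)))"],
        (intro clin | simp add: tensor_map_pair[OF U.linear(1) clinear_id])+)
qed

lemma lact2_mult_23: "lact2 w (mult_23 t) = mult_23 (lact3 (tensor_map id (comult U) w) t)"
proof -
  have "lact2 (u \<otimes> v) (mult_23 t) = mult_23 (lact3 (u \<otimes> comult U v) t)" for u v
    by (rule tensor_eqI3[of "\<lambda>t. lact2 (u \<otimes> v) (mult_23 t)"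
        "\<lambda>t. mult_23 (lact3 (u \<otimes> comult U v) t)"])
      (intro clin | simp add: mult_23_pair lact2_pair lact3_pair mult_A_pair lact_times)+
  then show ?thesis
    by - (rule clinear_tensor_eqI[of "\<lambda>w. lact2 w (mult_23 t)"
        "\<lambda>w. mult_23 (lact3 (tensor_map id (comult U) w) t)"],
        (intro clin | simp add: tensor_map_pair[OF clinear_id U.linear(1)])+)
qed

lemma ract2_mult_23: "ract2 (mult_23 t) w = mult_23 (ract3 t (tensor_map id (comult U) w))"
proof -
  have "ract2 (mult_23 t) (u \<otimes> v) = mult_23 (ract3 t (u \<otimes> comult U v))" for u v
    by (rule tensor_eqI3[of "\<lambda>t. ract2 (mult_23 t) (u \<otimes> v)"
        "\<lambda>t. mult_23 (ract3 t (u \<otimes> comult U v))"])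
      (intro clin | simp add: mult_23_pair ract2_pair ract3_pair mult_A_pair ract_times)+
  then show ?thesis
    by - (rule clinear_tensor_eqI[of "\<lambda>w. ract2 (mult_23 t) w"
        "\<lambda>w. mult_23 (ract3 t (tensor_map id (comult U) w))"],
        (intro clin | simp add: tensor_map_pair[OF clinear_id U.linear(1)])+)
qed

end

section \<open>The twisted product\<close>

context dynamical_setting
begin

text \<open>The product in the fibre over a point: at (\<lambda>, \<mu>) = (x, y) it is used with
  \<open>w = J y\<close> and \<open>w'\<close> the inverse of \<open>J x\<close>, the dynamical
  shifts being left to the arguments. Two independent tensors make it linear in each, so identities
  can be tested on pure tensors.\<close>

definition star :: "('u, 'u) tensor \<Rightarrow> ('u, 'u) tensor \<Rightarrow> 'a \<Rightarrow> 'a \<Rightarrow> 'a"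
  where "star w w' a b = mult_A (ract2 (lact2 w (a \<otimes> b)) w')"

lemma star_comps [clin]:
  "clinear f \<Longrightarrow> clinear (\<lambda>x. star (f x) w' a b)" "clinear f' \<Longrightarrow> clinear (\<lambda>x. star w (f' x) a b)"
  "clinear g \<Longrightarrow> clinear (\<lambda>x. star w w' (g x) b)" "clinear g' \<Longrightarrow> clinear (\<lambda>x. star w w' a (g' x))"
  unfolding star_def by (intro clin; assumption)+

lemma star_pair: "star (u \<otimes> v) (u' \<otimes> v') a b = ract (lact u a) u' * ract (lact v b) v'"
  by (simp add: star_def lact2_pair ract2_pair mult_A_pair)

lemma star_one:
  "star 1 (u' \<otimes> v') a b = ract a u' * ract b v'" "star (u \<otimes> v) 1 a b = lact u a * lact v b"
  by (simp_all add: one_tensor_def star_pair lact_one ract_one)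

text \<open>Under the coproduct right actions stay on the first legs and left actions on the second,
  so \<open>w'\<close> and \<open>w\<close> separate and \<open>1\<close> fills the vacant
  places.\<close>

lemma star_comult:
  "comult A (star w w' a b) = tensor_lift (\<lambda>a1 a2. tensor_lift (\<lambda>b1 b2.
    star 1 w' a1 b1 \<otimes> star w 1 a2 b2) (comult A b)) (comult A a)"
proof (rule tensor_eqI2[of "\<lambda>w w'. comult A (star w w' a b)"
    "\<lambda>w w'. tensor_lift (\<lambda>a1 a2. tensor_lift (\<lambda>b1 b2.
    star 1 w' a1 b1 \<otimes> star w 1 a2 b2) (comult A b)) (comult A a)"])
  fix u v u' v'
  have "comult A (star (u \<otimes> v) (u' \<otimes> v') a b)
    = tensor_lift (\<otimes>) (comult A (ract (lact u a) u' * ract (lact v b) v'))"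
    by (simp add: star_pair tensor_lift_pair_self)
  also have "\<dots> = tensor_lift
      (\<lambda>a1 a2. tensor_lift (\<lambda>b1 b2. (a1 * b1) \<otimes> (a2 * b2)) (comult A (ract (lact v b) v')))
      (comult A (ract (lact u a) u'))"
    by (rule A.comult_mult_lift) (intro clin)
  also have "\<dots> = tensor_lift
      (\<lambda>a1 a2. tensor_lift (\<lambda>b1 b2. (a1 * b1) \<otimes> (a2 * lact v b2)) (comult A (ract b v')))
      (comult A (ract (lact u a) u'))"
    unfolding lact_ract[symmetric] by (subst lact_lift[of _ v]) (intro clin refl)+
  also have "\<dots> = tensor_lift
      (\<lambda>a1 a2. tensor_lift (\<lambda>b1 b2. (a1 * ract b1 v') \<otimes> (a2 * lact v b2)) (comult A b))
      (comult A (ract (lact u a) u'))"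
    by (subst ract_lift[of _ b]) (intro clin refl)+
  also have "\<dots> = tensor_lift
      (\<lambda>a1 a2. tensor_lift (\<lambda>b1 b2. (ract a1 u' * ract b1 v') \<otimes> (lact u a2 * lact v b2))
      (comult A b))
      (comult A a)"
    by (subst ract_lift, intro clin, subst lact_lift, intro clin) (rule refl)
  finally show "comult A (star (u \<otimes> v) (u' \<otimes> v') a b) = tensor_lift (\<lambda>a1 a2. tensor_lift (\<lambda>b1 b2.
    star 1 (u' \<otimes> v') a1 b1 \<otimes> star (u \<otimes> v) 1 a2 b2) (comult A b)) (comult A a)"
    by (simp add: star_one)
qed (intro clin)+

text \<open>Each component of \<open>q\<close> acts from the left on a first leg and is carried over
  to a right action on the neighbouring second leg, where it precedes \<open>q'\<close>. Hence the
  order \<open>q * q'\<close>.\<close>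

lemma star_middle:
  "tensor_lift (\<lambda>a1 a2. tensor_lift (\<lambda>b1 b2. star q w' a1 b1 \<otimes> star w q' a2 b2) (comult A b))
      (comult A a)
  = tensor_lift (\<lambda>a1 a2. tensor_lift (\<lambda>b1 b2. star 1 w' a1 b1 \<otimes> star w (q * q') a2 b2)
      (comult A b)) (comult A a)"
proof -
  let ?l = "\<lambda>q q' w w'. tensor_lift
      (\<lambda>a1 a2. tensor_lift (\<lambda>b1 b2. star q w' a1 b1 \<otimes> star w q' a2 b2) (comult A b)) (comult A a)"
  have "?l (s \<otimes> t) (s' \<otimes> t') (u \<otimes> v) (u' \<otimes> v') = ?l 1 ((s \<otimes> t) * (s' \<otimes> t')) (u \<otimes> v) (u' \<otimes> v')"
    for s t s' t' u v u' v'
  proof -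
    have "?l (s \<otimes> t) (s' \<otimes> t') (u \<otimes> v) (u' \<otimes> v') = tensor_lift (\<lambda>a1 a2. tensor_lift (\<lambda>b1 b2.
        (ract (lact s a1) u' * ract b1 v') \<otimes> (ract (lact u a2) s' * ract (lact v (ract b2 t)) t'))
            (comult A b)) (comult A a)"
      unfolding star_pair by (subst middle_lift[of _ t]) (intro clin refl)+
    also have "\<dots> = tensor_lift (\<lambda>a1 a2. tensor_lift (\<lambda>b1 b2.
        (ract a1 u' * ract b1 v') \<otimes> (ract (lact u (ract a2 s)) s' * ract (lact v (ract b2 t)) t'))
            (comult A b)) (comult A a)"
      by (subst middle_lift[of _ s]) (intro clin refl)+
    finally show ?thesis
      by (simp add: tensor_pair_mult star_pair one_tensor_def ract_one lact_one lact_ract ract_mult)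
  qed
  then have "?l q q' (u \<otimes> v) (u' \<otimes> v') = ?l 1 (q * q') (u \<otimes> v) (u' \<otimes> v')" for u v u' v'
    by - (rule tensor_eqI2[of "\<lambda>q q'. ?l q q' (u \<otimes> v) (u' \<otimes> v')"
        "\<lambda>q q'. ?l 1 (q * q') (u \<otimes> v) (u' \<otimes> v')"], (intro clin | assumption)+)
  then show ?thesis
    by - (rule tensor_eqI2[of "\<lambda>w w'. ?l q q' w w'" "\<lambda>w w'. ?l 1 (q * q') w w'"],
        (intro clin | assumption)+)
qed

lemma counit_act: "counit A (lact u (ract a v)) = p (v * u) a"
  by (metis counit_lact counit_ract ract_mult)

text \<open>Under the counit both actions become arguments of the pairing, the right one first. On
  the diagonal \<lambda> = \<mu> the product \<open>w' * w\<close> is an inverse of \<open>J\<close>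
  times \<open>J\<close>, which is why the twist is invisible to the counit.\<close>

lemma star_counit: "counit A (star w w' a b) = tensor_lift (\<lambda>u v. p u a * p v b) (w' * w)"
proof (rule tensor_eqI2[of "\<lambda>w w'. counit A (star w w' a b)"
    "\<lambda>w w'. tensor_lift (\<lambda>u v. p u a * p v b) (w' * w)"])
  fix u v u' v'
  have "cbilinear (\<lambda>u v. p u a * p v b)" by (intro clin)
  then show "counit A (star (u \<otimes> v) (u' \<otimes> v') a b) =
      tensor_lift (\<lambda>u v. p u a * p v b) ((u' \<otimes> v') * (u \<otimes> v))"
    by (simp add: star_pair A.counit_mult tensor_pair_mult tensor_lift_pair counit_act
        flip: lact_ract)
qed (intro clin)+

section \<open>Contraction of the twist against the antipode\<close>

abbreviation S_U where "S_U \<equiv> antipode U"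
abbreviation S_A where "S_A \<equiv> antipode A"

lemma act_antipode: "ract (lact u (S_A a)) v = S_A (lact (S_U v) (ract a (S_U u)))"
  by (simp add: lact_antipode ract_antipode)

text \<open>Intended for \<open>w = J y\<close> and \<open>q = Q y\<close>: by the assumption this
  pair disappears and with it the dependence on y. The contraction of \<open>w'\<close> that remains
  is \<open>Q x\<close> when \<open>w'\<close> is the inverse of \<open>J x\<close>.\<close>

lemma star_antipode_right:
  assumes "tensor_lift (\<lambda>u v. u * q * S_U v) w = 1"
  shows "tensor_lift (\<lambda>a1 a2. star w w' a1 (S_A (ract (lact k a2) q))) (comult A a)
    = p (tensor_lift (\<lambda>u v. u * S_U v) w' * k) a *\<^sub>C 1"
proof -
  let ?E = "\<lambda>w. tensor_lift (\<lambda>u v. u * q * S_U v) w"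
  let ?l = "\<lambda>w w'. tensor_lift (\<lambda>a1 a2. star w w' a1 (S_A (ract (lact k a2) q))) (comult A a)"
  let ?r = "\<lambda>e w'. tensor_lift (\<lambda>u' v'. tensor_lift (\<lambda>a1 a2.
    ract (lact e a1) u' * S_A (lact (S_U v' * k) a2)) (comult A a)) w'"
  have "?l w w' = ?r (?E w) w'"
  proof (rule tensor_eqI2[of ?l "\<lambda>w w'. ?r (?E w) w'"])
    fix u v u' v'
    have bil: "cbilinear (\<lambda>u v. u * q * S_U v)"
      "cbilinear (\<lambda>u' v'. tensor_lift (\<lambda>a1 a2. ract (lact e a1) u' * S_A (lact (S_U v' * k) a2))
          (comult A a))" for e
      by (intro clin)+
    \<comment> \<open>Acting on an antipode places \<open>q * S_U v\<close> to the right of the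
      second leg; transferred to the left of the first leg it meets \<open>u\<close> and completes
      the contraction.\<close>
    have "?l (u \<otimes> v) (u' \<otimes> v')
      = tensor_lift (\<lambda>a1 a2. ract (lact u a1) u' * S_A (lact (S_U v' * k) (ract a2 (q * S_U v))))
          (comult A a)"
      by (simp add: star_pair act_antipode lact_mult lact_ract ract_mult)
    also have "\<dots> = tensor_lift
        (\<lambda>a1 a2. ract (lact u (lact (q * S_U v) a1)) u' * S_A (lact (S_U v' * k) a2)) (comult A a)"
      by (rule middle_lift[symmetric]) (intro clin)
    finally show "?l (u \<otimes> v) (u' \<otimes> v') = ?r (?E (u \<otimes> v)) (u' \<otimes> v')"
      unfolding tensor_lift_pair[OF bil(1)] tensor_lift_pair[OF bil(2)] by (simp add: lact_mult)
  qed (intro clin)+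
  also have "\<dots> = tensor_lift (\<lambda>u' v'. p (u' * S_U v' * k) a *\<^sub>C 1) w'"
  proof -
    have "tensor_lift (\<lambda>a1 a2. ract a1 u' * S_A (lact k' a2)) (comult A a) = p (u' * k') a *\<^sub>C 1"
        for u' k'
    proof -
      have "tensor_lift (\<lambda>a1 a2. ract a1 u' * S_A (lact k' a2)) (comult A a)
        = tensor_lift (\<lambda>a1 a2. a1 * S_A a2) (comult A (lact k' (ract a u')))"
        by (subst lact_lift, intro clin, subst ract_lift, intro clin) (rule refl)
      then show ?thesis by (simp add: A.antipode_right counit_act)
    qed
    then show ?thesis unfolding assms lact_one by (simp add: mult.assoc)
  qed
  also have "\<dots> = p (tensor_lift (\<lambda>u v. u * S_U v) w' * k) a *\<^sub>C 1"
    by (rule clinear_lift_commute[symmetric]) (intro clin)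
  finally show ?thesis .
qed

text \<open>The mirror image, with the roles of the tensors exchanged: \<open>k = K x\<close>
  cancels against the inverse of \<open>J x\<close>, and \<open>w = J y\<close> leaves
  \<open>K y\<close> behind.\<close>

lemma star_antipode_left:
  assumes "tensor_lift (\<lambda>u v. S_U u * k * v) w' = 1"
  shows "tensor_lift (\<lambda>a1 a2. star w w' (S_A (ract (lact k a1) q)) a2) (comult A a)
    = p (q * tensor_lift (\<lambda>u v. S_U u * v) w) a *\<^sub>C 1"
proof -
  let ?E = "\<lambda>w. tensor_lift (\<lambda>u v. S_U u * k * v) w"
  let ?l = "\<lambda>w w'. tensor_lift (\<lambda>a1 a2. star w w' (S_A (ract (lact k a1) q)) a2) (comult A a)"
  let ?r = "\<lambda>w e. tensor_lift (\<lambda>u v. tensor_lift (\<lambda>a1 a2.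
    S_A (ract (lact e a1) (q * S_U u)) * lact v a2) (comult A a)) w"
  have "?l w w' = ?r w (?E w')"
  proof (rule tensor_eqI2[of ?l "\<lambda>w w'. ?r w (?E w')"])
    fix u v u' v'
    have bil: "cbilinear (\<lambda>u v. S_U u * k * v)"
      "cbilinear (\<lambda>u v. tensor_lift (\<lambda>a1 a2. S_A (ract (lact e a1) (q * S_U u)) * lact v a2)
          (comult A a))" for e
      by (intro clin)+
    have "?l (u \<otimes> v) (u' \<otimes> v')
      = tensor_lift (\<lambda>a1 a2. S_A (ract (lact (S_U u' * k) a1) (q * S_U u)) * lact v (ract a2 v'))
          (comult A a)"
      by (simp add: star_pair act_antipode lact_mult lact_ract ract_mult)
    also have "\<dots> = tensor_lift
        (\<lambda>a1 a2. S_A (ract (lact (S_U u' * k) (lact v' a1)) (q * S_U u)) * lact v a2) (comult A a)"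
      by (rule middle_lift[symmetric]) (intro clin)
    finally show "?l (u \<otimes> v) (u' \<otimes> v') = ?r (u \<otimes> v) (?E (u' \<otimes> v'))"
      unfolding tensor_lift_pair[OF bil(1)] tensor_lift_pair[OF bil(2)] by (simp add: lact_mult)
  qed (intro clin)+
  also have "\<dots> = tensor_lift (\<lambda>u v. p (q * (S_U u * v)) a *\<^sub>C 1) w"
  proof -
    have "tensor_lift (\<lambda>a1 a2. S_A (ract a1 u) * lact v a2) (comult A a) = p (u * v) a *\<^sub>C 1"
        for u v
    proof -
      have "tensor_lift (\<lambda>a1 a2. S_A (ract a1 u) * lact v a2) (comult A a)
        = tensor_lift (\<lambda>a1 a2. S_A a1 * a2) (comult A (lact v (ract a u)))"
        by (subst lact_lift, intro clin, subst ract_lift, intro clin) (rule refl)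
      then show ?thesis by (simp add: A.antipode_left counit_act)
    qed
    then show ?thesis unfolding assms lact_one by (simp add: mult.assoc)
  qed
  also have "\<dots> = p (q * tensor_lift (\<lambda>u v. S_U u * v) w) a *\<^sub>C 1"
    by (rule clinear_lift_commute[symmetric]) (intro clin)
  finally show ?thesis .
qed

end

locale twist_setting = dynamical_setting U A p T chr
  for U :: "'u::complex_alg hopf" and A :: "'a::complex_alg hopf"
    and p :: "'u \<Rightarrow> 'a \<Rightarrow> complex"
    and T :: "'u set" and chr :: "'g::{finite, ab_group_add} \<Rightarrow> 'u \<Rightarrow> complex" +
  fixes J :: "'g \<Rightarrow> ('u, 'u) tensor"
  assumes twist: "dynamical_twist J"
begin

abbreviation J_inv where "J_inv x \<equiv> minv (J x)"

abbreviation eps1 :: "('u, 'u) tensor \<Rightarrow> 'u" where "eps1 \<equiv> tensor_lift (\<lambda>u v. counit U u *\<^sub>C v)"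
abbreviation eps2 :: "('u, 'u) tensor \<Rightarrow> 'u" where "eps2 \<equiv> tensor_lift (\<lambda>u v. counit U v *\<^sub>C u)"

lemma J_inverse: "J x * J_inv x = 1" "J_inv x * J x = 1"
  using twist by (simp_all add: dynamical_twist_def minv_inverse)

lemma J_weight: "t \<in> T \<Longrightarrow> J x * (t \<otimes> t) = (t \<otimes> t) * J x"
  using twist by (simp add: dynamical_twist_def)

lemma J_inv_weight: "t \<in> T \<Longrightarrow> J_inv x * (t \<otimes> t) = (t \<otimes> t) * J_inv x"
  by (rule inverse_commute[OF J_inverse J_weight])

lemma cbilinear_eps: "cbilinear (\<lambda>u v. counit U u *\<^sub>C v)" "cbilinear (\<lambda>u v. counit U v *\<^sub>C u)"
  by (intro clin)+

lemma eps_mult: "eps1 (w * w') = eps1 w * eps1 w'" "eps2 (w * w') = eps2 w * eps2 w'"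
proof -
  show "eps1 (w * w') = eps1 w * eps1 w'"
    by (rule tensor_eqI2[of "\<lambda>w w'. eps1 (w * w')" "\<lambda>w w'. eps1 w * eps1 w'"])
      (intro clin | simp add: tensor_pair_mult tensor_lift_pair[OF cbilinear_eps(1)] U.counit_mult
          mult_scaleC_left mult_scaleC_right mult.commute)+
  show "eps2 (w * w') = eps2 w * eps2 w'"
    by (rule tensor_eqI2[of "\<lambda>w w'. eps2 (w * w')" "\<lambda>w w'. eps2 w * eps2 w'"])
      (intro clin | simp add: tensor_pair_mult tensor_lift_pair[OF cbilinear_eps(2)] U.counit_mult
          mult_scaleC_left mult_scaleC_right mult.commute)+
qed

lemma eps_J: "eps1 (J x) = 1" "eps2 (J x) = 1"
  using twist by (simp_all add: dynamical_twist_def)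

lemma eps_one: "eps1 1 = 1" "eps2 1 = 1"
  by (simp_all add: one_tensor_def tensor_lift_pair cbilinear_eps U.counit_one scaleC_one)

lemma eps_J_inv: "eps1 (J_inv x) = 1" "eps2 (J_inv x) = 1"
  using eps_mult[of "J x" "J_inv x"] by (simp_all add: J_inverse eps_J eps_one)

text \<open>\<open>U\<close> acts on the unit of \<open>A\<close> through its counit, so a product
  with 1 only sees the counit contractions of \<open>w\<close> and \<open>w'\<close>.\<close>

lemma star_unit:
  assumes "eps1 w = 1" "eps1 w' = 1" "eps2 w = 1" "eps2 w' = 1"
  shows "star w w' 1 a = a" "star w w' a 1 = a"
proof -
  have "star w w' 1 a = ract (lact (eps1 w) a) (eps1 w')"
    by (rule tensor_eqI2[of "\<lambda>w w'. star w w' 1 a" "\<lambda>w w'. ract (lact (eps1 w) a) (eps1 w')"])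
      (intro clin | simp add: star_pair lact_unit ract_unit tensor_lift_pair[OF cbilinear_eps(1)]
          mult_scaleC_left
        cbilinear_simps[OF cbilinear_ract] cbilinear_simps[OF cbilinear_lact] mult.commute)+
  moreover have "star w w' a 1 = ract (lact (eps2 w) a) (eps2 w')"
    by (rule tensor_eqI2[of "\<lambda>w w'. star w w' a 1" "\<lambda>w w'. ract (lact (eps2 w) a) (eps2 w')"])
      (intro clin | simp add: star_pair lact_unit ract_unit tensor_lift_pair[OF cbilinear_eps(2)]
          mult_scaleC_right
        cbilinear_simps[OF cbilinear_ract] cbilinear_simps[OF cbilinear_lact] mult.commute)+
  ultimately show "star w w' 1 a = a" "star w w' a 1 = a"
    by (simp_all add: assms lact_one ract_one)
qed

section \<open>The twist equation weight by weight, and associativity\<close>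

abbreviation D1 where "D1 w \<equiv> tensor_assoc (tensor_map (comult U) id w)"
abbreviation D2 where "D2 w \<equiv> tensor_map id (comult U) w"
abbreviation pi3 where "pi3 \<alpha> \<equiv> 1 \<otimes> (1 \<otimes> \<pi> \<alpha>)"

lemma D_mult: "D1 (w * w') = D1 w * D1 w'" "D2 (w * w') = D2 w * D2 w'"
  by (simp_all add: tensor_map_mult U.linear clinear_id U.comult_mult tensor_assoc_mult)

lemma D_one: "D1 1 = 1" "D2 1 = 1"
  by (simp_all add: one_tensor_def tensor_map_pair U.linear clinear_id U.comult_one
      tensor_assoc_pair)

lemma pi3_commute: "pi3 \<alpha> * tensor_assoc (w \<otimes> 1) = tensor_assoc (w \<otimes> \<pi> \<alpha>)"
  "tensor_assoc (w \<otimes> 1) * pi3 \<alpha> = tensor_assoc (w \<otimes> \<pi> \<alpha>)"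
  by (simp_all add: tensor_assoc_pair[symmetric] tensor_pair_mult one_tensor_def[symmetric]
      flip: tensor_assoc_mult)

lemma twist_eq: "D1 (J x) * (\<Sum>\<alpha>\<in>UNIV. tensor_assoc (J (x + \<alpha>) \<otimes> \<pi> \<alpha>)) = D2 (J x) * (1 \<otimes> J x)"
proof -
  have "D1 (J x) * (\<Sum>\<alpha>\<in>UNIV. tensor_assoc (J (x + \<alpha>) \<otimes> \<pi> \<alpha>))
    = tensor_assoc (tensor_map (comult U) id (J x) * (\<Sum>\<alpha>\<in>UNIV. (J (x + \<alpha>) \<otimes> 1) * (1 \<otimes> \<pi> \<alpha>)))"
    by (simp add: tensor_assoc_mult tensor_pair_mult
        clinear_sum[OF clinear_tensor_assoc[OF clinear_id_fun]])
  then show ?thesis using twist by (simp add: dynamical_twist_def)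
qed

text \<open>Multiplying on the right by the projector in the third position selects one summand of
  \<open>J\<^sub>1\<^sub>2(\<lambda> + h)\<close>, turning the dynamical shift into the ordinary
  shift \<open>x + \<alpha>\<close>.\<close>

lemma twist_weight: "D1 (J x) * tensor_assoc (J (x + \<alpha>) \<otimes> \<pi> \<alpha>) = D2 (J x) * (1 \<otimes> J x) * pi3 \<alpha>"
proof -
  have "tensor_assoc (J (x + \<beta>) \<otimes> \<pi> \<beta>) * pi3 \<alpha> =
      (if \<beta> = \<alpha> then tensor_assoc (J (x + \<alpha>) \<otimes> \<pi> \<alpha>) else 0)" for \<beta>
    by (simp add: tensor_assoc_pair[symmetric] tensor_pair_mult one_tensor_def[symmetric]
        weight_proj_orth
        clinear_zero[OF clinear_tensor_assoc[OF clinear_id_fun]]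
            clinear_zero[OF cbilinear_comps(6)[OF clinear_id_fun]] flip: tensor_assoc_mult)
  then have "(\<Sum>\<beta>\<in>UNIV. tensor_assoc (J (x + \<beta>) \<otimes> \<pi> \<beta>)) * pi3 \<alpha> = tensor_assoc (J (x + \<alpha>) \<otimes> \<pi> \<alpha>)"
    by (simp add: sum_distrib_right)
  then show ?thesis unfolding twist_eq[symmetric] by (simp add: mult.assoc)
qed

text \<open>The inverted twist equation at third weight \<open>\<alpha>\<close>. With
  \<open>?Z\<close> the whole shifted factor and \<open>?Y\<close> a right inverse of the other side
  of the equation, \<open>?Z * ?Y\<close> equals \<open>D1 (J_inv x)\<close>; one summand of the
  shifted inverse cancels \<open>?Z\<close> up to the projector \<open>pi3 \<alpha>\<close>.\<close>

lemma twist_weight_inv: "tensor_assoc (J_inv (x + \<alpha>) \<otimes> \<pi> \<alpha>) * D1 (J_inv x) =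
    pi3 \<alpha> * (1 \<otimes> J_inv x) * D2 (J_inv x)"
proof -
  let ?Z = "\<Sum>\<beta>\<in>UNIV. tensor_assoc (J (x + \<beta>) \<otimes> \<pi> \<beta>)" and ?Y = "(1 \<otimes> J_inv x) * D2 (J_inv x)"
  have Y: "D2 (J x) * (1 \<otimes> J x) * ?Y = 1"
  proof -
    have "D2 (J x) * (1 \<otimes> J x) * ?Y = D2 (J x) * ((1 \<otimes> J x) * (1 \<otimes> J_inv x)) * D2 (J_inv x)"
      by (simp only: mult.assoc)
    also have "\<dots> = 1"
      by (simp add: tensor_pair_mult J_inverse D_one flip: one_tensor_def D_mult)
    finally show ?thesis .
  qed
  have "tensor_assoc (J_inv (x + \<alpha>) \<otimes> \<pi> \<alpha>) * tensor_assoc (J (x + \<beta>) \<otimes> \<pi> \<beta>) =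
      (if \<beta> = \<alpha> then pi3 \<alpha> else 0)" for \<beta>
    by (auto simp: tensor_pair_mult weight_proj_orth J_inverse one_tensor_def tensor_assoc_pair
        clinear_zero[OF clinear_tensor_assoc[OF clinear_id_fun]]
            clinear_zero[OF cbilinear_comps(6)[OF clinear_id_fun]] simp flip: tensor_assoc_mult)
  then have Z: "tensor_assoc (J_inv (x + \<alpha>) \<otimes> \<pi> \<alpha>) * ?Z = pi3 \<alpha>"
    by (simp add: sum_distrib_left)
  have "?Z * ?Y = D1 (J_inv x) * (D1 (J x) * ?Z) * ?Y"
    by (simp add: J_inverse D_one flip: mult.assoc D_mult)
  also have "\<dots> = D1 (J_inv x)"
    unfolding twist_eq by (simp only: mult.assoc Y[unfolded mult.assoc] mult_1_right)
  finally have "tensor_assoc (J_inv (x + \<alpha>) \<otimes> \<pi> \<alpha>) * D1 (J_inv x) =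
      tensor_assoc (J_inv (x + \<alpha>) \<otimes> \<pi> \<alpha>) * ?Z * ?Y"
    by (simp only: mult.assoc)
  then show ?thesis unfolding Z by (simp only: mult.assoc)
qed

text \<open>The shifts of the inner product are the weights of \<open>c\<close>:
  \<open>\<delta>\<close> for the left and \<open>\<gamma>\<close> for the right action. Since
  \<open>c\<close> is fixed by its projectors, these can be inserted in the third position, and the
  shifted twists become the factors in \<open>twist_weight\<close> and
  \<open>twist_weight_inv\<close>.\<close>

lemma star_assoc:
  assumes c: "c \<in> biweight \<gamma> \<delta>"
  shows "star (J y) (J_inv x) (star (J (y + \<delta>)) (J_inv (x + \<gamma>)) a b) c
    = star (J y) (J_inv x) a (star (J y) (J_inv x) b c)"
proof -
  let ?t = "a \<otimes> (b \<otimes> c)"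
  have c': "ract (lact (\<pi> \<delta>) c) (\<pi> \<gamma>) = c"
    using bicomp_of_biweight[OF c, of \<gamma> \<delta>] by (simp add: bicomp_def)
  have "mult_A (ract2 (lact2 (J (y + \<delta>)) (a \<otimes> b)) (J_inv (x + \<gamma>))) \<otimes> c
    = mult_12 (ract3 (lact3 (tensor_assoc (J (y + \<delta>) \<otimes> \<pi> \<delta>)) ?t)
        (tensor_assoc (J_inv (x + \<gamma>) \<otimes> \<pi> \<gamma>)))"
    by (simp add: tensor_assoc_pair[symmetric] lact3_assoc ract3_assoc mult_12_assoc c')
  then have "star (J y) (J_inv x) (star (J (y + \<delta>)) (J_inv (x + \<gamma>)) a b) c
    = mult_A (mult_12 (ract3 (lact3 (D1 (J y) * tensor_assoc (J (y + \<delta>) \<otimes> \<pi> \<delta>)) ?t)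
        (tensor_assoc (J_inv (x + \<gamma>) \<otimes> \<pi> \<gamma>) * D1 (J_inv x))))"
    by (simp add: star_def lact2_mult_12 ract2_mult_12 lact3_ract3 lact3_mult ract3_mult)
  also have "\<dots> = mult_A (mult_23
      (ract3 (lact3 (D2 (J y)) (ract3 (lact3 (1 \<otimes> J y) (ract3 (lact3 (pi3 \<delta>) ?t) (pi3 \<gamma>)))
      (1 \<otimes> J_inv x)))
        (D2 (J_inv x))))"
    unfolding twist_weight twist_weight_inv mult_A_assoc
        by (simp add: lact3_ract3 lact3_mult ract3_mult)
  also have "ract3 (lact3 (pi3 \<delta>) ?t) (pi3 \<gamma>) = ?t"
    by (simp add: lact3_pair ract3_pair lact2_pair ract2_pair lact_one ract_one c')
  also have "mult_A (mult_23
      (ract3 (lact3 (D2 (J y)) (ract3 (lact3 (1 \<otimes> J y) ?t) (1 \<otimes> J_inv x))) (D2 (J_inv x))))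
    = star (J y) (J_inv x) a (star (J y) (J_inv x) b c)"
    by (simp add: star_def lact3_pair ract3_pair lact_one ract_one mult_23_pair
        flip: lact2_mult_23 ract2_mult_23)
  finally show ?thesis .
qed

lemma star_biweight:
  assumes "a \<in> biweight \<alpha> \<beta>" "b \<in> biweight \<gamma> \<delta>"
  shows "star (J y) (J_inv x) a b \<in> biweight (\<alpha> + \<gamma>) (\<beta> + \<delta>)"
proof -
  have "lact t (star (J y) (J_inv x) a b) = chr (\<beta> + \<delta>) t *\<^sub>C star (J y) (J_inv x) a b"
    "ract (star (J y) (J_inv x) a b) t = chr (\<alpha> + \<gamma>) t *\<^sub>C star (J y) (J_inv x) a b" if t: "t \<in> T"
        for t
  proof -
    have m: "lact t (mult_A z) = mult_A (lact2 (t \<otimes> t) z)"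
        "ract (mult_A z) t = mult_A (ract2 z (t \<otimes> t))" for z
      by (rule clinear_tensor_eqI[of "\<lambda>z. lact t (mult_A z)" "\<lambda>z. mult_A (lact2 (t \<otimes> t) z)"]
          clinear_tensor_eqI[of "\<lambda>z. ract (mult_A z) t" "\<lambda>z. mult_A (ract2 z (t \<otimes> t))"];
        (intro clin)?; simp add: mult_A_pair lact_times ract_times U_grouplike[OF t])+
    have "lact t (star (J y) (J_inv x) a b) =
        mult_A (ract2 (lact2 ((t \<otimes> t) * J y) (a \<otimes> b)) (J_inv x))"
      by (simp add: star_def m lact2_mult lact2_ract2)
    also have "\<dots> = mult_A (ract2 (lact2 (J y) (chr \<beta> t *\<^sub>C chr \<delta> t *\<^sub>C (a \<otimes> b))) (J_inv x))"
      by (simp add: J_weight[OF t, symmetric] lact2_mult lact2_pair biweightD[OF assms(1) t]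
          biweightD[OF assms(2) t] tensor_pair_simps mult.commute[of "chr \<beta> t"]
          mult.commute[of "chr \<alpha> t"])
    also have "\<dots> = chr (\<beta> + \<delta>) t *\<^sub>C star (J y) (J_inv x) a b"
      by (simp add: star_def chr_add[OF t] cbilinear_simps[OF cbilinear_lact2]
          cbilinear_simps[OF cbilinear_ract2]
        clinear_scale[OF clinear_tensor_lift[OF cbilinear_times]])
    finally show "lact t (star (J y) (J_inv x) a b) = chr (\<beta> + \<delta>) t *\<^sub>C star (J y) (J_inv x) a b" .
    have "ract (star (J y) (J_inv x) a b) t =
        mult_A (lact2 (J y) (ract2 (a \<otimes> b) (J_inv x * (t \<otimes> t))))"
      by (simp add: star_def m ract2_mult lact2_ract2)
    also have "\<dots> = mult_A (lact2 (J y) (ract2 (chr \<alpha> t *\<^sub>C chr \<gamma> t *\<^sub>C (a \<otimes> b)) (J_inv x)))"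
      by (simp add: J_inv_weight[OF t] ract2_mult ract2_pair biweightD[OF assms(1) t]
          biweightD[OF assms(2) t] tensor_pair_simps mult.commute[of "chr \<beta> t"]
          mult.commute[of "chr \<alpha> t"])
    also have "\<dots> = chr (\<alpha> + \<gamma>) t *\<^sub>C star (J y) (J_inv x) a b"
      by (simp add: star_def chr_add[OF t] cbilinear_simps[OF cbilinear_lact2]
          cbilinear_simps[OF cbilinear_ract2] lact2_ract2
        clinear_scale[OF clinear_tensor_lift[OF cbilinear_times]])
    finally show "ract (star (J y) (J_inv x) a b) t = chr (\<alpha> + \<gamma>) t *\<^sub>C star (J y) (J_inv x) a b" .
  qed
  then show ?thesis by (simp add: biweight_def)
qed

section \<open>The elements \<open>K\<close> and \<open>Q\<close> of the twist\<close>

abbreviation K where "K x \<equiv> KJ J x"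
abbreviation Q where "Q x \<equiv> QJ J x"

text \<open>Since the antipode reverses products, contracting \<open>w\<close> around the
  contraction of \<open>w'\<close> is the contraction of \<open>w * w'\<close>; here that product is
  1. \<open>K_contract\<close> is the mirror image.\<close>

lemma Q_contract: "tensor_lift (\<lambda>u v. u * Q x * S_U v) (J x) = 1"
proof -
  let ?q = "\<lambda>w. tensor_lift (\<lambda>u v. u * S_U v) w"
  have bil: "cbilinear (\<lambda>u v. u * q * S_U v)" "cbilinear (\<lambda>u v. u * S_U v)" for q by (intro clin)+
  have "tensor_lift (\<lambda>u v. u * ?q w' * S_U v) w = ?q (w * w')" for w w'
    by (rule tensor_eqI2[of "\<lambda>w w'. tensor_lift (\<lambda>u v. u * ?q w' * S_U v) w" "\<lambda>w w'. ?q (w * w')"],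
        (intro clin)+, simp only: tensor_pair_mult tensor_lift_pair[OF bil(1)]
            tensor_lift_pair[OF bil(2)],
        simp add: U.antipode_mult mult.assoc)
  then show ?thesis
    by (simp add: QJ_def J_inverse)
        (simp add: one_tensor_def tensor_lift_pair[OF bil(2)] U.antipode_one)
qed

lemma K_contract: "tensor_lift (\<lambda>u v. S_U u * K x * v) (J_inv x) = 1"
proof -
  let ?q = "\<lambda>w. tensor_lift (\<lambda>u v. S_U u * v) w"
  have bil: "cbilinear (\<lambda>u v. S_U u * q * v)" "cbilinear (\<lambda>u v. S_U u * v)" for q by (intro clin)+
  have "tensor_lift (\<lambda>u v. S_U u * ?q w * v) w' = ?q (w * w')" for w w'
    by (rule tensor_eqI2[of "\<lambda>w w'. tensor_lift (\<lambda>u v. S_U u * ?q w * v) w'" "\<lambda>w w'. ?q (w * w')"],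
        (intro clin)+, simp only: tensor_pair_mult tensor_lift_pair[OF bil(1)]
            tensor_lift_pair[OF bil(2)],
        simp add: U.antipode_mult mult.assoc)
  then show ?thesis
    by (simp add: KJ_def J_inverse)
        (simp add: one_tensor_def tensor_lift_pair[OF bil(2)] U.antipode_one)
qed

text \<open>Multiplying a tensor by \<open>t \<otimes> t\<close> on one side leaves its contraction
  unchanged, as \<open>t\<close> meets its inverse in the middle; on the other side it conjugates
  the contraction. Zero weight of the twist equates the two.\<close>

lemma KQ_weight:
  assumes t: "t \<in> T"
  shows "K x * t = t * K x" "Q x * t = t * Q x"
proof -
  let ?k = "\<lambda>w. tensor_lift (\<lambda>u v. S_U u * v) w" and ?q = "\<lambda>w. tensor_lift (\<lambda>u v. u * S_U v) w"
  have bil: "cbilinear (\<lambda>u v. S_U u * v)" "cbilinear (\<lambda>u v. u * S_U v)" by (intro clin)+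
  have inv: "S_U t * (t * w) = w" "t * (S_U t * w) = w" for w
    by (simp_all add: antipode_T[OF t] flip: mult.assoc)
  have k1: "?k ((t \<otimes> t) * w) = ?k w" for w
    by (rule clinear_tensor_eqI[of "\<lambda>w. ?k ((t \<otimes> t) * w)" ?k])
      (intro clin | simp add: tensor_pair_mult tensor_lift_pair[OF bil(1)] U.antipode_mult
          mult.assoc inv)+
  have k2: "?k (w * (t \<otimes> t)) = S_U t * ?k w * t" for w
    by (rule clinear_tensor_eqI[of "\<lambda>w. ?k (w * (t \<otimes> t))" "\<lambda>w. S_U t * ?k w * t"])
      (intro clin | simp add: tensor_pair_mult tensor_lift_pair[OF bil(1)] U.antipode_mult
          mult.assoc)+
  have q1: "?q (w * (t \<otimes> t)) = ?q w" for w
    by (rule clinear_tensor_eqI[of "\<lambda>w. ?q (w * (t \<otimes> t))" ?q])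
      (intro clin | simp add: tensor_pair_mult tensor_lift_pair[OF bil(2)] U.antipode_mult
          mult.assoc inv)+
  have q2: "?q ((t \<otimes> t) * w) = t * ?q w * S_U t" for w
    by (rule clinear_tensor_eqI[of "\<lambda>w. ?q ((t \<otimes> t) * w)" "\<lambda>w. t * ?q w * S_U t"])
      (intro clin | simp add: tensor_pair_mult tensor_lift_pair[OF bil(2)] U.antipode_mult
          mult.assoc)+
  have "K x = S_U t * K x * t"
    unfolding KJ_def by (metis J_weight[OF t] k1 k2)
  then have "t * K x = t * (S_U t * K x * t)" by simp
  then show "K x * t = t * K x" by (simp add: mult.assoc inv)
  have "Q x = t * Q x * S_U t"
    unfolding QJ_def by (metis J_inv_weight[OF t] q1 q2)
  then have "Q x * t = (t * Q x * S_U t) * t" by simp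
  then show "Q x * t = t * Q x" by (simp add: mult.assoc antipode_T[OF t])
qed

text \<open>
  The map \<open>u \<otimes> v \<otimes> w \<mapsto> u S(v) w\<close> is applied to
  $\Delta_2(J^{-1}(\lambda)) \Delta_1(J(\lambda)) = J_{23}(\lambda) J_{12}^{-1}(\lambda + h^{(3)})$.
\<close>

lemma Q_K: "Q (x + \<alpha>) * K x * \<pi> \<alpha> = \<pi> \<alpha>"
proof -
  let ?\<psi> = "\<lambda>t. tensor_lift (\<lambda>u z. tensor_lift (\<lambda>v w. u * S_U v * w) z) t"
  let ?k = "\<lambda>w. tensor_lift (\<lambda>u v. S_U u * v) w" and ?q = "\<lambda>w. tensor_lift (\<lambda>u v. u * S_U v) w"
  have bil: "cbilinear (\<lambda>u v. S_U u * v)" "cbilinear (\<lambda>u v. u * S_U v)"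
    "cbilinear (\<lambda>u z. tensor_lift (\<lambda>v w. u * S_U v * w) z)" "cbilinear (\<lambda>v w. u * S_U v * w)" for u
    by (intro clin)+
  have \<psi>: "?\<psi> (u \<otimes> (v \<otimes> w)) = u * S_U v * w" for u v w
    by (simp add: tensor_lift_pair[OF bil(3)] tensor_lift_pair[OF bil(4)])
  have inv: "tensor_assoc (J (x + \<alpha>) \<otimes> \<pi> \<alpha>) * tensor_assoc (J_inv (x + \<alpha>) \<otimes> 1) = pi3 \<alpha>"
    by (simp add: tensor_pair_mult J_inverse one_tensor_def tensor_assoc_pair
        flip: tensor_assoc_mult)
  \<comment> \<open>The projector is written as shifted twist times inverse, so that
    \<open>twist_weight\<close> can replace \<open>D1 (J x)\<close> and the two \<open>D2\<close>
    factors cancel.\<close>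
  have "D2 (J_inv x) * D1 (J x) * pi3 \<alpha> =
      D2 (J_inv x) * (D1 (J x) * tensor_assoc (J (x + \<alpha>) \<otimes> \<pi> \<alpha>)) * tensor_assoc (J_inv (x + \<alpha>) \<otimes> 1)"
    by (simp only: mult.assoc inv)
  also have "\<dots> = (D2 (J_inv x) * D2 (J x)) * (1 \<otimes> J x) * (pi3 \<alpha> * tensor_assoc (J_inv (x + \<alpha>) \<otimes> 1))"
    unfolding twist_weight by (simp only: mult.assoc)
  also have "\<dots> = (1 \<otimes> J x) * tensor_assoc (J_inv (x + \<alpha>) \<otimes> \<pi> \<alpha>)"
    by (simp add: J_inverse D_one pi3_commute flip: D_mult)
  finally have main: "?\<psi> (D2 (J_inv x) * D1 (J x) * pi3 \<alpha>) =
      ?\<psi> ((1 \<otimes> J x) * tensor_assoc (J_inv (x + \<alpha>) \<otimes> \<pi> \<alpha>))"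
    by simp
  \<comment> \<open>For pure tensors the value is
    \<open>u s\<^sub>1 S(s\<^sub>2) S(v\<^sub>1) v\<^sub>2 t \<pi>\<close>: both antipode axioms
    apply and only counits remain, which are normalised for the twist.\<close>
  have "?\<psi> (D2 w' * D1 w * pi3 \<alpha>) = eps2 w' * eps1 w * \<pi> \<alpha>" for w w'
  proof (rule tensor_eqI2[of "\<lambda>w w'. ?\<psi> (D2 w' * D1 w * pi3 \<alpha>)" "\<lambda>w w'. eps2 w' * eps1 w * \<pi> \<alpha>"])
    fix s t u v
    have "?\<psi> ((u \<otimes> z) * tensor_assoc (y \<otimes> t) * pi3 \<alpha>) = tensor_lift (\<lambda>s1 s2. u * (s1 * S_U s2) *
        tensor_lift (\<lambda>v1 v2. S_U v1 * v2) z * t * \<pi> \<alpha>) y" for z y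
      by (rule tensor_eqI2[of "\<lambda>y z. ?\<psi> ((u \<otimes> z) * tensor_assoc (y \<otimes> t) * pi3 \<alpha>)"
          "\<lambda>y z. tensor_lift (\<lambda>s1 s2. u * (s1 * S_U s2) *
        tensor_lift (\<lambda>v1 v2. S_U v1 * v2) z * t * \<pi> \<alpha>) y"])
        ((intro clin)+, simp add: tensor_assoc_pair tensor_pair_mult \<psi>
            tensor_lift_pair[OF bil(1)], subst tensor_lift_pair, intro clin,
            simp add: U.antipode_mult mult.assoc)
    then have "?\<psi> ((u \<otimes> comult U v) * tensor_assoc (comult U s \<otimes> t) * pi3 \<alpha>) =
        counit U v *\<^sub>C counit U s *\<^sub>C (u * t * \<pi> \<alpha>)"
      by (simp add: U.antipode_left mult_scaleC_left mult_scaleC_right tensor_lift_scale)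
        (subst U.antipode_right_lift[of "\<lambda>r. u * r * t * \<pi> \<alpha>"], intro clin, simp)
    then show "?\<psi> (D2 (u \<otimes> v) * D1 (s \<otimes> t) * pi3 \<alpha>) = eps2 (u \<otimes> v) * eps1 (s \<otimes> t) * \<pi> \<alpha>"
      by (simp add: tensor_map_pair U.linear clinear_id tensor_lift_pair cbilinear_eps
          mult_scaleC_left mult_scaleC_right)
  qed (intro clin)+
  then have "?\<psi> (D2 (J_inv x) * D1 (J x) * pi3 \<alpha>) = \<pi> \<alpha>"
    by (simp add: eps_J eps_J_inv)
  \<comment> \<open>On this side antimultiplicativity of the antipode splits the middle factor, and
    the contractions of \<open>w'\<close> and \<open>w\<close> appear as consecutive
    factors.\<close>
  moreover have "?\<psi> ((1 \<otimes> w) * tensor_assoc (w' \<otimes> \<pi> \<alpha>)) = ?q w' * ?k w * \<pi> \<alpha>" for w w'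
    by (rule tensor_eqI2[of "\<lambda>w w'. ?\<psi> ((1 \<otimes> w) * tensor_assoc (w' \<otimes> \<pi> \<alpha>))"
        "\<lambda>w w'. ?q w' * ?k w * \<pi> \<alpha>"],
        (intro clin)+, simp only: tensor_assoc_pair tensor_pair_mult \<psi> tensor_lift_pair[OF bil(1)]
            tensor_lift_pair[OF bil(2)],
        simp add: U.antipode_mult mult.assoc)
  ultimately show ?thesis using main by (simp add: KJ_def QJ_def)
qed

end

section \<open>Coefficients in two dynamical variables\<close>

lemma sum_fun_apply: "(\<Sum>i\<in>I. f i) x = (\<Sum>i\<in>I. f i x)"
  by (induction I rule: infinite_finite_induct) simp_all

lemmas clinear_eval [clin] = clinear_fun_apply[OF clinear_id_fun]
  clinear_fun_apply[OF clinear_fun_apply[OF clinear_id_fun]]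

context dynamical_setting
begin

lemma biweight_zero: "0 \<in> biweight \<alpha> \<beta>"
  using subspace_biweight by (rule cs.subspace_0)

lemma biweight_scale: "a \<in> biweight \<alpha> \<beta> \<Longrightarrow> c *\<^sub>C a \<in> biweight \<alpha> \<beta>"
  by (rule cs.subspace_scale[OF subspace_biweight])

lemma subspace_biweightK: "cs.subspace (biweightK \<alpha> \<beta>)"
  using subspace_biweight[of \<alpha> \<beta>] by (simp add: cs.subspace_def biweightK_def scaleC_fun_def)

lemma biweightKD: "a \<in> biweightK \<alpha> \<beta> \<Longrightarrow> a x y \<in> biweight \<alpha> \<beta>"
  by (simp add: biweightK_def)

lemma biweightKI: "(\<And>x y. a x y \<in> biweight \<alpha> \<beta>) \<Longrightarrow> a \<in> biweightK \<alpha> \<beta>"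
  by (simp add: biweightK_def)

lemma bicomp_sum_biweight:
  assumes "\<And>\<gamma> \<delta>. c \<gamma> \<delta> \<in> biweight \<gamma> \<delta>"
  shows "bicomp \<alpha> \<beta> (\<Sum>\<gamma>\<in>UNIV. \<Sum>\<delta>\<in>UNIV. c \<gamma> \<delta>) = c \<alpha> \<beta>"
proof -
  have "bicomp \<alpha> \<beta> (\<Sum>\<gamma>\<in>UNIV. \<Sum>\<delta>\<in>UNIV. c \<gamma> \<delta>) = (\<Sum>\<gamma>\<in>UNIV. \<Sum>\<delta>\<in>UNIV. bicomp \<alpha> \<beta> (c \<gamma> \<delta>))"
    by (simp add: clinear_sum[OF clinear_bicomp[OF clinear_id_fun]])
  also have "\<dots> = (\<Sum>\<gamma>\<in>UNIV. \<Sum>\<delta>\<in>UNIV. if \<delta> = \<beta> then if \<gamma> = \<alpha> then c \<gamma> \<delta> else 0 else 0)"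
    by (intro sum.cong refl) (auto simp: bicomp_of_biweight[OF assms])
  finally show ?thesis by simp
qed

text \<open>Replaces the definite description by the pointwise projection. Uniqueness holds because
  projecting any decomposition at a point returns its components.\<close>

lemma compK_eq: "compK \<alpha> \<beta> a = (\<lambda>x y. bicomp \<alpha> \<beta> (a x y))"
proof -
  let ?V = "\<lambda>(\<gamma>, \<delta>). biweightK \<gamma> \<delta>"
  let ?c = "\<lambda>(\<gamma>, \<delta>) x y. bicomp \<gamma> \<delta> (a x y)"
  have "(THE c. (\<forall>i. c i \<in> ?V i) \<and> (\<Sum>i\<in>UNIV. c i) = a) = ?c"
  proof (rule the_equality)
    show "(\<forall>i. ?c i \<in> ?V i) \<and> (\<Sum>i\<in>UNIV. ?c i) = a"
      by (auto simp: biweightK_def bicomp_biweight sum_pair_UNIV sum_fun_apply fun_eq_iff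
          sum_bicomp)
    fix c
    assume c: "(\<forall>i. c i \<in> ?V i) \<and> (\<Sum>i\<in>UNIV. c i) = a"
    then have w: "c (\<gamma>, \<delta>) x y \<in> biweight \<gamma> \<delta>" for \<gamma> \<delta> x y
      by (auto simp: biweightK_def split_paired_all)
    have "a x y = (\<Sum>\<gamma>\<in>UNIV. \<Sum>\<delta>\<in>UNIV. c (\<gamma>, \<delta>) x y)" for x y
      using c by (auto simp: sum_pair_UNIV sum_fun_apply)
    then show "c = ?c"
      by (auto simp: fun_eq_iff bicomp_sum_biweight[of "\<lambda>\<gamma> \<delta>. c (\<gamma>, \<delta>) _ _", OF w])
  qed
  then show ?thesis by (simp add: compK_def component_def)
qed

lemma compK_biweightK: "compK \<alpha> \<beta> a \<in> biweightK \<alpha> \<beta>"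
  by (simp add: compK_eq biweightK_def bicomp_biweight)

lemma sum_compK: "(\<Sum>\<alpha>\<in>UNIV. \<Sum>\<beta>\<in>UNIV. compK \<alpha> \<beta> a) = a"
  by (simp add: compK_eq fun_eq_iff sum_fun_apply sum_bicomp)

lemma K_space_mem:
  assumes "cs.subspace V" "clinear f" "\<And>\<alpha> \<beta> a. a \<in> biweightK \<alpha> \<beta> \<Longrightarrow> f a \<in> V"
  shows "f a \<in> V"
proof -
  have "f a = (\<Sum>\<alpha>\<in>UNIV. \<Sum>\<beta>\<in>UNIV. f (compK \<alpha> \<beta> a))"
    by (subst sum_compK[symmetric]) (simp add: clinear_sum[OF assms(2)])
  also have "\<dots> \<in> V"
    by (intro cs.subspace_sum assms(1) assms(3)[OF compK_biweightK])
  finally show ?thesis .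
qed

lemma K_space_eqI:
  assumes "clinear f" "clinear g" "\<And>\<alpha> \<beta> a. a \<in> biweightK \<alpha> \<beta> \<Longrightarrow> f a = g a"
  shows "f a = g a"
proof -
  have "f a - g a \<in> {0}"
    by (rule K_space_mem[OF subspace_zero]) (intro clin assms | simp add: assms(3))+
  then show ?thesis by simp
qed

section \<open>Delta functions in the dynamical variables, and the comultiplication\<close>

definition point :: "'g \<Rightarrow> 'g \<Rightarrow> 'a \<Rightarrow> 'g \<Rightarrow> 'g \<Rightarrow> 'a"
  where "point \<sigma> \<tau> a = (\<lambda>x y. if x = \<sigma> \<and> y = \<tau> then a else 0)"

text \<open>The factors of the coproduct of \<open>point \<sigma> \<tau> a\<close>: a delta in the
  outer variable, constant in the variable facing the other factor. \<open>at_snd\<close> is its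
  counterpart, and \<open>const2\<close> is the middle factor of an iterated coproduct.\<close>

definition at_fst :: "'g \<Rightarrow> 'a \<Rightarrow> 'g \<Rightarrow> 'g \<Rightarrow> 'a"
  where "at_fst \<sigma> a = (\<lambda>x y. if x = \<sigma> then a else 0)"

definition at_snd :: "'g \<Rightarrow> 'a \<Rightarrow> 'g \<Rightarrow> 'g \<Rightarrow> 'a"
  where "at_snd \<tau> a = (\<lambda>x y. if y = \<tau> then a else 0)"

definition const2 :: "'a \<Rightarrow> 'g \<Rightarrow> 'g \<Rightarrow> 'a"
  where "const2 a = (\<lambda>x y. a)"

lemma clinear_point: "clinear (point \<sigma> \<tau>)" "clinear (at_fst \<sigma>)" "clinear (at_snd \<tau>)"
    "clinear const2"
  unfolding point_def at_fst_def at_snd_def const2_def by (intro clin)+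

lemmas point_comps [clin] = clinear_comp[OF clinear_point(1)] clinear_comp[OF clinear_point(2)]
  clinear_comp[OF clinear_point(3)] clinear_comp[OF clinear_point(4)]

lemma point_biweightK: "a \<in> biweight \<alpha> \<beta> \<Longrightarrow> point \<sigma> \<tau> a \<in> biweightK \<alpha> \<beta>"
  "a \<in> biweight \<alpha> \<beta> \<Longrightarrow> at_fst \<sigma> a \<in> biweightK \<alpha> \<beta>"
  "a \<in> biweight \<alpha> \<beta> \<Longrightarrow> at_snd \<tau> a \<in> biweightK \<alpha> \<beta>"
  by (simp_all add: biweightK_def point_def at_fst_def at_snd_def biweight_zero)

lemma sum_point: "(\<Sum>\<sigma>\<in>UNIV. \<Sum>\<tau>\<in>UNIV. point \<sigma> \<tau> (a \<sigma> \<tau>)) = a"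
proof -
  have "(if x = \<sigma> \<and> y = \<tau> then a \<sigma> \<tau> else 0) = (if \<tau> = y then if \<sigma> = x then a \<sigma> \<tau> else 0 else 0)"
      for x y \<sigma> \<tau>
    by auto
  then show ?thesis by (simp add: point_def fun_eq_iff sum_fun_apply)
qed

lemma biweightK_mem:
  assumes "cs.subspace V" "clinear f" "\<And>\<sigma> \<tau> b. b \<in> biweight \<alpha> \<beta> \<Longrightarrow> f (point \<sigma> \<tau> b) \<in> V"
    and "a \<in> biweightK \<alpha> \<beta>"
  shows "f a \<in> V"
proof -
  have "f a = (\<Sum>\<sigma>\<in>UNIV. \<Sum>\<tau>\<in>UNIV. f (point \<sigma> \<tau> (a \<sigma> \<tau>)))"
    by (subst sum_point[symmetric]) (simp add: clinear_sum[OF assms(2)])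
  also have "\<dots> \<in> V"
    by (intro cs.subspace_sum assms(1) assms(3) biweightKD[OF assms(4)])
  finally show ?thesis .
qed

lemma biweightK_eqI:
  assumes "clinear f" "clinear g" "\<And>\<sigma> \<tau> b. b \<in> biweight \<alpha> \<beta> \<Longrightarrow> f (point \<sigma> \<tau> b) = g (point \<sigma> \<tau> b)"
    and "a \<in> biweightK \<alpha> \<beta>"
  shows "f a = g a"
proof -
  have "f a - g a \<in> {0}"
    by (rule biweightK_mem[OF subspace_zero _ _ assms(4)]) (intro clin assms | simp add: assms(3))+
  then show ?thesis by simp
qed

lemma K_space_point_eqI:
  assumes "clinear f" "clinear g"
    and "\<And>\<alpha> \<beta> \<sigma> \<tau> b. b \<in> biweight \<alpha> \<beta> \<Longrightarrow> f (point \<sigma> \<tau> b) = g (point \<sigma> \<tau> b)"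
  shows "f a = g a"
proof (rule K_space_eqI[OF assms(1,2)])
  fix \<alpha> \<beta> a assume a: "a \<in> biweightK \<alpha> \<beta>"
  show "f a = g a"
    by (rule biweightK_eqI[OF assms(1,2) _ a]) (rule assms(3))
qed

lemma clinear_comultJ: "clinear comultJ"
  unfolding comultJ_def[abs_def] split_coefficients_def
  by (intro clin)

lemma comultJ_eq: "comultJ a =
    (\<Sum>\<sigma>\<in>UNIV. \<Sum>\<tau>\<in>UNIV. tensor_map (at_fst \<sigma>) (at_snd \<tau>) (comult A (a \<sigma> \<tau>)))"
  by (simp add: comultJ_def split_coefficients_def at_fst_def[abs_def] at_snd_def[abs_def])

lemma tensor_map_at_zero: "tensor_map (at_fst \<sigma>) (at_snd \<tau>) (comult A 0) = 0"
  by (simp add: clinear_zero[OF A.linear(1)]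
      clinear_zero[OF clinear_tensor_map[OF clinear_point(2,3)]])

lemma comultJ_point: "comultJ (point \<sigma> \<tau> a) = tensor_map (at_fst \<sigma>) (at_snd \<tau>) (comult A a)"
proof -
  have "tensor_map (at_fst \<sigma>') (at_snd \<tau>') (comult A (point \<sigma> \<tau> a \<sigma>' \<tau>'))
    = (if \<tau>' = \<tau> then if \<sigma>' = \<sigma> then tensor_map (at_fst \<sigma>') (at_snd \<tau>') (comult A a) else 0 else
        0)" for \<sigma>' \<tau>'
    by (auto simp: point_def tensor_map_at_zero)
  then show ?thesis by (simp add: comultJ_eq)
qed

lemma sum_at: "(\<Sum>\<sigma>\<in>UNIV. at_fst \<sigma> a) = const2 a" "(\<Sum>\<tau>\<in>UNIV. at_snd \<tau> a) = const2 a"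
  by (simp_all add: at_fst_def at_snd_def const2_def fun_eq_iff sum_fun_apply)

lemmas comultJ_comps [clin] = clinear_comp[OF clinear_comultJ]

text \<open>The deltas in the second variable sum to the constant 1, so the second factor becomes
  constant in both variables.\<close>

lemma comultJ_at_fst: "comultJ (at_fst \<sigma> a) = tensor_map (at_fst \<sigma>) const2 (comult A a)"
proof -
  have "tensor_map (at_fst \<sigma>') (at_snd \<tau>') (comult A (at_fst \<sigma> a \<sigma>' \<tau>'))
    = (if \<sigma>' = \<sigma> then tensor_map (at_fst \<sigma>') (at_snd \<tau>') (comult A a) else 0)" for \<sigma>' \<tau>'
    by (auto simp: at_fst_def[of \<sigma>] tensor_map_at_zero)
  then have "comultJ (at_fst \<sigma> a) = (\<Sum>\<tau>\<in>UNIV. tensor_map (at_fst \<sigma>) (at_snd \<tau>) (comult A a))"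
    unfolding comultJ_eq by (subst sum.swap) simp
  then show ?thesis
    by (simp add: tensor_map_def sum_at flip: tensor_lift_sum tensor_pair_sum_right)
qed

lemma comultJ_at_snd: "comultJ (at_snd \<tau> a) = tensor_map const2 (at_snd \<tau>) (comult A a)"
proof -
  have "tensor_map (at_fst \<sigma>') (at_snd \<tau>') (comult A (at_snd \<tau> a \<sigma>' \<tau>'))
    = (if \<tau>' = \<tau> then tensor_map (at_fst \<sigma>') (at_snd \<tau>') (comult A a) else 0)" for \<sigma>' \<tau>'
    by (auto simp: at_snd_def[of \<tau>] tensor_map_at_zero)
  then have "comultJ (at_snd \<tau> a) = (\<Sum>\<sigma>\<in>UNIV. tensor_map (at_fst \<sigma>) (at_snd \<tau>) (comult A a))"
    unfolding comultJ_eq by simp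
  then show ?thesis
    by (simp add: tensor_map_def sum_at flip: tensor_lift_sum tensor_pair_sum_left)
qed

text \<open>This holds before balancing: either bracketing puts deltas in the two outer factors and
  a constant in the middle one, so coassociativity of \<open>A\<close> suffices.\<close>

lemma comultJ_coassoc: "tensor_assoc (tensor_map comultJ id (comultJ a)) =
    tensor_map id comultJ (comultJ a)"
proof (rule K_space_point_eqI[of "\<lambda>a. tensor_assoc (tensor_map comultJ id (comultJ a))"
    "\<lambda>a. tensor_map id comultJ (comultJ a)"])
  show "clinear (\<lambda>a. tensor_assoc (tensor_map comultJ id (comultJ a)))"
      "clinear (\<lambda>a. tensor_map id comultJ (comultJ a))"
    by (intro clin)+
  fix \<sigma> \<tau> b
  let ?f = "at_fst \<sigma>" and ?s = "at_snd \<tau>"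
  have "tensor_assoc (tensor_map comultJ id (comultJ (point \<sigma> \<tau> b)))
    = tensor_lift (\<lambda>a c. tensor_assoc (comultJ (?f a) \<otimes> ?s c)) (comult A b)"
  proof -
    have "tensor_assoc (tensor_map comultJ id t) =
        tensor_lift (\<lambda>F G. tensor_assoc (comultJ F \<otimes> G)) t"
      for t :: "('g \<Rightarrow> 'g \<Rightarrow> 'a, 'g \<Rightarrow> 'g \<Rightarrow> 'a) tensor"
      unfolding tensor_map_def id_apply by (rule clinear_lift_commute) (intro clin)
    moreover have "cbilinear (\<lambda>F (G :: 'g \<Rightarrow> 'g \<Rightarrow> 'a). tensor_assoc (comultJ F \<otimes> G))" by (intro clin)
    ultimately show ?thesis
      by (simp add: comultJ_point tensor_lift_tensor_map[OF clinear_point(2,3)])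
  qed
  also have "\<dots> = tensor_lift (\<lambda>w c. tensor_lift (\<lambda>a b. ?f a \<otimes> (const2 b \<otimes> ?s c)) (comult A w))
      (comult A b)"
  proof -
    have "tensor_assoc (tensor_map ?f const2 z \<otimes> ?s c) =
        tensor_lift (\<lambda>a b. ?f a \<otimes> (const2 b \<otimes> ?s c)) z" for z c
      unfolding tensor_map_def
      by (subst clinear_lift_commute[of "\<lambda>z. tensor_assoc (z \<otimes> ?s c)"])
          (intro clin | simp add: tensor_assoc_pair)+
    then show ?thesis by (simp add: comultJ_at_fst)
  qed
  also have "\<dots> = tensor_lift (\<lambda>a w. tensor_lift (\<lambda>b c. ?f a \<otimes> (const2 b \<otimes> ?s c)) (comult A w))
      (comult A b)"
    by (rule A.coassoc_lift) (intro clin)+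
  also have "\<dots> = tensor_lift (\<lambda>a c. ?f a \<otimes> comultJ (?s c)) (comult A b)"
  proof -
    have "?f a \<otimes> tensor_map const2 ?s z = tensor_lift (\<lambda>b c. ?f a \<otimes> (const2 b \<otimes> ?s c)) z" for z a
      unfolding tensor_map_def by (rule clinear_lift_commute) (intro clin)
    then show ?thesis by (simp add: comultJ_at_snd)
  qed
  also have "\<dots> = tensor_map id comultJ (comultJ (point \<sigma> \<tau> b))"
  proof -
    have "cbilinear (\<lambda>(F :: 'g \<Rightarrow> 'g \<Rightarrow> 'a) G. F \<otimes> comultJ G)" by (intro clin)
    then show ?thesis
      by (simp add: comultJ_point tensor_map_def[of id comultJ]
          tensor_lift_tensor_map[OF clinear_point(2,3)])
  qed
  finally show "tensor_assoc (tensor_map comultJ id (comultJ (point \<sigma> \<tau> b))) =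
      tensor_map id comultJ (comultJ (point \<sigma> \<tau> b))" .
qed

end

section \<open>Difference operators and the counit\<close>

lemma at_one_diff_op: "at_one (diff_op \<alpha> f) = f"
  by (simp add: at_one_def diff_op_def)

lemma clinear_diff_op: "clinear (diff_op \<alpha>)"
  unfolding diff_op_def by (intro clin)

lemma clinear_shift: "clinear (shift \<alpha>)"
  unfolding shift_def by (intro clin)

lemma clinear_at_one: "clinear at_one"
  unfolding at_one_def by (intro clin)

lemmas diff_op_comps [clin] = clinear_comp[OF clinear_diff_op] clinear_comp[OF clinear_shift]
    clinear_comp[OF clinear_at_one]

lemma diff_op_alg_prd:
  "prd diff_op_alg (diff_op \<alpha> f) (diff_op \<beta> g) = diff_op (\<alpha> + \<beta>) (f * shift \<alpha> g)"
proof -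
  have "diff_op (\<gamma> + \<delta>) (diff_op \<alpha> f \<gamma> * shift \<gamma> (diff_op \<beta> g \<delta>))
    = (if \<delta> = \<beta> then if \<gamma> = \<alpha> then diff_op (\<alpha> + \<beta>) (f * shift \<alpha> g) else 0 else 0)" for \<gamma> \<delta>
    by (auto simp: diff_op_def fun_eq_iff shift_def)
  then show ?thesis by (simp add: diff_op_alg_def)
qed

context dynamical_setting
begin

lemma clinear_counitJ: "clinear counitJ"
  unfolding counitJ_def[abs_def] compK_eq
  by (intro clin)

lemma counitJ_biweightK:
  assumes "a \<in> biweightK \<alpha> \<beta>"
  shows "counitJ a = diff_op (- \<alpha>) (shift (- \<alpha>) (\<lambda>x. counit A (a x x)))"
proof -
  have "diff_op (- \<gamma>) (shift (- \<gamma>) (\<lambda>x. counit A (bicomp \<gamma> \<delta> (a x x))))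
    = (if \<delta> = \<beta> then if \<gamma> = \<alpha> then diff_op (- \<gamma>) (shift (- \<gamma>) (\<lambda>x. counit A (a x x))) else 0 else
        0)" for \<gamma> \<delta>
    by (auto simp: bicomp_of_biweight[OF biweightKD[OF assms]] clinear_zero[OF A.linear(2)]
        diff_op_def shift_def fun_eq_iff)
  then show ?thesis by (simp add: counitJ_def compK_eq)
qed

end

context twist_setting
begin

abbreviation "sJ x y \<equiv> star (J y) (J_inv x)"

lemma multJ_eq: "multJ J a b x y =
    (\<Sum>\<alpha>\<in>UNIV. \<Sum>\<beta>\<in>UNIV. sJ x y (a (x + \<alpha>) (y + \<beta>)) (bicomp \<alpha> \<beta> (b x y)))"
  by (simp add: multJ_def star_def compK_eq)

lemma cbilinear_multJ: "cbilinear (multJ J)"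
  unfolding multJ_eq[abs_def] by (intro clin)

lemmas multJ_comps [clin] = cbilinear_comp[OF cbilinear_multJ]

lemma sJ_zero: "sJ x y a 0 = 0" "sJ x y 0 b = 0"
  by (rule clinear_zero; intro clin)+

lemma multJ_biweightK:
  assumes "b \<in> biweightK \<alpha> \<beta>"
  shows "multJ J a b x y = sJ x y (a (x + \<alpha>) (y + \<beta>)) (b x y)"
proof -
  have "sJ x y (a (x + \<gamma>) (y + \<delta>)) (bicomp \<gamma> \<delta> (b x y))
    = (if \<delta> = \<beta> then if \<gamma> = \<alpha> then sJ x y (a (x + \<gamma>) (y + \<delta>)) (b x y) else 0 else 0)" for \<gamma> \<delta>
    by (auto simp: bicomp_of_biweight[OF biweightKD[OF assms]] sJ_zero)
  then show ?thesis by (simp add: multJ_eq)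
qed

lemma multJ_grade: "a \<in> biweightK \<alpha> \<beta> \<Longrightarrow> b \<in> biweightK \<gamma> \<delta> \<Longrightarrow> multJ J a b \<in> biweightK (\<alpha> + \<gamma>) (\<beta> + \<delta>)"
  by (intro biweightKI) (simp add: multJ_biweightK star_biweight biweightKD)

text \<open>Each product is shifted by the degree of its right factor, so \<open>b\<close> and
  \<open>c\<close> are reduced to homogeneous elements while \<open>a\<close> stays
  arbitrary.\<close>

lemma multJ_assoc: "multJ J (multJ J a b) c = multJ J a (multJ J b c)"
proof (rule K_space_eqI[of "\<lambda>c. multJ J (multJ J a b) c" "\<lambda>c. multJ J a (multJ J b c)"])
  fix \<gamma> \<delta> c assume c: "c \<in> biweightK \<gamma> \<delta>"
  show "multJ J (multJ J a b) c = multJ J a (multJ J b c)"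
  proof (rule K_space_eqI[of "\<lambda>b. multJ J (multJ J a b) c" "\<lambda>b. multJ J a (multJ J b c)"])
    fix \<alpha> \<beta> b assume b: "b \<in> biweightK \<alpha> \<beta>"
    show "multJ J (multJ J a b) c = multJ J a (multJ J b c)"
      by (simp add: fun_eq_iff multJ_biweightK[OF c] multJ_biweightK[OF b]
          multJ_biweightK[OF multJ_grade[OF b c]]
        star_assoc[OF biweightKD[OF c]] add_ac)
  qed (intro clin)+
qed (intro clin)+

lemma sJ_unit: "sJ x y 1 a = a" "sJ x y a 1 = a"
  by (rule star_unit; simp add: eps_J eps_J_inv)+

lemma sJ_scale: "sJ x y (c *\<^sub>C a) b = c *\<^sub>C sJ x y a b" "sJ x y a (c *\<^sub>C b) = c *\<^sub>C sJ x y a b"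
  by (rule clinear_scale; intro clin)+

lemma one_biweight: "c *\<^sub>C 1 \<in> biweight 0 0"
  by (rule biweight_scale) (simp add: biweight_def lact_unit ract_unit U_grouplike chr_zero)

lemma scalar_biweightK: "(\<lambda>x y. f x y *\<^sub>C 1) \<in> biweightK 0 0"
  by (intro biweightKI one_biweight)

lemma multJ_scalar_right: "multJ J a (\<lambda>x y. f x y *\<^sub>C 1) = (\<lambda>x y. f x y *\<^sub>C a x y)"
  by (simp add: fun_eq_iff multJ_biweightK[OF scalar_biweightK] sJ_scale sJ_unit)

lemma multJ_scalar_left: "a \<in> biweightK \<alpha> \<beta> \<Longrightarrow> multJ J (\<lambda>x y. f x y *\<^sub>C 1) a =
    (\<lambda>x y. f (x + \<alpha>) (y + \<beta>) *\<^sub>C a x y)"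
  by (simp add: fun_eq_iff multJ_biweightK sJ_scale sJ_unit)

lemma multJ_one: "multJ J (\<lambda>x y. 1) a = a" "multJ J a (\<lambda>x y. 1) = a"
proof -
  show "multJ J (\<lambda>x y. 1) a = a"
  proof (rule K_space_eqI[of "multJ J (\<lambda>x y. 1)" "\<lambda>a. a"])
    show "multJ J (\<lambda>x y. 1) a = a" if "a \<in> biweightK \<alpha> \<beta>" for \<alpha> \<beta> a
      using multJ_scalar_left[OF that, of "\<lambda>x y. 1"] by (simp add: scaleC_one)
  qed (intro clin)+
  show "multJ J a (\<lambda>x y. 1) = a"
    using multJ_scalar_right[of a "\<lambda>x y. 1"] by (simp add: scaleC_one)
qed

lemma algebroidJ_simps [simp]:
  "grade (algebroidJ J) = biweightK" "null (algebroidJ J) = {0}" "prd (algebroidJ J) = multJ J"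
  "unt (algebroidJ J) = (\<lambda>x y. 1)" "mom_l (algebroidJ J) = (\<lambda>f x y. f x *\<^sub>C 1)"
      "mom_r (algebroidJ J) = (\<lambda>f x y. f y *\<^sub>C 1)"
  by (simp_all add: algebroidJ_def)

lemma T_eq_algebroidJ: "T_eq (algebroidJ J) a b \<longleftrightarrow> a = b"
  by (simp add: T_eq_def)

text \<open>Provides injectivity of the moment maps: the class of algebras admits the zero algebra,
  but a counit with value 1 at the unit excludes it.\<close>

lemma A_one_nonzero: "(1 :: 'a) \<noteq> 0"
  using A.counit_one clinear_zero[OF A.linear(2)] by auto

lemma T_carrier_algebroidJ: "T_carrier (algebroidJ J) = UNIV"
proof -
  have "a \<in> cs.span (\<Union>\<alpha> \<beta>. biweightK \<alpha> \<beta>)" for a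
    by (rule K_space_mem[of _ "\<lambda>a. a"]) (auto intro: cs.span_base simp: clinear_id_fun)
  then show ?thesis by (auto simp: T_carrier_def)
qed

lemma T_algebra_algebroidJ: "T_algebra (algebroidJ J)"
proof (rule T_algebra.intro, goal_cases)
  case (1 \<alpha> \<beta>)
  then show ?case by (simp add: subspace_biweightK)
next
  case 2
  then show ?case by (simp add: subspace_zero)
next
  case (3 c \<alpha> \<beta>)
  then have c: "c \<gamma> \<delta> x y \<in> biweight \<gamma> \<delta>" for \<gamma> \<delta> x y
    by (simp add: biweightKD)
  have "c \<alpha> \<beta> x y = 0" for x y
  proof -
    have "(\<Sum>\<gamma>\<in>UNIV. \<Sum>\<delta>\<in>UNIV. c \<gamma> \<delta> x y) = 0"
      using 3(2) by (simp add: fun_eq_iff sum_fun_apply)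
    then show ?thesis
      using bicomp_sum_biweight[of "\<lambda>\<gamma> \<delta>. c \<gamma> \<delta> x y" \<alpha> \<beta>, OF c]
          clinear_zero[OF clinear_bicomp[OF clinear_id_fun]] by simp
  qed
  then show ?case by (simp add: fun_eq_iff)
next
  case 4
  then show ?case by (simp add: cbilinear_multJ)
next
  case (5 x y)
  then show ?case
    by (simp add: clinear_zero[OF multJ_comps(1)[OF clinear_id_fun]]
        clinear_zero[OF multJ_comps(2)[OF clinear_id_fun]])
next
  case (6 x \<alpha> \<beta> y \<gamma> \<delta>)
  then show ?case by (simp add: multJ_grade)
next
  case (7 x y z)
  then show ?case by (simp add: T_eq_algebroidJ multJ_assoc)
next
  case 8
  then show ?case using scalar_biweightK[of "\<lambda>x y. 1"] by (simp add: scaleC_one)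
next
  case (9 x)
  then show ?case by (simp add: T_eq_algebroidJ multJ_one)
next
  case 10
  then show ?case by simp (intro clin)
next
  case 11
  then show ?case by simp (intro clin)
next
  case (12 f)
  then show ?case by (simp add: scalar_biweightK)
next
  case (13 f)
  then show ?case by (simp add: scalar_biweightK)
next
  case (14 f g)
  then show ?case by (simp add: T_eq_algebroidJ multJ_scalar_right mult.commute)
next
  case (15 f g)
  then show ?case by (simp add: T_eq_algebroidJ multJ_scalar_right mult.commute)
next
  case 16
  then show ?case by (simp add: T_eq_algebroidJ scaleC_one)
next
  case 17
  then show ?case by (simp add: T_eq_algebroidJ scaleC_one)
next
  case (18 f)
  then show ?case by (simp add: fun_eq_iff A_one_nonzero)
next
  case (19 f)
  then show ?case by (simp add: fun_eq_iff A_one_nonzero)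
next
  case (20 f g)
  then show ?case by (simp add: T_eq_algebroidJ multJ_scalar_right mult.commute)
next
  case (21 a \<alpha> \<beta> f)
  then show ?case by (simp add: T_eq_algebroidJ multJ_scalar_right multJ_scalar_left shift_def)
next
  case (22 a \<alpha> \<beta> f)
  then show ?case by (simp add: T_eq_algebroidJ multJ_scalar_right multJ_scalar_left shift_def)
qed

end

section \<open>Comultiplication and counit\<close>

context twist_setting
begin

section \<open>The balanced tensor square\<close>

abbreviation "AA \<equiv> T_tensor (algebroidJ J) (algebroidJ J)"

lemma T_tensor_simps:
  "grade AA \<alpha> \<beta> = cs.span (\<Union>\<gamma>. {a \<otimes> b |a b. a \<in> biweightK \<alpha> \<gamma> \<and> b \<in> biweightK \<gamma> \<beta>})"
  "prd AA = tensor_prod (multJ J) (multJ J)"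
  "unt AA = (\<lambda>x y. 1) \<otimes> (\<lambda>x y. 1)"
  "mom_l AA f = (\<lambda>x y. f x *\<^sub>C 1) \<otimes> (\<lambda>x y. 1)"
  "mom_r AA f = (\<lambda>x y. 1) \<otimes> (\<lambda>x y. f y *\<^sub>C 1)"
  by (simp_all add: T_tensor_def)

lemma subspace_null_AA: "cs.subspace (null AA)"
  by (simp add: T_tensor_def cs.subspace_span)

lemma comultJ_grade:
  assumes "a \<in> biweightK \<alpha> \<beta>"
  shows "comultJ a \<in> grade AA \<alpha> \<beta>"
proof (rule biweightK_mem[OF _ clinear_comultJ _ assms])
  show sub: "cs.subspace (grade AA \<alpha> \<beta>)" by (simp add: T_tensor_simps cs.subspace_span)
  fix \<sigma> \<tau> b assume b: "b \<in> biweight \<alpha> \<beta>"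
  show "comultJ (point \<sigma> \<tau> b) \<in> grade AA \<alpha> \<beta>"
    unfolding comultJ_point
  proof (rule comult_biweight_mem[OF b clinear_tensor_map[OF clinear_point(2,3)] sub])
    fix \<gamma> c d assume "c \<in> biweight \<alpha> \<gamma>" "d \<in> biweight \<gamma> \<beta>"
    then have "at_fst \<sigma> c \<otimes> at_snd \<tau> d \<in> grade AA \<alpha> \<beta>"
      unfolding T_tensor_simps by (intro cs.span_base UN_I[of \<gamma>]) (auto intro: point_biweightK)
    then show "tensor_map (at_fst \<sigma>) (at_snd \<tau>) (c \<otimes> d) \<in> grade AA \<alpha> \<beta>"
      by (simp add: tensor_map_pair[OF clinear_point(2,3)])
  qed
qed

lemma T_carrier_AA: "T_carrier AA =
    cs.span (\<Union>\<alpha> \<gamma> \<beta>. {a \<otimes> b |a b. a \<in> biweightK \<alpha> \<gamma> \<and> b \<in> biweightK \<gamma> \<beta>})"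
  (is "_ = cs.span ?G")
proof
  show "T_carrier AA \<subseteq> cs.span ?G"
    unfolding T_carrier_def
  proof (rule cs.span_minimal[OF _ cs.subspace_span], intro UN_least)
    show "grade AA \<alpha> \<beta> \<subseteq> cs.span ?G" for \<alpha> \<beta>
      unfolding T_tensor_simps by (intro cs.span_mono) blast
  qed
  show "cs.span ?G \<subseteq> T_carrier AA"
  proof (rule cs.span_minimal, intro UN_least)
    show "{a \<otimes> b |a b. a \<in> biweightK \<alpha> \<gamma> \<and> b \<in> biweightK \<gamma> \<beta>} \<subseteq> T_carrier AA" for \<alpha> \<gamma> \<beta>
      unfolding T_carrier_def T_tensor_simps
      by (intro order.trans[OF _ cs.span_superset] order.trans[OF _ UN_upper[of \<alpha>]]
        order.trans[OF _ UN_upper[of \<beta>]] order.trans[OF _ UN_upper[of \<gamma>]]) auto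
    show "cs.subspace (T_carrier AA)" by (simp add: T_carrier_def cs.subspace_span)
  qed
qed

lemma T_carrier_AA_mem:
  assumes "clinear f" "cs.subspace V"
    and "\<And>\<alpha> \<gamma> \<beta> a b. a \<in> biweightK \<alpha> \<gamma> \<Longrightarrow> b \<in> biweightK \<gamma> \<beta> \<Longrightarrow> f (a \<otimes> b) \<in> V"
    and "x \<in> T_carrier AA"
  shows "f x \<in> V"
  using assms(4) unfolding T_carrier_AA
proof (induction rule: cs.span_induct_alt)
  case base
  then show ?case using clinear_zero[OF assms(1)] cs.subspace_0[OF assms(2)] by simp
next
  case (step c x y)
  then have "f x \<in> V" using assms(3) by auto
  then show ?case
    using step by (simp add: clinear_add[OF assms(1)] clinear_scale[OF assms(1)]
        cs.subspace_add[OF assms(2)] cs.subspace_scale[OF assms(2)])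
qed

lemma subspace_T_carrier: "cs.subspace (T_carrier B)"
  by (simp add: T_carrier_def cs.subspace_span)

lemma T_carrier_AA_pair: "a \<in> biweightK \<alpha> \<gamma> \<Longrightarrow> b \<in> biweightK \<gamma> \<beta> \<Longrightarrow> a \<otimes> b \<in> T_carrier AA"
  unfolding T_carrier_AA by (rule cs.span_base) blast

lemma comultJ_carrier: "comultJ a \<in> T_carrier AA"
proof (rule K_space_mem[OF subspace_T_carrier clinear_comultJ])
  fix \<alpha> \<beta> a assume "a \<in> biweightK \<alpha> \<beta>"
  then show "comultJ a \<in> T_carrier AA"
    using comultJ_grade unfolding T_carrier_def by (intro cs.span_base) blast
qed

lemma cbilinear_prd_AA: "cbilinear (tensor_prod (multJ J) (multJ J))"
  by (rule cbilinear_tensor_prod[OF cbilinear_multJ cbilinear_multJ])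

lemmas prd_AA_comps [clin] = cbilinear_comp[OF cbilinear_prd_AA]

lemma prd_AA_carrier:
  assumes "x \<in> T_carrier AA" "y \<in> T_carrier AA"
  shows "tensor_prod (multJ J) (multJ J) x y \<in> T_carrier AA"
proof (rule T_carrier_AA_mem[of "\<lambda>x. tensor_prod (multJ J) (multJ J) x y", OF _ subspace_T_carrier
    _ assms(1)])
  fix \<alpha> \<gamma> \<beta> a b assume ab: "a \<in> biweightK \<alpha> \<gamma>" "b \<in> biweightK \<gamma> \<beta>"
  show "tensor_prod (multJ J) (multJ J) (a \<otimes> b) y \<in> T_carrier AA"
  proof (rule T_carrier_AA_mem[of "\<lambda>y. tensor_prod (multJ J) (multJ J) (a \<otimes> b) y", OF _
      subspace_T_carrier _ assms(2)])
    fix \<alpha>' \<gamma>' \<beta>' c d assume cd: "c \<in> biweightK \<alpha>' \<gamma>'" "d \<in> biweightK \<gamma>' \<beta>'"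
    show "tensor_prod (multJ J) (multJ J) (a \<otimes> b) (c \<otimes> d) \<in> T_carrier AA"
      unfolding tensor_prod_pair[OF cbilinear_multJ cbilinear_multJ] 
      by (rule T_carrier_AA_pair[OF multJ_grade[OF ab(1) cd(1)] multJ_grade[OF ab(2) cd(2)]])
  qed (intro clin)
qed (intro clin)

text \<open>
  \<open>evaluate\<close> identifies the variable $\mu$ of the first factor with the variable $\lambda$ of the
  second one. Its kernel on the carrier is the balancing relation, because
  $a \otimes b \equiv \sum_z \delta_z(\mu) a \otimes \delta_z(\lambda) b$.
\<close>

definition evaluate :: "('g \<Rightarrow> 'g \<Rightarrow> 'a, 'g \<Rightarrow> 'g \<Rightarrow> 'a) tensor \<Rightarrow> 'g \<Rightarrow> 'g \<Rightarrow> 'g \<Rightarrow> ('a, 'a) tensor"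
  where "evaluate X x z y = tensor_lift (\<lambda>a b. a x z \<otimes> b z y) X"

lemma clinear_evaluate: "clinear (\<lambda>X. evaluate X x z y)"
  unfolding evaluate_def by (intro clin)

lemmas evaluate_comps [clin] = clinear_comp[OF clinear_evaluate]

lemma evaluate_pair: "evaluate (a \<otimes> b) x z y = a x z \<otimes> b z y"
proof -
  have "cbilinear (\<lambda>(a :: 'g \<Rightarrow> 'g \<Rightarrow> 'a) (b :: 'g \<Rightarrow> 'g \<Rightarrow> 'a). a x z \<otimes> b z y)" by (intro clin)
  then show ?thesis by (simp add: evaluate_def tensor_lift_pair)
qed

definition restr_snd :: "'g \<Rightarrow> ('g \<Rightarrow> 'g \<Rightarrow> 'a) \<Rightarrow> 'g \<Rightarrow> 'g \<Rightarrow> 'a"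
  where "restr_snd z a = (\<lambda>x y. if y = z then a x y else 0)"

definition restr_fst :: "'g \<Rightarrow> ('g \<Rightarrow> 'g \<Rightarrow> 'a) \<Rightarrow> 'g \<Rightarrow> 'g \<Rightarrow> 'a"
  where "restr_fst z a = (\<lambda>x y. if x = z then a x y else 0)"

lemma clinear_restr: "clinear (restr_snd z)" "clinear (restr_fst z)"
  unfolding restr_snd_def restr_fst_def by (intro clin)+

lemma null_AA_balance:
  assumes "a \<in> biweightK \<alpha> \<gamma>" "b \<in> biweightK \<gamma> \<beta>"
  shows "multJ J (\<lambda>x y. f y *\<^sub>C 1) a \<otimes> b - a \<otimes> multJ J (\<lambda>x y. f x *\<^sub>C 1) b \<in> null AA"
proof -
  have "multJ J (\<lambda>x y. f y *\<^sub>C 1) a \<otimes> b - a \<otimes> multJ J (\<lambda>x y. f x *\<^sub>C 1) b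
    \<in> {prd (algebroidJ J) (mom_r (algebroidJ J) f) a \<otimes> b - a \<otimes> prd (algebroidJ J)
        (mom_l (algebroidJ J) f) b |f a b.
      a \<in> grade (algebroidJ J) \<alpha> \<gamma> \<and> b \<in> grade (algebroidJ J) \<gamma> \<beta>}"
    unfolding algebroidJ_simps
        by (intro CollectI exI[of _ f] exI[of _ a] exI[of _ b] conjI refl assms)
  then show ?thesis
    unfolding T_tensor_def T_alg.select_convs
    by (intro cs.span_base UN_I[of \<alpha>] UN_I[of \<beta>] UN_I[of \<gamma>] UNIV_I UnI1)
qed

text \<open>Restriction to z is multiplication by a moment map. The delta sits at
  \<open>z + \<gamma>\<close> because left multiplication by a scalar function shifts it by the
  degree; the inner degree \<open>\<gamma>\<close> is common to both factors, so one function serves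
  both.\<close>

lemma restr_eq_multJ:
  assumes "a \<in> biweightK \<alpha> \<gamma>" "b \<in> biweightK \<gamma> \<beta>"
  shows "restr_snd z a = multJ J (\<lambda>x y. (if y = z + \<gamma> then 1 else 0) *\<^sub>C 1) a"
    "restr_fst z b = multJ J (\<lambda>x y. (if x = z + \<gamma> then 1 else 0) *\<^sub>C 1) b"
  by (simp_all add: multJ_scalar_left[OF assms(1), of "\<lambda>x y. if y = z + \<gamma> then 1 else 0"]
      multJ_scalar_left[OF assms(2), of "\<lambda>x y. if x = z + \<gamma> then 1 else 0"] restr_snd_def
          restr_fst_def fun_eq_iff scaleC_one)

lemma sum_restr_snd: "(\<Sum>z\<in>UNIV. restr_snd z a) = a"
  by (simp add: restr_snd_def fun_eq_iff sum_fun_apply)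

lemma restr_null:
  assumes "x \<in> T_carrier AA"
  shows "x - (\<Sum>z\<in>UNIV. tensor_map (restr_snd z) (restr_fst z) x) \<in> null AA"
proof (rule T_carrier_AA_mem[of "\<lambda>x. x - (\<Sum>z\<in>UNIV. tensor_map (restr_snd z) (restr_fst z) x)",
    OF _ subspace_null_AA _ assms])
  show "clinear (\<lambda>x. x - (\<Sum>z\<in>UNIV. tensor_map (restr_snd z) (restr_fst z) x))"
    by (intro clin clinear_restr)
  fix \<alpha> \<gamma> \<beta> a b assume ab: "a \<in> biweightK \<alpha> \<gamma>" "b \<in> biweightK \<gamma> \<beta>"
  have "restr_snd z a \<otimes> b - restr_snd z a \<otimes> restr_fst z b \<in> null AA" for z
  proof -
    have ra: "restr_snd z a \<in> biweightK \<alpha> \<gamma>"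
      using ab(1) by (simp add: biweightK_def restr_snd_def biweight_zero)
    \<comment> \<open>Balancing is applied to the already restricted first factor, on which the
      moment map acts as the identity; it then only changes \<open>b\<close>.\<close>
    have idem: "restr_snd z a = restr_snd z (restr_snd z a)"
      by (simp add: restr_snd_def fun_eq_iff)
    show ?thesis
      using null_AA_balance[OF ra ab(2), of "\<lambda>x. if x = z + \<gamma> then 1 else 0"]
      unfolding restr_eq_multJ(1)[OF ra ab(2), symmetric] restr_eq_multJ(2)[OF ab, symmetric]
          idem[symmetric] .
  qed
  then have "(\<Sum>z\<in>UNIV. restr_snd z a \<otimes> b - restr_snd z a \<otimes> restr_fst z b) \<in> null AA"
    by (intro cs.subspace_sum subspace_null_AA)
  then show "a \<otimes> b - (\<Sum>z\<in>UNIV. tensor_map (restr_snd z) (restr_fst z) (a \<otimes> b)) \<in> null AA"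
    by (simp add: tensor_map_pair[OF clinear_restr] sum_subtractf tensor_pair_sum_left[symmetric]
        sum_restr_snd)
qed

text \<open>Modulo balancing, \<open>x\<close> is the sum of its restrictions to equal inner
  variables, and that sum is rebuilt from the values of \<open>evaluate\<close>.\<close>

lemma null_AA_I:
  assumes "x \<in> T_carrier AA" "\<And>r z s. evaluate x r z s = 0"
  shows "x \<in> null AA"
proof -
  have "(\<Sum>z\<in>UNIV. tensor_map (restr_snd z) (restr_fst z) x)
    = (\<Sum>z\<in>UNIV. \<Sum>r\<in>UNIV. \<Sum>s\<in>UNIV. tensor_map (point r z) (point z s) (evaluate x r z s))"
  proof (rule clinear_tensor_eqI[of "\<lambda>x. \<Sum>z\<in>UNIV. tensor_map (restr_snd z) (restr_fst z) x"
        "\<lambda>x. \<Sum>z\<in>UNIV. \<Sum>r\<in>UNIV. \<Sum>s\<in>UNIV. tensor_map (point r z) (point z s) (evaluate x r z s)"])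
    fix a b
    have "(\<Sum>r\<in>UNIV. point r z (a r z)) = restr_snd z a"
        "(\<Sum>s\<in>UNIV. point z s (b z s)) = restr_fst z b" for z
    proof -
      have "(if x = r \<and> y = z then a r z else 0) =
          (if r = x then if y = z then a r z else 0 else 0)"
        "(if x = z \<and> y = r then b z r else 0) = (if r = y then if x = z then b z r else 0 else 0)"
            for x y r
        by auto
      then show "(\<Sum>r\<in>UNIV. point r z (a r z)) = restr_snd z a"
          "(\<Sum>s\<in>UNIV. point z s (b z s)) = restr_fst z b"
        by (simp_all add: point_def restr_snd_def restr_fst_def fun_eq_iff sum_fun_apply)
    qed
    then have "restr_snd z a \<otimes> restr_fst z b =
        (\<Sum>r\<in>UNIV. \<Sum>s\<in>UNIV. point r z (a r z) \<otimes> point z s (b z s))" for z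
      by (simp only: tensor_pair_sum_left[symmetric] tensor_pair_sum_right[symmetric])
    then show "(\<Sum>z\<in>UNIV. tensor_map (restr_snd z) (restr_fst z) (a \<otimes> b))
      = (\<Sum>z\<in>UNIV. \<Sum>r\<in>UNIV. \<Sum>s\<in>UNIV. tensor_map (point r z) (point z s) (evaluate (a \<otimes> b) r z s))"
      by (simp add: tensor_map_pair[OF clinear_restr] evaluate_pair
          tensor_map_pair[OF clinear_point(1) clinear_point(1)])
  qed (intro clin clinear_restr clinear_point)+
  also have "\<dots> = 0"
    by (simp add: assms(2) clinear_zero[OF
        clinear_tensor_map[OF clinear_point(1) clinear_point(1)]])
  finally show ?thesis using restr_null[OF assms(1)] by simp
qed

lemma T_eq_AA_I:
  assumes "x \<in> T_carrier AA" "y \<in> T_carrier AA" "\<And>r z s. evaluate x r z s = evaluate y r z s"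
  shows "T_eq AA x y"
  unfolding T_eq_def
  by (rule null_AA_I) (simp_all add: cs.subspace_diff[OF subspace_T_carrier] assms
      clinear_diff[OF clinear_evaluate])

lemma evaluate_comultJ: "evaluate (comultJ a) x z y = comult A (a x y)"
proof (rule K_space_point_eqI[of "\<lambda>a. evaluate (comultJ a) x z y" "\<lambda>a. comult A (a x y)"])
  fix \<sigma> \<tau> b
  have "evaluate (tensor_map (at_fst \<sigma>) (at_snd \<tau>) w) x z y = (if x = \<sigma> \<and> y = \<tau> then w else 0)"
      for w
  proof (rule clinear_tensor_eqI[of "\<lambda>w. evaluate (tensor_map (at_fst \<sigma>) (at_snd \<tau>) w) x z y"
      "\<lambda>w. if x = \<sigma> \<and> y = \<tau> then w else 0"])
    fix a b
    show "evaluate (tensor_map (at_fst \<sigma>) (at_snd \<tau>) (a \<otimes> b)) x z y =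
        (if x = \<sigma> \<and> y = \<tau> then a \<otimes> b else 0)"
      by (auto simp: tensor_map_pair[OF clinear_point(2,3)] evaluate_pair at_fst_def at_snd_def
        clinear_zero[OF cbilinear_comps(5)[OF clinear_id_fun]]
            clinear_zero[OF cbilinear_comps(6)[OF clinear_id_fun]])
  qed (intro clin clinear_point)+
  then show "evaluate (comultJ (point \<sigma> \<tau> b)) x z y = comult A (point \<sigma> \<tau> b x y)"
    unfolding comultJ_point by (auto simp: point_def clinear_zero[OF A.linear(1)])
qed (intro clin)+

text \<open>The inner variable z is arbitrary: it enters only through
  \<open>J z * J_inv z = 1\<close>, introduced by reading \<open>star_middle\<close> backwards. This
  z becomes the variable on which the two tensor factors are balanced.\<close>

lemma comult_sJ: "comult A (sJ x y a b) =
    tensor_lift (\<lambda>a1 a2. tensor_lift (\<lambda>b1 b2. sJ x z a1 b1 \<otimes> sJ z y a2 b2) (comult A b))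
    (comult A a)"
  by (subst star_middle) (simp only: J_inverse star_comult)

lemma comultJ_mult: "T_eq AA (comultJ (multJ J a b))
    (tensor_prod (multJ J) (multJ J) (comultJ a) (comultJ b))"
proof (rule T_eq_AA_I)
  let ?P = "tensor_prod (multJ J) (multJ J)"
  show "comultJ (multJ J a b) \<in> T_carrier AA" "?P (comultJ a) (comultJ b) \<in> T_carrier AA"
    by (intro comultJ_carrier prd_AA_carrier)+
  fix x z y
  show "evaluate (comultJ (multJ J a b)) x z y = evaluate (?P (comultJ a) (comultJ b)) x z y"
  proof (rule K_space_point_eqI[of "\<lambda>b. evaluate (comultJ (multJ J a b)) x z y"
      "\<lambda>b. evaluate (?P (comultJ a) (comultJ b)) x z y"])
    fix \<alpha>' \<beta>' \<sigma>' \<tau>' b assume b: "b \<in> biweight \<alpha>' \<beta>'"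
    let ?b = "point \<sigma>' \<tau>' b"
    show "evaluate (comultJ (multJ J a ?b)) x z y = evaluate (?P (comultJ a) (comultJ ?b)) x z y"
    proof (rule K_space_point_eqI[of "\<lambda>a. evaluate (comultJ (multJ J a ?b)) x z y"
        "\<lambda>a. evaluate (?P (comultJ a) (comultJ ?b)) x z y"])
      fix \<sigma> \<tau> and a :: 'a
      \<comment> \<open>The conditions under which the product of two delta functions survives at
        (x, y); the left factor is read at arguments shifted by the degree of
        \<open>b\<close>.\<close>
      let ?c = "x + \<alpha>' = \<sigma> \<and> y + \<beta>' = \<tau> \<and> x = \<sigma>' \<and> y = \<tau>'"
      let ?f = "\<lambda>w. tensor_map (at_fst \<sigma>) (at_snd \<tau>) w" and ?f' =
          "\<lambda>w. tensor_map (at_fst \<sigma>') (at_snd \<tau>') w"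
      let ?g = "\<lambda>v w. if ?c then
          tensor_lift (\<lambda>a1 a2. tensor_lift (\<lambda>b1 b2. sJ x z a1 b1 \<otimes> sJ z y a2 b2) w) v else 0"
      have "evaluate (?P (?f v) (?f' (comult A b))) x z y = ?g v (comult A b)" for v
      proof (rule comult_biweight_eqI[OF b, of "\<lambda>w. evaluate (?P (?f v) (?f' w)) x z y" "?g v"])
        fix \<gamma> b1 b2 assume b1: "b1 \<in> biweight \<alpha>' \<gamma>" and b2: "b2 \<in> biweight \<gamma> \<beta>'"
        show "evaluate (?P (?f v) (?f' (b1 \<otimes> b2))) x z y = ?g v (b1 \<otimes> b2)"
        proof (rule clinear_tensor_eqI[of "\<lambda>v. evaluate (?P (?f v) (?f' (b1 \<otimes> b2))) x z y"
            "\<lambda>v. ?g v (b1 \<otimes> b2)"])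
          fix a1 a2
          have bil: "cbilinear (\<lambda>a1 a2. tensor_lift (\<lambda>b1 b2. sJ x z a1 b1 \<otimes> sJ z y a2 b2)
              (b1 \<otimes> b2))"
            "cbilinear (\<lambda>b1 b2. sJ x z a1 b1 \<otimes> sJ z y a2 b2)" by (intro clin)+
          have "evaluate (?P (?f (a1 \<otimes> a2)) (?f' (b1 \<otimes> b2))) x z y
            = multJ J (at_fst \<sigma> a1) (at_fst \<sigma>' b1) x z \<otimes> multJ J (at_snd \<tau> a2) (at_snd \<tau>' b2) z y"
            by (simp add: tensor_map_pair[OF clinear_point(2,3)]
                tensor_prod_pair[OF cbilinear_multJ cbilinear_multJ] evaluate_pair)
          also have "\<dots> = sJ x z (at_fst \<sigma> a1 (x + \<alpha>') (z + \<gamma>)) (at_fst \<sigma>' b1 x z)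
              \<otimes> sJ z y (at_snd \<tau> a2 (z + \<gamma>) (y + \<beta>')) (at_snd \<tau>' b2 z y)"
            by (simp add: multJ_biweightK[OF point_biweightK(2)[OF b1]]
                multJ_biweightK[OF point_biweightK(3)[OF b2]])
          \<comment> \<open>The shift of z by \<open>\<gamma>\<close> has no effect, because
            \<open>at_fst\<close> and \<open>at_snd\<close> are constant in their inner
            variable.\<close>
          also have "\<dots> = (if ?c then sJ x z a1 b1 \<otimes> sJ z y a2 b2 else 0)"
            by (auto simp: at_fst_def at_snd_def sJ_zero
              clinear_zero[OF cbilinear_comps(5)[OF clinear_id_fun]]
                  clinear_zero[OF cbilinear_comps(6)[OF clinear_id_fun]])
          finally show "evaluate (?P (?f (a1 \<otimes> a2)) (?f' (b1 \<otimes> b2))) x z y = ?g (a1 \<otimes> a2) (b1 \<otimes> b2)"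
            unfolding tensor_lift_pair[OF bil(1)] tensor_lift_pair[OF bil(2)] .
        qed (intro clin clinear_point)+
      qed (intro clin clinear_point)+
      moreover have "evaluate (comultJ (multJ J (point \<sigma> \<tau> a) ?b)) x z y =
          ?g (comult A a) (comult A b)"
      proof -
        have "multJ J (point \<sigma> \<tau> a) ?b x y = (if ?c then sJ x y a b else 0)"
          unfolding multJ_biweightK[OF point_biweightK(1)[OF b]] by (auto simp: point_def sJ_zero)
        then have "comult A (multJ J (point \<sigma> \<tau> a) ?b x y) =
            (if ?c then comult A (sJ x y a b) else 0)"
          by (simp only: if_distrib[of "comult A"] clinear_zero[OF A.linear(1)])
        then show ?thesis
          by (simp only: evaluate_comultJ comult_sJ[where x = x and y = y and z = z])
      qed
      ultimately show "evaluate (comultJ (multJ J (point \<sigma> \<tau> a) ?b)) x z y =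
          evaluate (?P (comultJ (point \<sigma> \<tau> a)) (comultJ ?b)) x z y"
        by (simp only: comultJ_point)
    qed (intro clin)+
  qed (intro clin)+
qed

lemma comultJ_scalar: "comultJ (\<lambda>x y. (f x * g y) *\<^sub>C 1) = (\<lambda>x y. f x *\<^sub>C 1) \<otimes> (\<lambda>x y. g y *\<^sub>C 1)"
proof -
  have "comult A ((f x * g y) *\<^sub>C 1) = (f x * g y) *\<^sub>C (1 \<otimes> 1)" for x y
    by (simp add: clinear_scale[OF A.linear(1)] A.comult_one one_tensor_def)
  then show ?thesis by (simp add: comultJ_def split_coefficients_pair)
qed

lemma comultJ_morphism: "T_morphism (algebroidJ J) AA comultJ"
proof -
  have refl: "T_eq AA x x" for x
    using cs.subspace_0[OF subspace_null_AA] by (simp add: T_eq_def)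
  have "comultJ (\<lambda>x y. 1) = (\<lambda>x y. 1) \<otimes> (\<lambda>x y. 1)"
    "comultJ (\<lambda>x y. f x *\<^sub>C 1) = (\<lambda>x y. f x *\<^sub>C 1) \<otimes> (\<lambda>x y. 1)"
    "comultJ (\<lambda>x y. f y *\<^sub>C 1) = (\<lambda>x y. 1) \<otimes> (\<lambda>x y. f y *\<^sub>C 1)" for f
    using comultJ_scalar[of "\<lambda>x. 1" "\<lambda>y. 1"] comultJ_scalar[of f "\<lambda>y. 1"]
        comultJ_scalar[of "\<lambda>x. 1" f]
    by (simp_all add: scaleC_one)
  then show ?thesis
    unfolding T_morphism_def
    using cs.subspace_0[OF subspace_null_AA]
    by (auto simp: clinear_comultJ comultJ_grade clinear_zero[OF clinear_comultJ]
        T_tensor_simps(2-) comultJ_mult refl)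
qed

section \<open>Multiplicativity of the counit\<close>

lemma sJ_counit: "counit A (sJ x x a b) = counit A a * counit A b"
proof -
  have "cbilinear (\<lambda>u v. p u a * p v b)" by (intro clin)
  then show ?thesis
    unfolding star_counit J_inverse one_tensor_def by (simp add: tensor_lift_pair p_one_left)
qed

lemma cbilinear_diff_op_prd: "cbilinear (prd (diff_op_alg :: ('g, _) T_alg))"
proof -
  have [clin]: "cbilinear ((*) :: ('g \<Rightarrow> complex) \<Rightarrow> _)"
    by (rule cbilinearI) (simp_all add: fun_eq_iff scaleC_fun_def scaleC_complex_def algebra_simps)
  note [clin] = cbilinear_comp[OF this]
  show ?thesis
    unfolding diff_op_alg_def T_alg.simps by (intro clin)
qed

lemma counitJ_mult: "counitJ (multJ J a b) = prd diff_op_alg (counitJ a) (counitJ b)"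
proof (rule K_space_eqI[of "\<lambda>a. counitJ (multJ J a b)"
    "\<lambda>a. prd diff_op_alg (counitJ a) (counitJ b)"])
  note [clin] = cbilinear_comp[OF cbilinear_diff_op_prd] clinear_comp[OF clinear_counitJ]
  show "clinear (\<lambda>a. counitJ (multJ J a b))" "clinear (\<lambda>a. prd diff_op_alg (counitJ a) (counitJ b))"
    by (intro clin)+
  fix \<alpha> \<beta> a assume a: "a \<in> biweightK \<alpha> \<beta>"
  show "counitJ (multJ J a b) = prd diff_op_alg (counitJ a) (counitJ b)"
  proof (rule K_space_eqI[of "\<lambda>b. counitJ (multJ J a b)"
      "\<lambda>b. prd diff_op_alg (counitJ a) (counitJ b)"])
    show "clinear (\<lambda>b. counitJ (multJ J a b))"
        "clinear (\<lambda>b. prd diff_op_alg (counitJ a) (counitJ b))"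
      by (intro clin)+
    fix \<gamma> \<delta> b assume b: "b \<in> biweightK \<gamma> \<delta>"
    \<comment> \<open>The product reads \<open>a\<close> at the possibly off-diagonal point
      \<open>(x + \<gamma>, x + \<delta>)\<close>, but then the factor from \<open>b\<close>
      vanishes.\<close>
    have "counit A (b x x) = 0" if "\<gamma> \<noteq> \<delta>" for x
      using counit_biweight[OF biweightKD[OF b] that] .
    then have "counit A (multJ J a b x x) = counit A (a (x + \<gamma>) (x + \<gamma>)) * counit A (b x x)" for x
      by (cases "\<gamma> = \<delta>") (simp_all add: multJ_biweightK[OF b] sJ_counit)
    then show "counitJ (multJ J a b) = prd diff_op_alg (counitJ a) (counitJ b)"
      by (simp add: counitJ_biweightK[OF multJ_grade[OF a b]] counitJ_biweightK[OF a]
          counitJ_biweightK[OF b] diff_op_alg_prd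
        shift_def times_fun_def algebra_simps)
  qed
qed

lemma counitJ_scalar: "counitJ (\<lambda>x y. f x y *\<^sub>C 1) = diff_op 0 (\<lambda>x. f x x)"
  by (simp add: counitJ_biweightK[OF scalar_biweightK] clinear_scale[OF A.linear(2)] A.counit_one
      shift_def scaleC_complex_def)

lemma counitJ_grade:
  assumes "a \<in> biweightK \<alpha> \<beta>"
  shows "counitJ a \<in> grade diff_op_alg \<alpha> \<beta>"
proof (cases "\<alpha> = \<beta>")
  case False
  then have "counit A (a x x) = 0" for x
    by (rule counit_biweight[OF biweightKD[OF assms]])
  then show ?thesis
    using False by (simp add: diff_op_alg_def counitJ_biweightK[OF assms] shift_def)
        (simp add: diff_op_def fun_eq_iff)
qed (simp add: diff_op_alg_def counitJ_biweightK[OF assms])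

lemma counitJ_morphism: "T_morphism (algebroidJ J) diff_op_alg counitJ"
proof -
  have eq: "T_eq diff_op_alg x y \<longleftrightarrow> x = y" for x y :: "'g \<Rightarrow> 'g \<Rightarrow> complex"
    by (simp add: T_eq_def diff_op_alg_def)
  have "counitJ (\<lambda>x y. 1) = unt diff_op_alg" "counitJ (\<lambda>x y. f x *\<^sub>C 1) = mom_l diff_op_alg f"
    "counitJ (\<lambda>x y. f y *\<^sub>C 1) = mom_r diff_op_alg f" for f
    using counitJ_scalar[of "\<lambda>x y. 1"] counitJ_scalar[of "\<lambda>x y. f x"] counitJ_scalar[of "\<lambda>x y. f y"]
    by (simp_all add: diff_op_alg_def scaleC_one one_fun_def)
  then show ?thesis
    unfolding T_morphism_def
    by (auto simp: clinear_counitJ counitJ_grade clinear_zero[OF clinear_counitJ] counitJ_mult eq)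
      (simp add: diff_op_alg_def)
qed

end

section \<open>The antipode\<close>

context twist_setting
begin

lemmas counitJ_comps [clin] = clinear_comp[OF clinear_counitJ]

text \<open>The common reduction for the counit and antipode axioms: it remains to compute on delta
  functions whose coefficients have matching inner degree.\<close>

lemma lift_comultJ_point:
  assumes b: "b \<in> biweight \<alpha> \<beta>" and \<phi>: "cbilinear \<phi>" and h: "clinear h"
    and eq: "\<And>\<gamma> c d. c \<in> biweight \<alpha> \<gamma> \<Longrightarrow> d \<in> biweight \<gamma> \<beta> \<Longrightarrow> \<phi> (at_fst \<sigma> c) (at_snd \<tau> d) = h (c \<otimes> d)"
  shows "tensor_lift \<phi> (comultJ (point \<sigma> \<tau> b)) = h (comult A b)"
  unfolding comultJ_point
  by (rule comult_biweight_eqI[OF b, of "\<lambda>z. tensor_lift \<phi> (tensor_map (at_fst \<sigma>) (at_snd \<tau>) z)" h])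
    (intro clin clinear_point \<phi> h | simp add: tensor_map_pair[OF clinear_point(2,3)]
        tensor_lift_pair[OF \<phi>] eq)+

lemma at_one_counitJ:
  "a \<in> biweightK \<alpha> \<beta> \<Longrightarrow> at_one (counitJ a) = (\<lambda>x. counit A (a (x - \<alpha>) (x - \<alpha>)))"
  by (simp add: counitJ_biweightK at_one_diff_op shift_def)

lemma clinear_mom: "clinear (\<lambda>(f :: 'g \<Rightarrow> complex) (x :: 'g) (y :: 'g). f x *\<^sub>C (1 :: 'a))"
  "clinear (\<lambda>(f :: 'g \<Rightarrow> complex) (x :: 'g) (y :: 'g). f y *\<^sub>C (1 :: 'a))"
  by (intro clin)+

lemmas mom_comps [clin] = clinear_comp[OF clinear_mom(1)] clinear_comp[OF clinear_mom(2)]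

lemma counitJ_left: "tensor_lift (\<lambda>d b. multJ J (\<lambda>x y. at_one d x *\<^sub>C 1) b)
    (tensor_map counitJ id (comultJ a)) = a"
proof -
  let ?\<phi> = "\<lambda>d b. multJ J (\<lambda>x y. at_one d x *\<^sub>C 1) b"
  let ?\<psi> = "\<lambda>c d. ?\<phi> (counitJ c) d"
  have bil: "cbilinear ?\<phi>" "cbilinear ?\<psi>" by (intro clin)+
  have "tensor_lift ?\<psi> (comultJ a) = a"
  proof (rule K_space_point_eqI[of "\<lambda>a. tensor_lift ?\<psi> (comultJ a)" "\<lambda>a. a"])
    show "clinear (\<lambda>a. tensor_lift ?\<psi> (comultJ a))" by (intro clin)
    fix \<alpha> \<beta> \<sigma> \<tau> b assume b: "b \<in> biweight \<alpha> \<beta>"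
    have bil': "cbilinear (\<lambda>y z. counit A y *\<^sub>C (z :: 'a))" by (intro clin)
    have "tensor_lift ?\<psi> (comultJ (point \<sigma> \<tau> b)) =
        point \<sigma> \<tau> (tensor_lift (\<lambda>y z. counit A y *\<^sub>C z) (comult A b))"
    proof (rule lift_comultJ_point[OF b bil(2),
        of "\<lambda>z. point \<sigma> \<tau> (tensor_lift (\<lambda>y z. counit A y *\<^sub>C z) z)"])
      show "clinear (\<lambda>z. point \<sigma> \<tau> (tensor_lift (\<lambda>y z. counit A y *\<^sub>C z) z))" by (intro clin)
      fix \<gamma> c d assume c: "c \<in> biweight \<alpha> \<gamma>" and d: "d \<in> biweight \<gamma> \<beta>"
      have "?\<psi> (at_fst \<sigma> c) (at_snd \<tau> d) x y = point \<sigma> \<tau> (counit A c *\<^sub>C d) x y" for x y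
      proof -
        have "?\<psi> (at_fst \<sigma> c) (at_snd \<tau> d) x y =
            counit A (at_fst \<sigma> c (x + \<gamma> - \<alpha>) (x + \<gamma> - \<alpha>)) *\<^sub>C at_snd \<tau> d x y"
          by (simp add: at_one_counitJ[OF point_biweightK(2)[OF c]]
              multJ_scalar_left[OF point_biweightK(3)[OF d]])
        \<comment> \<open>The argument \<open>x + \<gamma> - \<alpha>\<close> is \<open>x\<close>
          when \<open>\<alpha> = \<gamma>\<close>; otherwise the counit of \<open>c\<close> is 0 and
          both sides vanish.\<close>
        also have "\<dots> = point \<sigma> \<tau> (counit A c *\<^sub>C d) x y"
          using counit_biweight[OF c] by (cases "\<alpha> = \<gamma>")
              (simp_all add: at_fst_def at_snd_def point_def clinear_zero[OF A.linear(2)])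
        finally show ?thesis .
      qed
      then show "?\<psi> (at_fst \<sigma> c) (at_snd \<tau> d) =
          point \<sigma> \<tau> (tensor_lift (\<lambda>y z. counit A y *\<^sub>C z) (c \<otimes> d))"
        by (simp add: fun_eq_iff tensor_lift_pair[OF bil'])
    qed
    then show "tensor_lift ?\<psi> (comultJ (point \<sigma> \<tau> b)) = point \<sigma> \<tau> b"
      by (simp add: A.counit_left)
  qed (intro clin)
  then show ?thesis
    by (simp add: tensor_lift_tensor_map[OF clinear_counitJ clinear_id bil(1)])
qed

lemma counitJ_right: "tensor_lift (\<lambda>b d. multJ J (\<lambda>x y. at_one d y *\<^sub>C 1) b)
    (tensor_map id counitJ (comultJ a)) = a"
proof -
  let ?\<phi> = "\<lambda>b d. multJ J (\<lambda>x y. at_one d y *\<^sub>C 1) b"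
  let ?\<psi> = "\<lambda>c d. ?\<phi> c (counitJ d)"
  have bil: "cbilinear ?\<phi>" "cbilinear ?\<psi>" by (intro clin)+
  have "tensor_lift ?\<psi> (comultJ a) = a"
  proof (rule K_space_point_eqI[of "\<lambda>a. tensor_lift ?\<psi> (comultJ a)" "\<lambda>a. a"])
    show "clinear (\<lambda>a. tensor_lift ?\<psi> (comultJ a))" by (intro clin)
    fix \<alpha> \<beta> \<sigma> \<tau> b assume b: "b \<in> biweight \<alpha> \<beta>"
    have bil': "cbilinear (\<lambda>y z. counit A z *\<^sub>C (y :: 'a))" by (intro clin)
    have "tensor_lift ?\<psi> (comultJ (point \<sigma> \<tau> b)) =
        point \<sigma> \<tau> (tensor_lift (\<lambda>y z. counit A z *\<^sub>C y) (comult A b))"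
    proof (rule lift_comultJ_point[OF b bil(2),
        of "\<lambda>z. point \<sigma> \<tau> (tensor_lift (\<lambda>y z. counit A z *\<^sub>C y) z)"])
      show "clinear (\<lambda>z. point \<sigma> \<tau> (tensor_lift (\<lambda>y z. counit A z *\<^sub>C y) z))" by (intro clin)
      fix \<gamma> c d assume c: "c \<in> biweight \<alpha> \<gamma>" and d: "d \<in> biweight \<gamma> \<beta>"
      have "?\<psi> (at_fst \<sigma> c) (at_snd \<tau> d) x y = point \<sigma> \<tau> (counit A d *\<^sub>C c) x y" for x y
      proof -
        have "?\<psi> (at_fst \<sigma> c) (at_snd \<tau> d) x y = counit A (at_snd \<tau> d y y) *\<^sub>C at_fst \<sigma> c x y"
          by (simp add: at_one_counitJ[OF point_biweightK(3)[OF d]]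
              multJ_scalar_left[OF point_biweightK(2)[OF c]])
        also have "\<dots> = point \<sigma> \<tau> (counit A d *\<^sub>C c) x y"
          by (simp add: at_fst_def at_snd_def point_def clinear_zero[OF A.linear(2)])
        finally show ?thesis .
      qed
      then show "?\<psi> (at_fst \<sigma> c) (at_snd \<tau> d) =
          point \<sigma> \<tau> (tensor_lift (\<lambda>y z. counit A z *\<^sub>C y) (c \<otimes> d))"
        by (simp add: fun_eq_iff tensor_lift_pair[OF bil'])
    qed
    then show "tensor_lift ?\<psi> (comultJ (point \<sigma> \<tau> b)) = point \<sigma> \<tau> b"
      by (simp add: A.counit_right)
  qed (intro clin)
  then show ?thesis
    by (simp add: tensor_lift_tensor_map[OF clinear_id clinear_counitJ bil(1)])
qed

lemma T_bialgebroid_algebroidJ: "T_bialgebroid (algebroidJ J) comultJ counitJ"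
proof (rule T_bialgebroid.intro[OF T_algebra_algebroidJ], rule T_bialgebroid_axioms.intro,
    goal_cases)
  case 1
  show ?case by (rule comultJ_morphism)
next
  case 2
  show ?case by (rule counitJ_morphism)
next
  case (3 a)
  show ?case by (simp add: comultJ_coassoc T_eq_def) (simp add: T_tensor_def cs.span_zero)
next
  case (4 a)
  show ?case by (simp add: T_eq_algebroidJ counitJ_left)
next
  case (5 a)
  show ?case by (simp add: T_eq_algebroidJ counitJ_right)
qed

section \<open>Degrees and moment maps under the antipode\<close>

abbreviation "SJ \<equiv> antipodeJ J"

lemma antipodeJ_eq: "SJ a x y = (\<Sum>\<alpha>\<in>UNIV. \<Sum>\<beta>\<in>UNIV. S_A
    (ract (lact (K (x - \<beta>)) (bicomp \<alpha> \<beta> (a (y - \<alpha>) (x - \<beta>)))) (Q y)))"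
  by (simp add: antipodeJ_def compK_eq)

lemma clinear_antipodeJ: "clinear SJ"
  unfolding antipodeJ_eq[abs_def] by (intro clin)

lemmas antipodeJ_comps [clin] = clinear_comp[OF clinear_antipodeJ]

lemma act_antipode_zero: "S_A (ract (lact u 0) v) = 0"
  by (rule clinear_zero[of "\<lambda>a. S_A (ract (lact u a) v)"]) (intro clin)

lemma antipodeJ_biweightK:
  assumes "a \<in> biweightK \<alpha> \<beta>"
  shows "SJ a x y = S_A (ract (lact (K (x - \<beta>)) (a (y - \<alpha>) (x - \<beta>))) (Q y))"
proof -
  have "S_A (ract (lact (K (x - \<delta>)) (bicomp \<gamma> \<delta> (a (y - \<gamma>) (x - \<delta>)))) (Q y))
    = (if \<delta> = \<beta> then if \<gamma> = \<alpha> then S_A (ract (lact (K (x - \<delta>)) (a (y - \<gamma>) (x - \<delta>))) (Q y)) else 0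
        else 0)" for \<gamma> \<delta>
    by (auto simp: bicomp_of_biweight[OF biweightKD[OF assms]] act_antipode_zero)
  then show ?thesis by (simp add: antipodeJ_eq)
qed

text \<open>The antipode exchanges the two actions and replaces \<open>t\<close> by its inverse;
  \<open>K\<close> and \<open>Q\<close> commute with \<open>T\<close> and leave the weights
  alone.\<close>

lemma antipode_biweight:
  assumes "a \<in> biweight \<alpha> \<beta>"
  shows "S_A (ract (lact (K x) a) (Q y)) \<in> biweight (- \<beta>) (- \<alpha>)"
proof -
  have "lact t (S_A (ract (lact (K x) a) (Q y))) = chr (- \<alpha>) t *\<^sub>C S_A (ract (lact (K x) a) (Q y))"
    "ract (S_A (ract (lact (K x) a) (Q y))) t = chr (- \<beta>) t *\<^sub>C S_A (ract (lact (K x) a) (Q y))"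
        if t: "t \<in> T" for t
  proof -
    note St = antipode_T(3)[OF t]
    have "lact t (S_A (ract (lact (K x) a) (Q y))) = S_A (ract (lact (K x) (ract a (S_U t))) (Q y))"
      by (simp add: lact_antipode lact_ract KQ_weight[OF St] flip: ract_mult)
    then show "lact t (S_A (ract (lact (K x) a) (Q y))) =
        chr (- \<alpha>) t *\<^sub>C S_A (ract (lact (K x) a) (Q y))"
      by (simp add: biweightD[OF assms St] chr_antipode[OF t] cbilinear_simps[OF cbilinear_lact]
          cbilinear_simps[OF cbilinear_ract] clinear_scale[OF A.linear(3)])
    have "ract (S_A (ract (lact (K x) a) (Q y))) t = S_A (ract (lact (K x) (lact (S_U t) a)) (Q y))"
      by (simp add: ract_antipode lact_ract KQ_weight[OF St] flip: lact_mult)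
    then show "ract (S_A (ract (lact (K x) a) (Q y))) t =
        chr (- \<beta>) t *\<^sub>C S_A (ract (lact (K x) a) (Q y))"
      by (simp add: biweightD[OF assms St] chr_antipode[OF t] cbilinear_simps[OF cbilinear_lact]
          cbilinear_simps[OF cbilinear_ract] clinear_scale[OF A.linear(3)])
  qed
  then show ?thesis by (simp add: biweight_def)
qed

lemma antipodeJ_grade: "a \<in> biweightK \<alpha> \<beta> \<Longrightarrow> SJ a \<in> biweightK (- \<beta>) (- \<alpha>)"
  by (intro biweightKI) (simp add: antipodeJ_biweightK antipode_biweight biweightKD)

lemma scale_biweightK: "a \<in> biweightK \<alpha> \<beta> \<Longrightarrow> (\<lambda>x y. f x y *\<^sub>C a x y) \<in> biweightK \<alpha> \<beta>"
  by (simp add: biweightK_def biweight_scale)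

lemma act_antipode_scale: "S_A (ract (lact u (c *\<^sub>C a)) v) = c *\<^sub>C S_A (ract (lact u a) v)"
  by (rule clinear_scale[of "\<lambda>a. S_A (ract (lact u a) v)"]) (intro clin)

lemma antipodeJ_mom_r: "SJ (multJ J (\<lambda>x y. f y *\<^sub>C 1) a) = multJ J (SJ a) (\<lambda>x y. f x *\<^sub>C 1)"
proof (rule K_space_eqI[of "\<lambda>a. SJ (multJ J (\<lambda>x y. f y *\<^sub>C 1) a)"
    "\<lambda>a. multJ J (SJ a) (\<lambda>x y. f x *\<^sub>C 1)"])
  fix \<alpha> \<beta> a assume a: "a \<in> biweightK \<alpha> \<beta>"
  show "SJ (multJ J (\<lambda>x y. f y *\<^sub>C 1) a) = multJ J (SJ a) (\<lambda>x y. f x *\<^sub>C 1)"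
    by (simp add: multJ_scalar_left[OF a, of "\<lambda>x y. f y"] multJ_scalar_right fun_eq_iff
        antipodeJ_biweightK[OF a]
      antipodeJ_biweightK[OF scale_biweightK[OF a]] act_antipode_scale)
qed (intro clin)+

lemma antipodeJ_mom_l: "SJ (multJ J a (\<lambda>x y. f x *\<^sub>C 1)) = multJ J (\<lambda>x y. f y *\<^sub>C 1) (SJ a)"
proof (rule K_space_eqI[of "\<lambda>a. SJ (multJ J a (\<lambda>x y. f x *\<^sub>C 1))"
    "\<lambda>a. multJ J (\<lambda>x y. f y *\<^sub>C 1) (SJ a)"])
  fix \<alpha> \<beta> a assume a: "a \<in> biweightK \<alpha> \<beta>"
  show "SJ (multJ J a (\<lambda>x y. f x *\<^sub>C 1)) = multJ J (\<lambda>x y. f y *\<^sub>C 1) (SJ a)"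
    by (simp add: multJ_scalar_left[OF antipodeJ_grade[OF a], of "\<lambda>x y. f y"] multJ_scalar_right
        fun_eq_iff antipodeJ_biweightK[OF a]
      antipodeJ_biweightK[OF scale_biweightK[OF a]] act_antipode_scale)
qed (intro clin)+

text \<open>The left weight of \<open>b\<close> permits inserting \<open>\<pi> \<beta>\<close> in
  front of it, which turns the pairing into one with the product evaluated in
  \<open>Q_K\<close>.\<close>

lemma p_biweight:
  assumes "b \<in> biweight \<alpha> \<beta>"
  shows "p (Q (x + \<beta>) * K x) b = counit A b"
proof -
  have "p (Q (x + \<beta>) * K x) b = p (Q (x + \<beta>) * K x) (lact (\<pi> \<beta>) b)"
    using weight_proj_biweight(1)[OF assms, of \<beta>] by simp
  also have "\<dots> = p (Q (x + \<beta>) * K x * \<pi> \<beta>) b"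
    by (simp add: lact_mult flip: counit_lact)
  also have "\<dots> = counit A b"
    using weight_proj_biweight(1)[OF assms, of \<beta>] by (simp add: Q_K flip: counit_lact)
  finally show ?thesis .
qed

lemma clinear_at_one_apply [clin]: "clinear f \<Longrightarrow> clinear (\<lambda>a. at_one (f a) x)"
  and clinear_shift_apply [clin]: "clinear g \<Longrightarrow> clinear (\<lambda>a. shift \<alpha> (g a) y)"
  using clinear_fun_apply[OF clinear_comp[OF clinear_at_one]]
      clinear_fun_apply[OF clinear_comp[OF clinear_shift]] by auto

lemma cbilinear_apply2: "cbilinear \<psi> \<Longrightarrow> cbilinear (\<lambda>c d. \<psi> c d x y)"
  unfolding cbilinear_def by (auto intro: clinear_fun_apply[OF clinear_fun_apply])

lemma antipodeJ_right:
  assumes a: "a \<in> biweightK \<alpha> \<beta>"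
  shows "tensor_lift (multJ J) (tensor_map id SJ (comultJ a)) = (\<lambda>x y. at_one (counitJ a) x *\<^sub>C 1)"
proof -
  let ?\<psi> = "\<lambda>c d. multJ J c (SJ d)"
  have "tensor_lift ?\<psi> (comultJ a) x y = at_one (counitJ a) x *\<^sub>C 1" for x y
  proof (rule biweightK_eqI[of "\<lambda>a. tensor_lift ?\<psi> (comultJ a) x y"
      "\<lambda>a. at_one (counitJ a) x *\<^sub>C 1", OF _ _ _ a])
    fix \<sigma> \<tau> b assume b: "b \<in> biweight \<alpha> \<beta>"
    \<comment> \<open>\<open>SJ d\<close> has degree (-\<beta>, -\<gamma>), so the product reads
      \<open>c\<close> with first argument \<open>x - \<beta>\<close>; the antipode exchanges
      variables and reads \<open>d\<close> with second argument \<open>x - \<beta>\<close>. Both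
      deltas are thus tested at the same point.\<close>
    let ?c = "x - \<beta> = \<sigma> \<and> x - \<beta> = \<tau>"
    let ?\<chi> = "\<lambda>c d. sJ x y c (S_A (ract (lact (K (x - \<beta>)) d) (Q y)))"
    have bil: "cbilinear (\<lambda>c d. ?\<psi> c d x y)" "cbilinear ?\<chi>"
      by (rule cbilinear_apply2; intro clin) (intro clin)
    have "tensor_lift (\<lambda>c d. ?\<psi> c d x y) (comultJ (point \<sigma> \<tau> b)) =
        (if ?c then tensor_lift ?\<chi> (comult A b) else 0)"
    proof (rule lift_comultJ_point[OF b bil(1), of "\<lambda>z. if ?c then tensor_lift ?\<chi> z else 0"])
      fix \<gamma> c d assume c: "c \<in> biweight \<alpha> \<gamma>" and d: "d \<in> biweight \<gamma> \<beta>"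
      have "?\<psi> (at_fst \<sigma> c) (at_snd \<tau> d) x y =
          sJ x y (at_fst \<sigma> c (x - \<beta>) (y - \<gamma>)) (SJ (at_snd \<tau> d) x y)"
        by (simp add: multJ_biweightK[OF antipodeJ_grade[OF point_biweightK(3)[OF d]]])
      also have "\<dots> = (if ?c then ?\<chi> c d else 0)"
        unfolding antipodeJ_biweightK[OF point_biweightK(3)[OF d]]
            by (auto simp: at_fst_def at_snd_def sJ_zero act_antipode_zero)
      finally show "?\<psi> (at_fst \<sigma> c) (at_snd \<tau> d) x y = (if ?c then tensor_lift ?\<chi> (c \<otimes> d) else 0)"
        by (simp only: tensor_lift_pair[OF bil(2)])
    qed (intro clin)
    also have "\<dots> = (if ?c then counit A b *\<^sub>C 1 else 0)"
      \<comment> \<open>The remaining pairing is with \<open>Q x * K (x - \<beta>)\<close>, which is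
        \<open>p_biweight\<close> at the base point \<open>x - \<beta>\<close>.\<close>
      unfolding star_antipode_right[OF Q_contract] QJ_def[symmetric]
      using p_biweight[OF b, of "x - \<beta>"] by (simp only: diff_add_cancel)
    also have "\<dots> = at_one (counitJ (point \<sigma> \<tau> b)) x *\<^sub>C 1"
      using counit_biweight[OF b] unfolding at_one_counitJ[OF point_biweightK(1)[OF b]]
      by (cases "\<alpha> = \<beta>") (auto simp: point_def clinear_zero[OF A.linear(2)])
    finally show "tensor_lift ?\<psi> (comultJ (point \<sigma> \<tau> b)) x y =
        at_one (counitJ (point \<sigma> \<tau> b)) x *\<^sub>C 1"
      by (subst clinear_lift_commute[OF clinear_eval(2)])
  next
    show "clinear (\<lambda>a. tensor_lift ?\<psi> (comultJ a) x y)"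
      by (rule clinear_fun_apply[OF clinear_fun_apply]) (intro clin)
  qed (intro clin)
  moreover have "tensor_lift (multJ J) (tensor_map id SJ (comultJ a)) = tensor_lift ?\<psi> (comultJ a)"
    by (simp add: tensor_lift_tensor_map[OF clinear_id clinear_antipodeJ cbilinear_multJ])
  ultimately show ?thesis by (simp add: fun_eq_iff)
qed

lemma antipodeJ_left:
  assumes a: "a \<in> biweightK \<alpha> \<beta>"
  shows "tensor_lift (multJ J) (tensor_map SJ id (comultJ a)) =
      (\<lambda>x y. shift \<alpha> (at_one (counitJ a)) y *\<^sub>C 1)"
proof -
  let ?\<psi> = "\<lambda>c d. multJ J (SJ c) d"
  have "tensor_lift ?\<psi> (comultJ a) x y = shift \<alpha> (at_one (counitJ a)) y *\<^sub>C 1" for x y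
  proof (rule biweightK_eqI[of "\<lambda>a. tensor_lift ?\<psi> (comultJ a) x y"
      "\<lambda>a. shift \<alpha> (at_one (counitJ a)) y *\<^sub>C 1", OF _ _ _ a])
    fix \<sigma> \<tau> b assume b: "b \<in> biweight \<alpha> \<beta>"
    \<comment> \<open>The product evaluates \<open>SJ c\<close> at
      \<open>(x + \<gamma>, y + \<beta>)\<close>, so the antipode reads \<open>c\<close> with first
      argument \<open>y + \<beta> - \<alpha>\<close> and produces \<open>K x\<close> and
      \<open>Q (y + \<beta>)\<close>. A nonzero counit forces \<open>\<alpha> = \<beta>\<close>, and
      then both conditions are tests at y.\<close>
    let ?c = "y + \<beta> - \<alpha> = \<sigma> \<and> y = \<tau>"
    let ?\<chi> = "\<lambda>c d. sJ x y (S_A (ract (lact (K x) c) (Q (y + \<beta>)))) d"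
    have bil: "cbilinear (\<lambda>c d. ?\<psi> c d x y)" "cbilinear ?\<chi>"
      by (rule cbilinear_apply2; intro clin) (intro clin)
    have "tensor_lift (\<lambda>c d. ?\<psi> c d x y) (comultJ (point \<sigma> \<tau> b)) =
        (if ?c then tensor_lift ?\<chi> (comult A b) else 0)"
    proof (rule lift_comultJ_point[OF b bil(1), of "\<lambda>z. if ?c then tensor_lift ?\<chi> z else 0"])
      fix \<gamma> c d assume c: "c \<in> biweight \<alpha> \<gamma>" and d: "d \<in> biweight \<gamma> \<beta>"
      have "?\<psi> (at_fst \<sigma> c) (at_snd \<tau> d) x y =
          sJ x y (SJ (at_fst \<sigma> c) (x + \<gamma>) (y + \<beta>)) (at_snd \<tau> d x y)"
        by (simp add: multJ_biweightK[OF point_biweightK(3)[OF d]])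
      also have "\<dots> = (if ?c then ?\<chi> c d else 0)"
        unfolding antipodeJ_biweightK[OF point_biweightK(2)[OF c]]
            by (auto simp: at_fst_def at_snd_def sJ_zero act_antipode_zero)
      finally show "?\<psi> (at_fst \<sigma> c) (at_snd \<tau> d) x y = (if ?c then tensor_lift ?\<chi> (c \<otimes> d) else 0)"
        by (simp only: tensor_lift_pair[OF bil(2)])
    qed (intro clin)
    also have "\<dots> = (if ?c then counit A b *\<^sub>C 1 else 0)"
      unfolding star_antipode_left[OF K_contract] KJ_def[symmetric] p_biweight[OF b] ..
    also have "\<dots> = shift \<alpha> (at_one (counitJ (point \<sigma> \<tau> b))) y *\<^sub>C 1"
      using counit_biweight[OF b] unfolding at_one_counitJ[OF point_biweightK(1)[OF b]]
      by (cases "\<alpha> = \<beta>") (auto simp: point_def shift_def clinear_zero[OF A.linear(2)])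
    finally show "tensor_lift ?\<psi> (comultJ (point \<sigma> \<tau> b)) x y =
        shift \<alpha> (at_one (counitJ (point \<sigma> \<tau> b))) y *\<^sub>C 1"
      by (subst clinear_lift_commute[OF clinear_eval(2)])
  next
    show "clinear (\<lambda>a. tensor_lift ?\<psi> (comultJ a) x y)"
      by (rule clinear_fun_apply[OF clinear_fun_apply]) (intro clin)
  qed (intro clin)
  moreover have "tensor_lift (multJ J) (tensor_map SJ id (comultJ a)) = tensor_lift ?\<psi> (comultJ a)"
    by (simp add: tensor_lift_tensor_map[OF clinear_antipodeJ clinear_id cbilinear_multJ])
  ultimately show ?thesis by (simp add: fun_eq_iff)
qed

lemma T_Hopf_algebroid_algebroidJ: "T_Hopf_algebroid (algebroidJ J) comultJ counitJ SJ"
proof (rule T_Hopf_algebroid.intro[OF T_bialgebroid_algebroidJ],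
    rule T_Hopf_algebroid_axioms.intro, goal_cases)
  case 1
  show ?case by (rule clinear_antipodeJ)
next
  case (2 a)
  show ?case by (simp add: T_carrier_algebroidJ)
next
  case (3 a)
  then show ?case by (simp add: clinear_zero[OF clinear_antipodeJ])
next
  case (4 a f)
  show ?case by (simp add: T_eq_algebroidJ antipodeJ_mom_r)
next
  case (5 a f)
  show ?case by (simp add: T_eq_algebroidJ antipodeJ_mom_l)
next
  case (6 a \<alpha> \<beta>)
  then show ?case by (simp add: T_eq_algebroidJ antipodeJ_right)
next
  case (7 a \<alpha> \<beta>)
  then show ?case by (simp add: T_eq_algebroidJ antipodeJ_left)
qed

text \<open>For constant coefficients only the argument of \<open>K\<close> still carries a shift,
  and that shift depends on the left weight \<open>\<beta>\<close> alone. Summing the components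
  over \<open>\<alpha>\<close> gives \<open>\<pi> \<beta> \<cdot> a\<close>, and the sum over
  \<open>\<beta>\<close> assembles \<open>K(\<lambda> - h)\<close>.\<close>

lemma antipodeJ_const: "SJ (\<lambda>_ _. a) x y = S_A (ract (lact (minus_h (KJ J) x) a) (Q y))"
proof -
  have "lact (\<pi> \<beta>) a = (\<Sum>\<alpha>\<in>UNIV. bicomp \<alpha> \<beta> a)" for \<beta>
  proof -
    have "lact (\<pi> \<beta>) a = (\<Sum>\<gamma>\<in>UNIV. \<Sum>\<delta>\<in>UNIV. lact (\<pi> \<beta>) (bicomp \<gamma> \<delta> a))"
      by (subst sum_bicomp[of a, symmetric])
          (simp add: clinear_sum[OF lact_comps(2)[OF clinear_id_fun]])
    also have "\<dots> = (\<Sum>\<gamma>\<in>UNIV. \<Sum>\<delta>\<in>UNIV. if \<delta> = \<beta> then bicomp \<gamma> \<delta> a else 0)"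
      by (intro sum.cong refl) (simp add: weight_proj_biweight(1)[OF bicomp_biweight])
    finally show ?thesis by simp
  qed
  then have "lact (minus_h (KJ J) x) a = (\<Sum>\<beta>\<in>UNIV. \<Sum>\<alpha>\<in>UNIV. lact (K (x - \<beta>)) (bicomp \<alpha> \<beta> a))"
    by (simp add: minus_h_def clinear_sum[OF lact_comps(1)[OF clinear_id_fun]] lact_mult
        clinear_sum[OF lact_comps(2)[OF clinear_id_fun]])
  then show ?thesis
    unfolding antipodeJ_eq
    by (subst sum.swap) (simp add: clinear_sum[OF A.linear(3)]
        clinear_sum[OF lact_comps(3)[OF clinear_id_fun]])
qed

end

theorem proposition3p12:
  fixes U :: "'u::complex_alg hopf" and A :: "'a::complex_alg hopf"
    and p :: "'u \<Rightarrow> 'a \<Rightarrow> complex"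
    and T :: "'u set" and chr :: "'g::{finite, ab_group_add} \<Rightarrow> 'u \<Rightarrow> complex"
    and J :: "'g \<Rightarrow> ('u, 'u) tensor"
  assumes "dynamical_setting U A p T chr"
    and "dynamical_data.dynamical_twist U T chr J"
  shows "T_Hopf_algebroid
        (dynamical_data.algebroidJ A p T chr J)
        (dynamical_data.comultJ A)
        (dynamical_data.counitJ A p T chr)
        (dynamical_data.antipodeJ U A p T chr J)
    \<and> (\<forall>\<alpha> \<beta>. \<forall>a \<in> dynamical_data.biweightK A p T chr \<alpha> \<beta>. \<forall>x y.
        dynamical_data.antipodeJ U A p T chr J a x y =
        antipode A (dynamical_data.ract A p
          (dynamical_data.lact A p (dynamical_data.KJ U J (x - \<beta>)) (a (y - \<alpha>) (x - \<beta>)))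
          (dynamical_data.QJ U J y)))
    \<and> (\<forall>a x y.
        dynamical_data.antipodeJ U A p T chr J (\<lambda>_ _. a) x y =
        antipode A (dynamical_data.ract A p
          (dynamical_data.lact A p (dynamical_data.minus_h T chr (dynamical_data.KJ U J) x) a)
          (dynamical_data.QJ U J y)))"
proof -
  interpret twist_setting U A p T chr J
    using assms by (intro twist_setting.intro twist_setting_axioms.intro)
  show ?thesis
    using T_Hopf_algebroid_algebroidJ antipodeJ_biweightK antipodeJ_const by blast
qed

end
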